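(* Let $Y$ be a compact hyperbolic Riemann surface, let $y\in Y$ and $r>0$, and let $\sigma=\sigma(r,y)$ be the geodesic circle of radius $r$ centered at $y$. There exists a constant $C''_\sigma>0$ such that for every eigenfunction $\phi_i$ of the Laplace-Beltrami operator on $Y$ with $\|\phi_i\|_{L^2(Y)}=1$, $$\left|p_0^{\sigma(r,y)}(\phi_i)\right|=\left|\int_{\sigma(r,y)}\phi_i(t_\sigma(\theta))\,d\sigma\right|\leq C''_\sigma .$$
   Context: $Y$ is a compact connected Riemann surface with a Riemannian metric of constant curvature $-1$ and volume element $dv$; eigenfunctions are normalized to have norm one in $L^2(Y,dv)$. For an orthonormal basis $u_1,u_2$ of $T_yY$, the geodesic circle $\sigma(r,y)$ is the closed curve $t_\sigma(\theta)=\exp_y\big(r(\cos(2\pi\theta)u_1+\sin(2\pi\theta)u_2)\big)$, $0\le\theta<1$ (for $r$ smaller than the injectivity radius at $y$ it is the set of points at distance $r$ from $y$). Here $d\sigma$ is the line element along this parametrized curve, so $\int_\sigma f\,d\sigma=2\pi\sinh(r)\int_0^1 f(t_\sigma(\theta))\,d\theta$. *)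

theory Defs
  imports "HOL-Analysis.Analysis"
begin

section \<open>Calculus in the coordinate plane\<close>

text \<open>
  The partial derivatives are real partial derivatives in the coordinate \<open>\<zeta> = x + \<i> y\<close>.
\<close>

definition pdx :: "(complex \<Rightarrow> 'b::real_normed_vector) \<Rightarrow> complex \<Rightarrow> 'b" where
  "pdx f \<zeta> = frechet_derivative f (at \<zeta>) 1"

definition pdy :: "(complex \<Rightarrow> 'b::real_normed_vector) \<Rightarrow> complex \<Rightarrow> 'b" where
  "pdy f \<zeta> = frechet_derivative f (at \<zeta>) \<i>"

definition laplacian :: "(complex \<Rightarrow> 'b::real_normed_vector) \<Rightarrow> complex \<Rightarrow> 'b" where
  "laplacian f \<zeta> = pdx (pdx f) \<zeta> + pdy (pdy f) \<zeta>"

text \<open>Real \<open>C\<^sup>k\<close> regularity on an open subset of the plane.\<close>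

primrec C_on :: "nat \<Rightarrow> (complex \<Rightarrow> 'b::real_normed_vector) \<Rightarrow> complex set \<Rightarrow> bool" where
  "C_on 0 f S \<longleftrightarrow> continuous_on S f"
| "C_on (Suc k) f S \<longleftrightarrow>
     (\<forall>\<zeta>\<in>S. f differentiable (at \<zeta>)) \<and> C_on k (pdx f) S \<and> C_on k (pdy f) S"

definition smooth_on :: "(complex \<Rightarrow> 'b::real_normed_vector) \<Rightarrow> complex set \<Rightarrow> bool" where
  "smooth_on f S \<longleftrightarrow> (\<forall>k. C_on k f S)"


section \<open>Riemann surfaces\<close>

text \<open>
  A chart is a pair of its domain and its coordinate map; the values of the coordinate map
  outside the domain are irrelevant.
\<close>

type_synonym 'a chart = "'a set \<times> ('a \<Rightarrow> complex)"

abbreviation cdom :: "'a chart \<Rightarrow> 'a set" where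
  "cdom c \<equiv> fst c"

abbreviation coord :: "'a chart \<Rightarrow> 'a \<Rightarrow> complex" where
  "coord c \<equiv> snd c"

definition cinv :: "'a chart \<Rightarrow> complex \<Rightarrow> 'a" where
  "cinv c = inv_into (cdom c) (coord c)"

definition transition :: "'a chart \<Rightarrow> 'a chart \<Rightarrow> complex \<Rightarrow> complex" where
  "transition c d = coord d \<circ> cinv c"

locale riemann_surface =
  fixes A :: "('a::t2_space) chart set"
  assumes connected_surface: "connected (UNIV :: 'a set)"
    and covering: "(\<Union>c\<in>A. cdom c) = UNIV"
    and open_cdom: "\<And>c. c \<in> A \<Longrightarrow> open (cdom c)"
    and open_coord_image: "\<And>c. c \<in> A \<Longrightarrow> open (coord c ` cdom c)"
    and homeomorphism_chart:
      "\<And>c. c \<in> A \<Longrightarrow> homeomorphism (cdom c) (coord c ` cdom c) (coord c) (cinv c)"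
    and holomorphic_transition:
      "\<And>c d. c \<in> A \<Longrightarrow> d \<in> A \<Longrightarrow>
         transition c d holomorphic_on (coord c ` (cdom c \<inter> cdom d))"

text \<open>
  Some chart around a point. It is only used to evaluate expressions that do not depend on the
  choice of the chart.
\<close>

definition chart_at :: "'a chart set \<Rightarrow> 'a \<Rightarrow> 'a chart" where
  "chart_at A p = (SOME c. c \<in> A \<and> p \<in> cdom c)"

text \<open>
  A real tangent vector at \<open>p\<close> is given by its coordinates in all charts around \<open>p\<close>
  (normalized to 0 in the other charts), which are related by the derivatives of the transition
  maps.
\<close>

definition tangent_space :: "'a chart set \<Rightarrow> 'a \<Rightarrow> ('a chart \<Rightarrow> complex) set" where
  "tangent_space A p = {u.
     (\<forall>c\<in>A. \<forall>d\<in>A. p \<in> cdom c \<and> p \<in> cdom d \<longrightarrow>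
        u d = deriv (transition c d) (coord c p) * u c) \<and>
     (\<forall>c. \<not> (c \<in> A \<and> p \<in> cdom c) \<longrightarrow> u c = 0)}"

definition velocity :: "'a chart set \<Rightarrow> (real \<Rightarrow> 'a) \<Rightarrow> real \<Rightarrow> 'a chart \<Rightarrow> complex" where
  "velocity A \<gamma> t = (\<lambda>c. if c \<in> A \<and> \<gamma> t \<in> cdom c
     then vector_derivative (coord c \<circ> \<gamma>) (at t) else 0)"


section \<open>Conformal metrics\<close>

text \<open>
  A Riemannian metric on a Riemann surface (compatible with the complex structure) is given in
  each chart \<open>c\<close> by a smooth positive density \<open>\<rho> c\<close> on the image of \<open>c\<close>:
  the metric is \<open>(\<rho> c)\<^sup>2 (dx\<^sup>2 + dy\<^sup>2)\<close>.
\<close>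

locale riemann_surface_metric = riemann_surface A
  for A :: "('a::t2_space) chart set" +
  fixes \<rho> :: "'a chart \<Rightarrow> complex \<Rightarrow> real"
  assumes density_pos: "\<And>c \<zeta>. c \<in> A \<Longrightarrow> \<zeta> \<in> coord c ` cdom c \<Longrightarrow> \<rho> c \<zeta> > 0"
    and density_smooth: "\<And>c. c \<in> A \<Longrightarrow> smooth_on (\<rho> c) (coord c ` cdom c)"
    and density_transition:
      "\<And>c d p. c \<in> A \<Longrightarrow> d \<in> A \<Longrightarrow> p \<in> cdom c \<Longrightarrow> p \<in> cdom d \<Longrightarrow>
         \<rho> c (coord c p) = \<rho> d (coord d p) * cmod (deriv (transition c d) (coord c p))"

text \<open>Gaussian curvature of the metric \<open>\<rho>\<^sup>2 (dx\<^sup>2 + dy\<^sup>2)\<close> on a plane domain.\<close>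

definition gauss_curvature :: "(complex \<Rightarrow> real) \<Rightarrow> complex \<Rightarrow> real" where
  "gauss_curvature \<rho> \<zeta> = - laplacian (\<lambda>z. ln (\<rho> z)) \<zeta> / (\<rho> \<zeta>)\<^sup>2"

locale compact_hyperbolic_surface = riemann_surface_metric A \<rho>
  for A :: "('a::t2_space) chart set" and \<rho> :: "'a chart \<Rightarrow> complex \<Rightarrow> real" +
  assumes compact_surface: "compact (UNIV :: 'a set)"
    and curvature:
      "\<And>c \<zeta>. c \<in> A \<Longrightarrow> \<zeta> \<in> coord c ` cdom c \<Longrightarrow> gauss_curvature (\<rho> c) \<zeta> = -1"

definition riem_inner :: "'a chart set \<Rightarrow> ('a chart \<Rightarrow> complex \<Rightarrow> real) \<Rightarrow> 'a \<Rightarrow>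
    ('a chart \<Rightarrow> complex) \<Rightarrow> ('a chart \<Rightarrow> complex) \<Rightarrow> real" where
  "riem_inner A \<rho> p u v =
     (let c = chart_at A p in (\<rho> c (coord c p))\<^sup>2 * (u c \<bullet> v c))"

definition orthonormal_frame :: "'a chart set \<Rightarrow> ('a chart \<Rightarrow> complex \<Rightarrow> real) \<Rightarrow> 'a \<Rightarrow>
    ('a chart \<Rightarrow> complex) \<Rightarrow> ('a chart \<Rightarrow> complex) \<Rightarrow> bool" where
  "orthonormal_frame A \<rho> p u1 u2 \<longleftrightarrow>
     u1 \<in> tangent_space A p \<and> u2 \<in> tangent_space A p \<and>
     riem_inner A \<rho> p u1 u1 = 1 \<and> riem_inner A \<rho> p u2 u2 = 1 \<and> riem_inner A \<rho> p u1 u2 = 0"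

text \<open>
  The Riemannian volume measure \<open>dv\<close>, which is \<open>(\<rho> c)\<^sup>2 dx dy\<close> in each chart \<open>c\<close>. On a
  compact surface there is exactly one such Borel measure.
\<close>

definition volume_measure ::
    "('a::t2_space) chart set \<Rightarrow> ('a chart \<Rightarrow> complex \<Rightarrow> real) \<Rightarrow> 'a measure \<Rightarrow> bool" where
  "volume_measure A \<rho> v \<longleftrightarrow> sets v = sets borel \<and>
     (\<forall>c\<in>A. \<forall>B\<in>sets borel. B \<subseteq> cdom c \<longrightarrow>
        emeasure v B = (\<integral>\<^sup>+\<zeta>\<in>coord c ` B. ennreal ((\<rho> c \<zeta>)\<^sup>2) \<partial>lborel))"

definition L2_norm :: "'a measure \<Rightarrow> ('a \<Rightarrow> complex) \<Rightarrow> real" where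
  "L2_norm v f = sqrt (\<integral>p. (cmod (f p))\<^sup>2 \<partial>v)"


section \<open>Eigenfunctions\<close>

text \<open>
  In the coordinates of a chart the Laplace-Beltrami operator
  \<open>(det g)\<^bsup>-1/2\<^esup> \<partial>\<^sub>i ((det g)\<^bsup>1/2\<^esup> g\<^bsup>ij\<^esup> \<partial>\<^sub>j)\<close> of \<open>g = \<rho>\<^sup>2 (dx\<^sup>2 + dy\<^sup>2)\<close> reduces to
  \<open>\<rho>\<^bsup>-2\<^esup> (\<partial>\<^sub>x\<^sup>2 + \<partial>\<^sub>y\<^sup>2)\<close>.
\<close>

definition laplace_beltrami :: "'a chart set \<Rightarrow> ('a chart \<Rightarrow> complex \<Rightarrow> real) \<Rightarrow>
    ('a \<Rightarrow> complex) \<Rightarrow> 'a \<Rightarrow> complex" where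
  "laplace_beltrami A \<rho> f p =
     (let c = chart_at A p in
        laplacian (f \<circ> cinv c) (coord c p) /\<^sub>R (\<rho> c (coord c p))\<^sup>2)"

text \<open>
  The operator is symmetric, so its eigenvalues are real; their sign is not prescribed here.
  By elliptic regularity it does not matter that only \<open>C\<^sup>2\<close> is required.
\<close>

definition eigenfunction :: "'a chart set \<Rightarrow> ('a chart \<Rightarrow> complex \<Rightarrow> real) \<Rightarrow>
    ('a \<Rightarrow> complex) \<Rightarrow> bool" where
  "eigenfunction A \<rho> \<phi> \<longleftrightarrow>
     (\<forall>c\<in>A. C_on 2 (\<phi> \<circ> cinv c) (coord c ` cdom c)) \<and>
     (\<exists>p. \<phi> p \<noteq> 0) \<and>
     (\<exists>\<mu>::real. \<forall>p. laplace_beltrami A \<rho> \<phi> p = \<mu> *\<^sub>R \<phi> p)"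


section \<open>Geodesics and geodesic circles\<close>

text \<open>
  With \<open>\<zeta> = x + \<i> y\<close>, the Christoffel symbols of \<open>\<rho>\<^sup>2 (dx\<^sup>2 + dy\<^sup>2)\<close> combine to
  \<open>\<Gamma> = 2 \<partial> ln \<rho> / \<partial>\<zeta> = \<partial>\<^sub>x ln \<rho> - \<i> \<partial>\<^sub>y ln \<rho>\<close>, and the two real geodesic equations become
  \<open>\<zeta>'' + \<Gamma>(\<zeta>) (\<zeta>')\<^sup>2 = 0\<close>.
\<close>

definition christoffel :: "(complex \<Rightarrow> real) \<Rightarrow> complex \<Rightarrow> complex" where
  "christoffel \<rho> \<zeta> = Complex (pdx (\<lambda>z. ln (\<rho> z)) \<zeta>) (- pdy (\<lambda>z. ln (\<rho> z)) \<zeta>)"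

definition geodesic :: "('a::topological_space) chart set \<Rightarrow>
    ('a chart \<Rightarrow> complex \<Rightarrow> real) \<Rightarrow> (real \<Rightarrow> 'a) \<Rightarrow> bool" where
  "geodesic A \<rho> \<gamma> \<longleftrightarrow> continuous_on UNIV \<gamma> \<and>
     (\<forall>c\<in>A. \<forall>t. \<gamma> t \<in> cdom c \<longrightarrow>
        (coord c \<circ> \<gamma>) differentiable (at t) \<and>
        ((\<lambda>s. vector_derivative (coord c \<circ> \<gamma>) (at s)) has_vector_derivative
           - (christoffel (\<rho> c) (coord c (\<gamma> t)) * (vector_derivative (coord c \<circ> \<gamma>) (at t))\<^sup>2))
          (at t))"

text \<open>
  A compact surface is geodesically complete, so geodesics may be taken to be defined on the
  whole real line.
\<close>

definition exp_map :: "('a::topological_space) chart set \<Rightarrow>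
    ('a chart \<Rightarrow> complex \<Rightarrow> real) \<Rightarrow> 'a \<Rightarrow> ('a chart \<Rightarrow> complex) \<Rightarrow> 'a" where
  "exp_map A \<rho> p u = (THE q. \<exists>\<gamma>. geodesic A \<rho> \<gamma> \<and> \<gamma> 0 = p \<and> velocity A \<gamma> 0 = u \<and> q = \<gamma> 1)"

definition geodesic_circle :: "('a::topological_space) chart set \<Rightarrow>
    ('a chart \<Rightarrow> complex \<Rightarrow> real) \<Rightarrow> 'a \<Rightarrow> ('a chart \<Rightarrow> complex) \<Rightarrow> ('a chart \<Rightarrow> complex) \<Rightarrow>
    real \<Rightarrow> real \<Rightarrow> 'a" where
  "geodesic_circle A \<rho> p u1 u2 r \<theta> =
     exp_map A \<rho> p
       (\<lambda>c. r *\<^sub>R (cos (2 * pi * \<theta>) *\<^sub>R u1 c + sin (2 * pi * \<theta>) *\<^sub>R u2 c))"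

text \<open>
  Integral against the line element along a curve parametrized by \<open>[0,1]\<close>. For a geodesic circle
  of radius \<open>r\<close> the speed is the constant \<open>2 \<pi> sinh r\<close>.
\<close>

definition line_integral :: "'a chart set \<Rightarrow> ('a chart \<Rightarrow> complex \<Rightarrow> real) \<Rightarrow>
    (real \<Rightarrow> 'a) \<Rightarrow> ('a \<Rightarrow> complex) \<Rightarrow> complex" where
  "line_integral A \<rho> \<alpha> f =
     integral {0..1} (\<lambda>\<theta>.
       sqrt (riem_inner A \<rho> (\<alpha> \<theta>) (velocity A \<alpha> \<theta>) (velocity A \<alpha> \<theta>)) *\<^sub>R f (\<alpha> \<theta>))"

end

theory Submission
  imports Defs "HOL-Complex_Analysis.Complex_Analysis"
begin

text \<open>
  For an eigenfunction \<open>\<phi>\<close> let \<open>F(t)\<close> be its mean over the geodesic circle around the given point whose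
  radius \<open>s\<close> satisfies \<open>exp t = tanh (s/2)\<close>. The Laplacian commutes with rotations, so \<open>F\<close> solves an
  ordinary differential equation, which in this variable is \<open>F'' = (\<mu> / sinh\<^sup>2 t) F\<close>
  (\<open>vertical_mean_ode\<close>). Here \<open>\<mu> \<le> 0\<close> by the maximum principle. Write \<open>\<nu> = -\<mu>\<close> and \<open>q = 1 / sinh\<^sup>2\<close>. The
  energy \<open>|F'|\<^sup>2 + (\<nu>q + 1)|F|\<^sup>2\<close> grows at most exponentially, at a rate independent of \<open>\<nu>\<close>; it dominates
  \<open>(1 + \<nu>)|F|\<^sup>2\<close> at the given radius, while by Caccioppoli's inequality its mean over a fixed interval of
  small radii is at most a constant times \<open>(1 + \<nu>)\<close> times the integral of \<open>|F|\<^sup>2\<close> over that interval.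
  The factor \<open>1 + \<nu>\<close> cancels (\<open>energy_estimate\<close>). Small geodesic discs are embedded, so the remaining
  integral is bounded by the \<open>L\<^sup>2\<close> norm of \<open>\<phi>\<close> (\<open>mean_square_bound\<close>).

  Circles of large radius are neither embedded nor contained in a chart. They are handled on the
  universal cover: there is a holomorphic local isometry \<open>E\<close> of the Poincare disc to the surface with
  prescribed 1-jet at the centre (\<open>developing_map\<close>), and the circles around the point are the images of
  Euclidean circles around \<open>0\<close> (\<open>geodesic_circle_developed\<close>). Locally \<open>E\<close> comes from Liouville's theorem
  on metrics of curvature \<open>-1\<close> (\<open>liouville_local\<close>): the reciprocal of the density satisfies a
  differential system whose coefficient \<open>\<tau>\<close> is holomorphic, and the quotient of two solutions of
  \<open>w'' = -\<tau> w\<close> is the inverse of \<open>E\<close>. By compactness local isometries extend over discs of a uniform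
  hyperbolic size, and a local isometry is determined by its 1-jet because it satisfies a second order
  equation; together this gives \<open>E\<close> on the whole disc. It maps radii to geodesics, and geodesics are
  unique, so the exponential map is expressed by \<open>E\<close>.
\<close>

section \<open>Real calculus in the plane\<close>

lemma has_derivative_pd:
  assumes "f differentiable (at \<zeta>)"
  shows "(f has_derivative (\<lambda>e. Re e *\<^sub>R pdx f \<zeta> + Im e *\<^sub>R pdy f \<zeta>)) (at \<zeta>)"
proof -
  have D: "(f has_derivative frechet_derivative f (at \<zeta>)) (at \<zeta>)"
    using assms frechet_derivative_works by blast
  then interpret bounded_linear "frechet_derivative f (at \<zeta>)"
    by (rule has_derivative_bounded_linear)
  have "frechet_derivative f (at \<zeta>) e = Re e *\<^sub>R pdx f \<zeta> + Im e *\<^sub>R pdy f \<zeta>" for e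
  proof -
    have e: "e = Re e *\<^sub>R 1 + Im e *\<^sub>R \<i>"
      by (simp add: complex_eq_iff)
    have "frechet_derivative f (at \<zeta>) (Re e *\<^sub>R 1 + Im e *\<^sub>R \<i>) = Re e *\<^sub>R pdx f \<zeta> + Im e *\<^sub>R pdy f \<zeta>"
      by (simp only: add scaleR pdx_def pdy_def)
    then show ?thesis by (simp only: e[symmetric])
  qed
  then have "frechet_derivative f (at \<zeta>) = (\<lambda>e. Re e *\<^sub>R pdx f \<zeta> + Im e *\<^sub>R pdy f \<zeta>)"
    by (intro ext)
  then show ?thesis using D by simp
qed

lemma pd_eqI:
  assumes "(f has_derivative D) (at \<zeta>)"
  shows "f differentiable (at \<zeta>)" "pdx f \<zeta> = D 1" "pdy f \<zeta> = D \<i>"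
  using assms frechet_derivative_at[OF assms] by (auto simp: differentiable_def pdx_def pdy_def)

lemma has_derivative_cong_open:
  assumes "open S" "\<zeta> \<in> S" "\<And>z. z \<in> S \<Longrightarrow> f z = g z"
  shows "(f has_derivative D) (at \<zeta>) \<longleftrightarrow> (g has_derivative D) (at \<zeta>)"
  using has_derivative_transform_within_open[OF _ assms(1,2), of f D UNIV g]
    has_derivative_transform_within_open[OF _ assms(1,2), of g D UNIV f] assms(3) by auto

lemma pd_cong_open:
  assumes "open S" "\<zeta> \<in> S" "\<And>z. z \<in> S \<Longrightarrow> f z = g z"
  shows "f differentiable (at \<zeta>) \<longleftrightarrow> g differentiable (at \<zeta>)"
    "pdx f \<zeta> = pdx g \<zeta>" "pdy f \<zeta> = pdy g \<zeta>"
  unfolding pdx_def pdy_def differentiable_def frechet_derivative_def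
  using has_derivative_cong_open[OF assms] by auto

lemma laplacian_cong_open:
  assumes "open S" "\<zeta> \<in> S" "\<And>z. z \<in> S \<Longrightarrow> f z = g z"
  shows "laplacian f \<zeta> = laplacian g \<zeta>"
proof -
  have "pdx (pdx f) \<zeta> = pdx (pdx g) \<zeta>"
    by (rule pd_cong_open(2)[OF assms(1,2)]) (rule pd_cong_open(2)[OF assms(1) _ assms(3)])
  moreover have "pdy (pdy f) \<zeta> = pdy (pdy g) \<zeta>"
    by (rule pd_cong_open(3)[OF assms(1,2)]) (rule pd_cong_open(3)[OF assms(1) _ assms(3)])
  ultimately show ?thesis by (simp add: laplacian_def)
qed

lemma C_on_cong:
  assumes "open S" "\<And>z. z \<in> S \<Longrightarrow> f z = g z"
  shows "C_on k f S \<longleftrightarrow> C_on k g S"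
  using assms(2)
proof (induction k arbitrary: f g)
  case 0
  then show ?case by (simp cong: continuous_on_cong)
next
  case (Suc k)
  have "C_on k (pdx f) S = C_on k (pdx g) S" "C_on k (pdy f) S = C_on k (pdy g) S"
    by (rule Suc.IH, rule pd_cong_open(2,3)[OF assms(1)], simp, rule Suc.prems, simp)+
  moreover have "(\<forall>\<zeta>\<in>S. f differentiable (at \<zeta>)) \<longleftrightarrow> (\<forall>\<zeta>\<in>S. g differentiable (at \<zeta>))"
    using pd_cong_open(1)[OF assms(1), of _ f g] Suc.prems by blast
  ultimately show ?case by simp
qed

lemma C_on_Suc_imp: "C_on (Suc k) f S \<Longrightarrow> C_on k f S"
proof (induction k arbitrary: f)
  case 0
  then show ?case
    by (auto intro!: continuous_at_imp_continuous_on differentiable_imp_continuous_within)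
qed (use C_on.simps(2) in blast)

lemma C_on_mono: "C_on k f S \<Longrightarrow> j \<le> k \<Longrightarrow> C_on j f S"
  by (induction k) (auto simp del: C_on.simps dest: C_on_Suc_imp simp: le_Suc_eq)

lemma C_on_imp_continuous: "C_on k f S \<Longrightarrow> continuous_on S f"
  using C_on_mono[of k f S 0] by simp

lemma C_on_local:
  assumes "\<And>z. z \<in> S \<Longrightarrow> \<exists>N. open N \<and> z \<in> N \<and> C_on k f N"
  shows "C_on k f S"
  using assms
proof (induction k arbitrary: f)
  case 0
  have "isCont f z" if "z \<in> S" for z
    using 0[OF that] continuous_on_interior interior_open by (metis C_on.simps(1))
  then show ?case by (simp add: continuous_at_imp_continuous_on)
next
  case (Suc k)
  then show ?case unfolding C_on.simps by metis
qed

lemma pd_bilinear: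
  assumes "bounded_bilinear pr" "f differentiable (at z)" "g differentiable (at z)"
  shows "(\<lambda>z. pr (f z) (g z)) differentiable (at z)"
    "pdx (\<lambda>z. pr (f z) (g z)) z = pr (f z) (pdx g z) + pr (pdx f z) (g z)"
    "pdy (\<lambda>z. pr (f z) (g z)) z = pr (f z) (pdy g z) + pr (pdy f z) (g z)"
proof -
  note D = bounded_bilinear.FDERIV[OF assms(1) has_derivative_pd[OF assms(2)] has_derivative_pd[OF assms(3)]]
  show "(\<lambda>z. pr (f z) (g z)) differentiable (at z)"
    "pdx (\<lambda>z. pr (f z) (g z)) z = pr (f z) (pdx g z) + pr (pdx f z) (g z)"
    "pdy (\<lambda>z. pr (f z) (g z)) z = pr (f z) (pdy g z) + pr (pdy f z) (g z)"
    using pd_eqI[OF D] by simp_all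
qed

lemma pd_add:
  assumes "f differentiable (at z)" "g differentiable (at z)"
  shows "(\<lambda>z. f z + g z) differentiable (at z)"
    "pdx (\<lambda>z. f z + g z) z = pdx f z + pdx g z"
    "pdy (\<lambda>z. f z + g z) z = pdy f z + pdy g z"
  using pd_eqI[OF has_derivative_add[OF has_derivative_pd[OF assms(1)] has_derivative_pd[OF assms(2)]]]
  by simp_all

lemma pd_linear:
  assumes "bounded_linear L" "f differentiable (at z)"
  shows "(\<lambda>z. L (f z)) differentiable (at z)"
    "pdx (\<lambda>z. L (f z)) z = L (pdx f z)" "pdy (\<lambda>z. L (f z)) z = L (pdy f z)"
  using pd_eqI[OF bounded_linear.has_derivative[OF assms(1) has_derivative_pd[OF assms(2)]]]
  by (simp_all add: linear_simps[OF assms(1)])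

lemma C_on_add:
  assumes "open S" "C_on k f S" "C_on k g S"
  shows "C_on k (\<lambda>z. f z + g z) S"
  using assms(2,3)
proof (induction k arbitrary: f g)
  case (Suc k)
  have "C_on k (pdx (\<lambda>z. f z + g z)) S"
    using Suc.IH[of "pdx f" "pdx g"] Suc.prems
    by (subst C_on_cong[OF assms(1), of _ "\<lambda>z. pdx f z + pdx g z"]) (auto simp: pd_add)
  moreover have "C_on k (pdy (\<lambda>z. f z + g z)) S"
    using Suc.IH[of "pdy f" "pdy g"] Suc.prems
    by (subst C_on_cong[OF assms(1), of _ "\<lambda>z. pdy f z + pdy g z"]) (auto simp: pd_add)
  ultimately show ?case using Suc.prems by (auto simp: pd_add)
qed (auto intro: continuous_on_add)

lemma C_on_linear:
  assumes "open S" "bounded_linear L" "C_on k f S"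
  shows "C_on k (\<lambda>z. L (f z)) S"
  using assms(3)
proof (induction k arbitrary: f)
  case 0
  then show ?case using bounded_linear.continuous_on[OF assms(2)] by auto
next
  case (Suc k)
  have "C_on k (pdx (\<lambda>z. L (f z))) S"
    using Suc.IH[of "pdx f"] Suc.prems
    by (subst C_on_cong[OF assms(1), of _ "\<lambda>z. L (pdx f z)"]) (auto simp: pd_linear[OF assms(2)])
  moreover have "C_on k (pdy (\<lambda>z. L (f z))) S"
    using Suc.IH[of "pdy f"] Suc.prems
    by (subst C_on_cong[OF assms(1), of _ "\<lambda>z. L (pdy f z)"]) (auto simp: pd_linear[OF assms(2)])
  ultimately show ?case using Suc.prems by (auto simp: pd_linear[OF assms(2)])
qed

lemma C_on_bilinear:
  assumes "open S" "bounded_bilinear pr" "C_on k f S" "C_on k g S"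
  shows "C_on k (\<lambda>z. pr (f z) (g z)) S"
  using assms(3,4)
proof (induction k arbitrary: f g)
  case 0
  then show ?case using bounded_bilinear.continuous_on[OF assms(2)] by auto
next
  case (Suc k)
  note C = Suc.prems[THEN C_on_Suc_imp]
  have "C_on k (pdx (\<lambda>z. pr (f z) (g z))) S"
    using Suc.IH[of "pdx f" g] Suc.IH[of f "pdx g"] Suc.prems C
    by (subst C_on_cong[OF assms(1), of _ "\<lambda>z. pr (f z) (pdx g z) + pr (pdx f z) (g z)"])
      (auto simp: pd_bilinear[OF assms(2)] intro!: C_on_add assms(1))
  moreover have "C_on k (pdy (\<lambda>z. pr (f z) (g z))) S"
    using Suc.IH[of "pdy f" g] Suc.IH[of f "pdy g"] Suc.prems C
    by (subst C_on_cong[OF assms(1), of _ "\<lambda>z. pr (f z) (pdy g z) + pr (pdy f z) (g z)"])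
      (auto simp: pd_bilinear[OF assms(2)] intro!: C_on_add assms(1))
  ultimately show ?case using Suc.prems by (auto simp: pd_bilinear[OF assms(2)])
qed

lemmas C_on_mult = C_on_bilinear[OF _ bounded_bilinear_mult]
lemmas C_on_scaleR = C_on_bilinear[OF _ bounded_bilinear_scaleR]

lemma pd_inverse:
  fixes f :: "complex \<Rightarrow> real"
  assumes "f differentiable (at z)" "f z \<noteq> 0"
  shows "(\<lambda>z. inverse (f z)) differentiable (at z)"
    "pdx (\<lambda>z. inverse (f z)) z = - (pdx f z * (inverse (f z) * inverse (f z)))"
    "pdy (\<lambda>z. inverse (f z)) z = - (pdy f z * (inverse (f z) * inverse (f z)))"
  using pd_eqI[OF Deriv.has_derivative_inverse[OF assms(2) has_derivative_pd[OF assms(1)]]]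
  by (simp_all add: algebra_simps)

lemma C_on_inverse:
  fixes f :: "complex \<Rightarrow> real"
  assumes "open S" "\<And>z. z \<in> S \<Longrightarrow> f z \<noteq> 0" "C_on k f S"
  shows "C_on k (\<lambda>z. inverse (f z)) S"
  using assms(3)
proof (induction k)
  case 0
  then show ?case using assms(2) by (auto intro!: continuous_intros)
next
  case (Suc k)
  note I = Suc.IH[OF C_on_Suc_imp[OF Suc.prems]]
  have "C_on k (\<lambda>z. - (pdx f z * (inverse (f z) * inverse (f z)))) S"
    "C_on k (\<lambda>z. - (pdy f z * (inverse (f z) * inverse (f z)))) S"
    using Suc.prems I
    by (auto intro!: C_on_mult assms(1) C_on_linear[OF assms(1) bounded_linear_minus[OF bounded_linear_ident]])
  moreover have "C_on k (pdx (\<lambda>z. inverse (f z))) S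
      \<longleftrightarrow> C_on k (\<lambda>z. - (pdx f z * (inverse (f z) * inverse (f z)))) S"
    "C_on k (pdy (\<lambda>z. inverse (f z))) S
      \<longleftrightarrow> C_on k (\<lambda>z. - (pdy f z * (inverse (f z) * inverse (f z)))) S"
    using Suc.prems by (rule_tac C_on_cong[OF assms(1)], intro pd_inverse assms(2); simp)+
  ultimately have "C_on k (pdx (\<lambda>z. inverse (f z))) S" "C_on k (pdy (\<lambda>z. inverse (f z))) S"
    by simp_all
  then show ?case using Suc.prems assms(2) by (auto simp: pd_inverse)
qed

lemma has_vector_derivative_line:
  assumes "f differentiable (at (p + of_real t * e))"
  shows "((\<lambda>t. f (p + of_real t * e)) has_vector_derivative
    Re e *\<^sub>R pdx f (p + of_real t * e) + Im e *\<^sub>R pdy f (p + of_real t * e)) (at t within T)"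
proof -
  have "((\<lambda>t. p + of_real t * e) has_derivative (\<lambda>s. of_real s * e)) (at t within T)"
    by (auto intro!: derivative_eq_intros)
  from has_derivative_compose[OF this has_derivative_pd[OF assms]] show ?thesis
    by (simp add: has_vector_derivative_def scaleR_add_right)
qed

lemma C_on_has_vector_derivative_line:
  assumes "C_on (Suc k) f S" "p + of_real t * e \<in> S"
  shows "((\<lambda>t. f (p + of_real t * e)) has_vector_derivative
    Re e *\<^sub>R pdx f (p + of_real t * e) + Im e *\<^sub>R pdy f (p + of_real t * e)) (at t within T)"
  by (rule has_vector_derivative_line) (use assms in auto)

text \<open>Both mixed partials are limits of the same second difference quotient.\<close>

lemma mixed_partials_real:
  fixes f :: "complex \<Rightarrow> real"
  assumes "open S" "\<zeta> \<in> S" "C_on 2 f S"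
  shows "pdy (pdx f) \<zeta> = pdx (pdy f) \<zeta>"
proof -
  have C: "C_on 1 (pdx f) S" "C_on 1 (pdy f) S" "C_on 1 f S"
    using assms(3) C_on_Suc_imp[of 1 f S] by (auto simp: numeral_2_eq_2)
  obtain r where r: "r > 0" "cball \<zeta> r \<subseteq> S"
    using assms(1,2) open_contains_cball by blast
  have inS: "\<zeta> + of_real a + \<i> * of_real b \<in> S" if "0 \<le> a" "0 \<le> b" "a + b \<le> r" for a b
  proof -
    have "cmod (of_real a + \<i> * of_real b) \<le> r"
      using that norm_triangle_ineq[of "of_real a :: complex" "\<i> * of_real b"] by (simp add: norm_mult)
    then show ?thesis using r(2) by (auto simp: dist_norm norm_minus_commute add.assoc subset_iff)
  qed
  have dx: "((\<lambda>t. g (p + of_real t)) has_real_derivative pdx g (p + of_real a)) (at a)"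
    if "C_on 1 g S" "p + of_real a \<in> S" for g :: "complex \<Rightarrow> real" and p a
    using C_on_has_vector_derivative_line[of 0 g S p a 1 UNIV] that
    by (simp add: has_real_derivative_iff_has_vector_derivative)
  have dy: "((\<lambda>t. g (p + \<i> * of_real t)) has_real_derivative pdy g (p + \<i> * of_real a)) (at a)"
    if "C_on 1 g S" "p + \<i> * of_real a \<in> S" for g :: "complex \<Rightarrow> real" and p a
    using C_on_has_vector_derivative_line[of 0 g S p a \<i> UNIV] that
    by (simp add: has_real_derivative_iff_has_vector_derivative mult.commute)
  have key: "\<exists>p q. cmod (p - \<zeta>) \<le> 2 * s \<and> cmod (q - \<zeta>) \<le> 2 * s \<and> pdy (pdx f) p = pdx (pdy f) q"
    if s: "s > 0" "2 * s \<le> r" for s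
  proof -
    let ?D = "f (\<zeta> + of_real s + \<i> * of_real s) - f (\<zeta> + of_real s) - f (\<zeta> + \<i> * of_real s) + f \<zeta>"
    have cm: "cmod (of_real a + \<i> * of_real b) \<le> 2 * s" if "0 < a" "a < s" "0 < b" "b < s" for a b
      using that norm_triangle_ineq[of "of_real a :: complex" "\<i> * of_real b"] by (simp add: norm_mult)
    have ac: "\<zeta> + \<i> * of_real s + of_real a = \<zeta> + of_real a + \<i> * of_real s" for a
      by simp
    have "\<exists>a. 0 < a \<and> a < s \<and>
      (f (\<zeta> + \<i> * of_real s + of_real s) - f (\<zeta> + of_real s))
      - (f (\<zeta> + \<i> * of_real s + of_real 0) - f (\<zeta> + of_real 0))
      = (s - 0) * (pdx f (\<zeta> + \<i> * of_real s + of_real a) - pdx f (\<zeta> + of_real a))"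
    proof (rule MVT2[OF s(1)])
      fix x assume "0 \<le> x" "x \<le> s"
      then show "((\<lambda>x. f (\<zeta> + \<i> * of_real s + of_real x) - f (\<zeta> + of_real x)) has_real_derivative
         pdx f (\<zeta> + \<i> * of_real s + of_real x) - pdx f (\<zeta> + of_real x)) (at x)"
        using inS[of x s] inS[of x 0] s by (intro DERIV_diff dx[OF C(3)]) (auto simp: ac)
    qed
    then obtain a where a: "0 < a" "a < s"
      "?D = s * (pdx f (\<zeta> + of_real a + \<i> * of_real s) - pdx f (\<zeta> + of_real a))"
      by (auto simp: algebra_simps)
    have "\<exists>b. 0 < b \<and> b < s \<and>
      pdx f (\<zeta> + of_real a + \<i> * of_real s) - pdx f (\<zeta> + of_real a + \<i> * of_real 0)
      = (s - 0) * pdy (pdx f) (\<zeta> + of_real a + \<i> * of_real b)"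
      using inS[of a] a s by (intro MVT2[OF s(1)] dy[OF C(1)]) auto
    then obtain b where b: "0 < b" "b < s" "?D = s * s * pdy (pdx f) (\<zeta> + of_real a + \<i> * of_real b)"
      using a by auto
    have "\<exists>a. 0 < a \<and> a < s \<and>
      (f (\<zeta> + of_real s + \<i> * of_real s) - f (\<zeta> + \<i> * of_real s))
      - (f (\<zeta> + of_real s + \<i> * of_real 0) - f (\<zeta> + \<i> * of_real 0))
      = (s - 0) * (pdy f (\<zeta> + of_real s + \<i> * of_real a) - pdy f (\<zeta> + \<i> * of_real a))"
      using inS[of s] inS[of 0] s by (intro MVT2[OF s(1)] DERIV_diff dy[OF C(3)]) auto
    then obtain c where c: "0 < c" "c < s"
      "?D = s * (pdy f (\<zeta> + of_real s + \<i> * of_real c) - pdy f (\<zeta> + \<i> * of_real c))"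
      by (auto simp: algebra_simps)
    have ac': "\<zeta> + \<i> * of_real c + of_real x = \<zeta> + of_real x + \<i> * of_real c" for x
      by simp
    have "\<exists>d. 0 < d \<and> d < s \<and>
      pdy f (\<zeta> + \<i> * of_real c + of_real s) - pdy f (\<zeta> + \<i> * of_real c + of_real 0)
      = (s - 0) * pdx (pdy f) (\<zeta> + \<i> * of_real c + of_real d)"
      using inS[of _ c] c s by (intro MVT2[OF s(1)] dx[OF C(2)]) (auto simp: ac')
    then obtain d where d: "0 < d" "d < s" "?D = s * s * pdx (pdy f) (\<zeta> + of_real d + \<i> * of_real c)"
      using c by (auto simp: ac')
    show ?thesis
      using a b c d s cm[of a b] cm[of d c]
      by (intro exI[of _ "\<zeta> + of_real a + \<i> * of_real b"] exI[of _ "\<zeta> + of_real d + \<i> * of_real c"])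
        (simp add: add.assoc)
  qed
  have c1: "isCont (pdy (pdx f)) \<zeta>" and c2: "isCont (pdx (pdy f)) \<zeta>"
    using C assms(1,2) by (auto simp: continuous_on_eq_continuous_at)
  show ?thesis
  proof (rule ccontr)
    assume n: "\<not> ?thesis"
    define \<epsilon> where "\<epsilon> = \<bar>pdy (pdx f) \<zeta> - pdx (pdy f) \<zeta>\<bar> / 2"
    have e: "\<epsilon> > 0" using n by (simp add: \<epsilon>_def)
    obtain d1 where d1: "d1 > 0" "\<And>p. cmod (p - \<zeta>) < d1 \<Longrightarrow> \<bar>pdy (pdx f) p - pdy (pdx f) \<zeta>\<bar> < \<epsilon>"
      using c1 e unfolding continuous_at_eps_delta by (auto simp: dist_norm)
    obtain d2 where d2: "d2 > 0" "\<And>p. cmod (p - \<zeta>) < d2 \<Longrightarrow> \<bar>pdx (pdy f) p - pdx (pdy f) \<zeta>\<bar> < \<epsilon>"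
      using c2 e unfolding continuous_at_eps_delta by (auto simp: dist_norm)
    define s where "s = min (r/2) (min (d1/4) (d2/4))"
    have s: "s > 0" "2 * s \<le> r" "2 * s < d1" "2 * s < d2"
      using r(1) d1(1) d2(1) by (auto simp: s_def)
    obtain p q where "cmod (p - \<zeta>) \<le> 2 * s" "cmod (q - \<zeta>) \<le> 2 * s" "pdy (pdx f) p = pdx (pdy f) q"
      using key[OF s(1,2)] by blast
    then have "\<bar>pdy (pdx f) p - pdy (pdx f) \<zeta>\<bar> < \<epsilon>" "\<bar>pdy (pdx f) p - pdx (pdy f) \<zeta>\<bar> < \<epsilon>"
      using d1(2)[of p] d2(2)[of q] s by simp_all
    then show False
      unfolding \<epsilon>_def abs_if by (auto split: if_splits)
  qed
qed

lemma mixed_partials: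
  fixes f :: "complex \<Rightarrow> complex"
  assumes "open S" "\<zeta> \<in> S" "C_on 2 f S"
  shows "pdy (pdx f) \<zeta> = pdx (pdy f) \<zeta>"
proof -
  have "L (pdy (pdx f) \<zeta>) = L (pdx (pdy f) \<zeta>)"
    if L: "bounded_linear L" for L :: "complex \<Rightarrow> real"
  proof -
    have d: "f differentiable (at z)" "pdx f differentiable (at z)" "pdy f differentiable (at z)" if "z \<in> S" for z
      using assms(3) that by (auto simp: numeral_2_eq_2)
    have "pdy (pdx (\<lambda>z. L (f z))) \<zeta> = pdy (\<lambda>z. L (pdx f z)) \<zeta>"
      by (rule pd_cong_open[OF assms(1,2)]) (simp add: pd_linear[OF L] d)
    moreover have "pdx (pdy (\<lambda>z. L (f z))) \<zeta> = pdx (\<lambda>z. L (pdy f z)) \<zeta>"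
      by (rule pd_cong_open[OF assms(1,2)]) (simp add: pd_linear[OF L] d)
    ultimately show ?thesis
      using mixed_partials_real[OF assms(1,2) C_on_linear[OF assms(1) L assms(3)]]
      by (simp add: pd_linear[OF L] d assms(2))
  qed
  from this[OF bounded_linear_Re] this[OF bounded_linear_Im] show ?thesis
    by (simp add: complex_eq_iff)
qed

lemma pd_holomorphic:
  assumes "(g has_field_derivative g') (at z)"
  shows "g differentiable (at z)" "pdx g z = g'" "pdy g z = \<i> * g'"
  using pd_eqI[of g "(*) g'" z] assms by (auto simp: has_field_derivative_def)

lemma holomorphic_C_on:
  assumes "open S" "g holomorphic_on S"
  shows "C_on k g S"
  using assms(2)
proof (induction k arbitrary: g)
  case 0
  then show ?case by (simp add: holomorphic_on_imp_continuous_on)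
next
  case (Suc k)
  have d: "(g has_field_derivative deriv g z) (at z)" if "z \<in> S" for z
    using Suc.prems that assms(1) holomorphic_derivI by blast
  have h: "deriv g holomorphic_on S" "(\<lambda>z. \<i> * deriv g z) holomorphic_on S"
    using Suc.prems assms(1) by (auto intro!: holomorphic_intros holomorphic_deriv)
  have "C_on k (pdx g) S" "C_on k (pdy g) S"
    using Suc.IH[OF h(1)] Suc.IH[OF h(2)] d
      C_on_cong[OF assms(1), of "pdx g" "deriv g"] C_on_cong[OF assms(1), of "pdy g" "\<lambda>z. \<i> * deriv g z"]
    by (auto simp: pd_holomorphic)
  then show ?case using d pd_holomorphic(1) by auto
qed

lemma pd_compose_holomorphic:
  assumes "(g has_field_derivative g') (at z)" "\<phi> differentiable (at (g z))"
  shows "(\<phi> \<circ> g) differentiable (at z)"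
    "pdx (\<phi> \<circ> g) z = Re g' *\<^sub>R pdx \<phi> (g z) + Im g' *\<^sub>R pdy \<phi> (g z)"
    "pdy (\<phi> \<circ> g) z = (- Im g') *\<^sub>R pdx \<phi> (g z) + Re g' *\<^sub>R pdy \<phi> (g z)"
  using pd_eqI[OF diff_chain_at[OF assms(1)[unfolded has_field_derivative_def] has_derivative_pd[OF assms(2)]]]
  by simp_all

lemma C_on_compose_holomorphic:
  assumes "open T" "g holomorphic_on T" "g ` T \<subseteq> S" "C_on k \<phi> S"
  shows "C_on k (\<phi> \<circ> g) T"
  using assms(4)
proof (induction k arbitrary: \<phi>)
  case 0
  then show ?case
    using continuous_on_compose[OF holomorphic_on_imp_continuous_on[OF assms(2)]
        continuous_on_subset[OF _ assms(3)]] by simp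
next
  case (Suc k)
  have d: "(g has_field_derivative deriv g z) (at z)" if "z \<in> T" for z
    using assms that holomorphic_derivI by blast
  have gS: "\<phi> differentiable (at (g z))" if "z \<in> T" for z
    using that assms(3) Suc.prems by auto
  have h: "deriv g holomorphic_on T"
    using assms(1,2) by (rule holomorphic_deriv[rotated])
  note R = C_on_linear[OF assms(1) _ holomorphic_C_on[OF assms(1) h, of k]]
  note R' = R[OF bounded_linear_Re] R[OF bounded_linear_Im] R[OF bounded_linear_minus[OF bounded_linear_Im]]
  have C: "C_on k (\<lambda>z. (pdx \<phi> \<circ> g) z) T" "C_on k (\<lambda>z. (pdy \<phi> \<circ> g) z) T"
    using Suc.IH[of "pdx \<phi>"] Suc.IH[of "pdy \<phi>"] Suc.prems by simp_all
  have 1: "C_on k (pdx (\<phi> \<circ> g)) T"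
    by (rule C_on_cong[OF assms(1), THEN iffD2, rotated],
        rule C_on_add[OF assms(1) C_on_scaleR[OF assms(1) R'(1) C(1)] C_on_scaleR[OF assms(1) R'(2) C(2)]])
      (simp add: pd_compose_holomorphic(2)[OF d gS])
  have 2: "C_on k (pdy (\<phi> \<circ> g)) T"
    by (rule C_on_cong[OF assms(1), THEN iffD2, rotated],
        rule C_on_add[OF assms(1) C_on_scaleR[OF assms(1) R'(3) C(1)] C_on_scaleR[OF assms(1) R'(1) C(2)]])
      (simp add: pd_compose_holomorphic(3)[OF d gS])
  show ?case using pd_compose_holomorphic(1)[OF d gS] 1 2 unfolding C_on.simps by blast
qed

text \<open>
  By the Cauchy-Riemann equations for \<open>g\<close> and for its derivative, the mixed second derivatives of
  \<open>\<phi>\<close> and all its first derivatives cancel in the sum.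
\<close>

lemma laplacian_compose_holomorphic:
  fixes \<phi> :: "complex \<Rightarrow> 'b::real_normed_vector"
  assumes "open T" "g holomorphic_on T" "g ` T \<subseteq> S" "C_on 2 \<phi> S" "z \<in> T"
  shows "laplacian (\<phi> \<circ> g) z = (cmod (deriv g z))\<^sup>2 *\<^sub>R laplacian \<phi> (g z)"
proof -
  have d: "(g has_field_derivative deriv g z) (at z)" if "z \<in> T" for z
    using assms that holomorphic_derivI by blast
  have d2: "(deriv g has_field_derivative deriv (deriv g) z) (at z)" if "z \<in> T" for z
    using assms that holomorphic_derivI holomorphic_deriv by blast
  have df: "\<phi> differentiable (at (g z))" "pdx \<phi> differentiable (at (g z))" "pdy \<phi> differentiable (at (g z))"
    if "z \<in> T" for z
    using that assms(3,4) by (auto simp: numeral_2_eq_2)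
  let ?a = "\<lambda>z. Re (deriv g z)" and ?b = "\<lambda>z. Im (deriv g z)" and ?mb = "\<lambda>z. - Im (deriv g z)"
  note bl = bounded_linear_Re bounded_linear_Im bounded_linear_minus[OF bounded_linear_Im]
  note da = pd_linear[OF bl(1) pd_holomorphic(1)[OF d2[OF assms(5)]]]
    pd_linear[OF bl(2) pd_holomorphic(1)[OF d2[OF assms(5)]]]
    pd_linear[OF bl(3) pd_holomorphic(1)[OF d2[OF assms(5)]]]
  note dc = pd_compose_holomorphic[OF d df(2), OF assms(5,5)] pd_compose_holomorphic[OF d df(3), OF assms(5,5)]
  note B = pd_bilinear[OF bounded_bilinear_scaleR]
  have "pdx (pdx (\<phi> \<circ> g)) z = pdx (\<lambda>z. ?a z *\<^sub>R (pdx \<phi> \<circ> g) z + ?b z *\<^sub>R (pdy \<phi> \<circ> g) z) z"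
    by (rule pd_cong_open[OF assms(1,5)]) (simp add: pd_compose_holomorphic(2)[OF d df(1)] del: o_apply, simp)
  also have "\<dots> = (?a z *\<^sub>R pdx (pdx \<phi> \<circ> g) z + pdx ?a z *\<^sub>R (pdx \<phi> \<circ> g) z)
      + (?b z *\<^sub>R pdx (pdy \<phi> \<circ> g) z + pdx ?b z *\<^sub>R (pdy \<phi> \<circ> g) z)"
    using pd_add(2)[OF B(1)[OF da(1) dc(1)] B(1)[OF da(4) dc(4)]]
    by (simp only: B(2)[OF da(1) dc(1)] B(2)[OF da(4) dc(4)])
  finally have xx: "pdx (pdx (\<phi> \<circ> g)) z = \<dots>" .
  have "pdy (pdy (\<phi> \<circ> g)) z = pdy (\<lambda>z. ?mb z *\<^sub>R (pdx \<phi> \<circ> g) z + ?a z *\<^sub>R (pdy \<phi> \<circ> g) z) z"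
    by (rule pd_cong_open[OF assms(1,5)]) (simp add: pd_compose_holomorphic(3)[OF d df(1)] del: o_apply, simp)
  also have "\<dots> = (?mb z *\<^sub>R pdy (pdx \<phi> \<circ> g) z + pdy ?mb z *\<^sub>R (pdx \<phi> \<circ> g) z)
      + (?a z *\<^sub>R pdy (pdy \<phi> \<circ> g) z + pdy ?a z *\<^sub>R (pdy \<phi> \<circ> g) z)"
    using pd_add(3)[OF B(1)[OF da(7) dc(1)] B(1)[OF da(1) dc(4)]]
    by (simp only: B(3)[OF da(7) dc(1)] B(3)[OF da(1) dc(4)])
  finally have yy: "pdy (pdy (\<phi> \<circ> g)) z = \<dots>" .
  have nrm: "cmod (deriv g z) ^ 2 = ?a z * ?a z + ?b z * ?b z"
    by (simp only: cmod_power2) (simp only: power2_eq_square)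
  show ?thesis
    unfolding laplacian_def xx yy nrm da dc pd_holomorphic(2,3)[OF d2[OF assms(5)]] o_apply
    by (simp add: scaleR_add_right scaleR_diff_right scaleR_add_left scaleR_diff_left mult.commute)
qed

section \<open>Ordinary differential equations\<close>

text \<open>
  \<open>exp (-2Lt) |X t|\<^sup>2\<close> is nonincreasing.
\<close>

lemma gronwall_zero:
  fixes X :: "real \<Rightarrow> 'e::real_inner"
  assumes "0 \<le> T"
    and D: "\<And>t. t \<in> {0..T} \<Longrightarrow> (X has_vector_derivative X' t) (at t within {0..T})"
    and B: "\<And>t. t \<in> {0..T} \<Longrightarrow> norm (X' t) \<le> L * norm (X t)"
    and X0: "X 0 = 0"
  shows "\<forall>t\<in>{0..T}. X t = 0"
proof
  fix s assume s: "s \<in> {0..T}"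
  define g where "g t = exp (- (2 * L * t)) * (X t \<bullet> X t)" for t
  have dX: "(X has_derivative (\<lambda>h. h *\<^sub>R X' t)) (at t within {0..s})" if "t \<in> {0..s}" for t
    using D[of t] that s by (auto simp: has_vector_derivative_def intro: has_derivative_subset)
  have dq: "((\<lambda>t. X t \<bullet> X t) has_real_derivative 2 * (X t \<bullet> X' t)) (at t within {0..s})" if "t \<in> {0..s}" for t
    unfolding has_field_derivative_def
    by (rule has_derivative_eq_rhs[OF has_derivative_inner[OF dX[OF that] dX[OF that]]])
      (simp add: fun_eq_iff inner_commute[of "X' t"])
  have dg: "(g has_real_derivative exp (- (2 * L * t)) * (2 * (X t \<bullet> X' t) - 2 * L * (X t \<bullet> X t)))
      (at t within {0..s})" if "t \<in> {0..s}" for t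
    unfolding g_def by (rule derivative_eq_intros dq[OF that] refl)+ (simp add: algebra_simps)
  have le: "exp (- (2 * L * t)) * (2 * (X t \<bullet> X' t) - 2 * L * (X t \<bullet> X t)) \<le> 0" if "t \<in> {0..s}" for t
  proof -
    have "X t \<bullet> X' t \<le> norm (X t) * norm (X' t)"
      by (rule norm_cauchy_schwarz)
    also have "\<dots> \<le> norm (X t) * (L * norm (X t))"
      using B[of t] that s by (intro mult_left_mono) auto
    also have "\<dots> = L * (X t \<bullet> X t)"
      by (simp add: dot_square_norm power2_eq_square)
    finally have "X t \<bullet> X' t \<le> L * (X t \<bullet> X t)" .
    then have "2 * (X t \<bullet> X' t) - 2 * L * (X t \<bullet> X t) \<le> 0" by simp
    then show ?thesis by (rule mult_nonneg_nonpos[OF exp_ge_zero])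
  qed
  have "g s \<le> g 0"
  proof (rule DERIV_nonpos_imp_decreasing_open[where a=0 and b=s and f=g])
    fix t assume t: "0 < t" "t < s"
    then have a: "at t within {0..s} = at t" and t': "t \<in> {0..s}"
      by (simp_all add: at_within_Icc_at)
    show "\<exists>y. DERIV g t :> y \<and> y \<le> 0"
      by (rule exI, rule conjI[OF dg[OF t', unfolded a] le[OF t']])
  next
    show "continuous_on {0..s} g"
      by (rule DERIV_continuous_on[OF dg])
  qed (use s in auto)
  then have "exp (- (2 * L * s)) * (X s \<bullet> X s) \<le> 0"
    by (simp add: g_def X0)
  then have "X s \<bullet> X s \<le> 0"
    by (simp add: mult_le_0_iff)
  then show "X s = 0"
    using inner_gt_zero_iff[of "X s"] not_le by blast
qed

lemma C_on_1_lipschitz: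
  fixes f :: "complex \<Rightarrow> 'b::real_normed_vector"
  assumes "C_on 1 f S" "cball p r \<subseteq> S"
  obtains L where "L \<ge> 0" "\<And>x z. x \<in> cball p r \<Longrightarrow> z \<in> cball p r \<Longrightarrow> norm (f x - f z) \<le> L * norm (x - z)"
proof -
  have "continuous_on (cball p r) (\<lambda>z. norm (pdx f z) + norm (pdy f z))"
    using assms by (auto intro!: continuous_intros intro: continuous_on_subset)
  then have "bounded ((\<lambda>z. norm (pdx f z) + norm (pdy f z)) ` cball p r)"
    by (intro compact_imp_bounded compact_continuous_image) auto
  then obtain L where L: "L > 0" "\<And>z. z \<in> cball p r \<Longrightarrow> norm (pdx f z) + norm (pdy f z) \<le> L"
    by (force simp: bounded_pos)
  have "norm (f x - f z) \<le> L * norm (x - z)" if "x \<in> cball p r" "z \<in> cball p r" for x z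
  proof (rule differentiable_bound[OF convex_cball _ _ that(1) that(2)])
    fix w assume w: "w \<in> cball p r"
    show "(f has_derivative (\<lambda>e. Re e *\<^sub>R pdx f w + Im e *\<^sub>R pdy f w)) (at w within cball p r)"
      using assms w by (intro has_derivative_at_withinI[OF has_derivative_pd]) auto
    show "onorm (\<lambda>e. Re e *\<^sub>R pdx f w + Im e *\<^sub>R pdy f w) \<le> L"
    proof (rule onorm_bound)
      fix e :: complex
      have "norm (Re e *\<^sub>R pdx f w + Im e *\<^sub>R pdy f w) \<le> \<bar>Re e\<bar> * norm (pdx f w) + \<bar>Im e\<bar> * norm (pdy f w)"
        by (rule norm_triangle_le) simp
      also have "\<dots> \<le> cmod e * norm (pdx f w) + cmod e * norm (pdy f w)"
        by (intro add_mono mult_right_mono abs_Re_le_cmod abs_Im_le_cmod) auto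
      also have "\<dots> \<le> L * cmod e"
        using mult_left_mono[OF L(2)[OF w], of "cmod e"] by (simp add: algebra_simps)
      finally show "norm (Re e *\<^sub>R pdx f w + Im e *\<^sub>R pdy f w) \<le> L * norm e" .
    qed (use L in auto)
  qed
  then show ?thesis using L(1) that[of L] by auto
qed

text \<open>
  The right-hand sides are Lipschitz in \<open>(\<zeta>, \<omega>)\<close> on bounded sets, so Gronwall's lemma applies to the
  difference of two solutions. With \<open>a = 1\<close>, \<open>B = 0\<close> this is the geodesic equation; with \<open>B\<close> the
  Christoffel symbol of the source metric it is the equation satisfied along a segment of direction
  \<open>a\<close> by a holomorphic local isometry and its derivative.
\<close>

lemma second_order_unique:
  fixes \<Gamma> :: "complex \<Rightarrow> complex"
  assumes T: "0 \<le> T" and \<Gamma>: "C_on 1 \<Gamma> S" "cball p r \<subseteq> S"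
    and B: "continuous_on {0..T} B"
    and D: "\<And>t. t \<in> {0..T} \<Longrightarrow> (\<zeta> has_vector_derivative a * \<omega> t) (at t within {0..T})"
      "\<And>t. t \<in> {0..T} \<Longrightarrow> (\<omega> has_vector_derivative a * (B t * \<omega> t - \<Gamma> (\<zeta> t) * (\<omega> t)\<^sup>2)) (at t within {0..T})"
      "\<And>t. t \<in> {0..T} \<Longrightarrow> (\<zeta>' has_vector_derivative a * \<omega>' t) (at t within {0..T})"
      "\<And>t. t \<in> {0..T} \<Longrightarrow> (\<omega>' has_vector_derivative a * (B t * \<omega>' t - \<Gamma> (\<zeta>' t) * (\<omega>' t)\<^sup>2)) (at t within {0..T})"
    and p: "\<And>t. t \<in> {0..T} \<Longrightarrow> \<zeta> t \<in> cball p r" "\<And>t. t \<in> {0..T} \<Longrightarrow> \<zeta>' t \<in> cball p r"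
    and init: "\<zeta> 0 = \<zeta>' 0" "\<omega> 0 = \<omega>' 0"
  shows "\<forall>t\<in>{0..T}. \<zeta> t = \<zeta>' t \<and> \<omega> t = \<omega>' t"
proof -
  obtain L where L: "L \<ge> 0" "\<And>x z. x \<in> cball p r \<Longrightarrow> z \<in> cball p r \<Longrightarrow> cmod (\<Gamma> x - \<Gamma> z) \<le> L * cmod (x - z)"
    by (rule C_on_1_lipschitz[OF \<Gamma>]) blast
  have bnd: "\<exists>K>0. \<forall>x\<in>C. cmod (f x) \<le> K" if "continuous_on C f" "compact C" for f :: "'t::{t2_space} \<Rightarrow> complex" and C
    using compact_imp_bounded[OF compact_continuous_image[OF that]] by (auto simp: bounded_pos)
  have c: "continuous_on {0..T} \<omega>" "continuous_on {0..T} \<omega>'" "continuous_on (cball p r) \<Gamma>"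
    by (rule continuous_on_vector_derivative[OF D(2)], assumption)
      (rule continuous_on_vector_derivative[OF D(4)], assumption,
       rule continuous_on_subset[OF C_on_imp_continuous[OF \<Gamma>(1)] \<Gamma>(2)])
  obtain K1 where K1: "K1 > 0" "\<And>t. t \<in> {0..T} \<Longrightarrow> cmod (\<omega> t) \<le> K1" using bnd[OF c(1) compact_Icc] by blast
  obtain K2 where K2: "K2 > 0" "\<And>t. t \<in> {0..T} \<Longrightarrow> cmod (\<omega>' t) \<le> K2" using bnd[OF c(2) compact_Icc] by blast
  obtain M where M: "M > 0" "\<And>x. x \<in> cball p r \<Longrightarrow> cmod (\<Gamma> x) \<le> M" using bnd[OF c(3) compact_cball] by blast
  obtain N where N: "N > 0" "\<And>t. t \<in> {0..T} \<Longrightarrow> cmod (B t) \<le> N" using bnd[OF B compact_Icc] by blast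
  define X where "X t = (\<zeta> t - \<zeta>' t, \<omega> t - \<omega>' t)" for t
  define X' where "X' t = (a * \<omega> t - a * \<omega>' t, a * (B t * \<omega> t - \<Gamma> (\<zeta> t) * (\<omega> t)\<^sup>2)
      - a * (B t * \<omega>' t - \<Gamma> (\<zeta>' t) * (\<omega>' t)\<^sup>2))" for t
  define C where "C = cmod a * (1 + N + M * (K1 + K2) + L * K2^2)"
  have "\<forall>t\<in>{0..T}. X t = 0"
  proof (rule gronwall_zero[OF T])
    fix t assume t: "t \<in> {0..T}"
    show "(X has_vector_derivative X' t) (at t within {0..T})"
      unfolding X_def X'_def
      by (intro has_vector_derivative_Pair has_vector_derivative_diff D t)
    let ?n = "norm (X t)"
    have n: "cmod (\<zeta> t - \<zeta>' t) \<le> ?n" "cmod (\<omega> t - \<omega>' t) \<le> ?n"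
      unfolding X_def by (rule norm_fst_le norm_snd_le)+
    have 1: "cmod (B t * \<omega> t - B t * \<omega>' t) \<le> N * ?n"
      unfolding right_diff_distrib[symmetric] norm_mult using N(2)[OF t] n N(1)
      by (intro mult_mono) auto
    have e: "\<Gamma> (\<zeta> t) * (\<omega> t)\<^sup>2 - \<Gamma> (\<zeta>' t) * (\<omega>' t)\<^sup>2
        = \<Gamma> (\<zeta> t) * ((\<omega> t + \<omega>' t) * (\<omega> t - \<omega>' t)) + (\<Gamma> (\<zeta> t) - \<Gamma> (\<zeta>' t)) * (\<omega>' t)\<^sup>2"
      by (simp add: algebra_simps power2_eq_square)
    have s: "cmod (\<omega> t + \<omega>' t) \<le> K1 + K2"
      using K1(2)[OF t] K2(2)[OF t] by (intro norm_triangle_mono)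
    have 2: "cmod (\<Gamma> (\<zeta> t) * ((\<omega> t + \<omega>' t) * (\<omega> t - \<omega>' t))) \<le> M * ((K1 + K2) * ?n)"
      unfolding norm_mult using M(2)[OF p(1)[OF t]] s n M(1) K1(1) K2(1)
      by (intro mult_mono) auto
    have "cmod (\<Gamma> (\<zeta> t) - \<Gamma> (\<zeta>' t)) \<le> L * ?n"
      using L(2)[OF p(1)[OF t] p(2)[OF t]] n(1) mult_left_mono[OF n(1) L(1)] by linarith
    then have 3: "cmod ((\<Gamma> (\<zeta> t) - \<Gamma> (\<zeta>' t)) * (\<omega>' t)\<^sup>2) \<le> (L * ?n) * K2\<^sup>2"
      unfolding norm_mult norm_power using K2(2)[OF t] L(1)
      by (intro mult_mono power_mono) auto
    have "cmod ((B t * \<omega> t - \<Gamma> (\<zeta> t) * (\<omega> t)\<^sup>2) - (B t * \<omega>' t - \<Gamma> (\<zeta>' t) * (\<omega>' t)\<^sup>2))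
      = cmod ((B t * \<omega> t - B t * \<omega>' t) - (\<Gamma> (\<zeta> t) * (\<omega> t)\<^sup>2 - \<Gamma> (\<zeta>' t) * (\<omega>' t)\<^sup>2))"
      by (simp add: algebra_simps)
    also have "\<dots> \<le> N * ?n + (M * ((K1 + K2) * ?n) + (L * ?n) * K2\<^sup>2)"
      unfolding e
      by (rule order_trans[OF norm_triangle_ineq4 add_mono[OF 1 order_trans[OF norm_triangle_ineq add_mono[OF 2 3]]]])
    finally have 4: "cmod (a * (B t * \<omega> t - \<Gamma> (\<zeta> t) * (\<omega> t)\<^sup>2) - a * (B t * \<omega>' t - \<Gamma> (\<zeta>' t) * (\<omega>' t)\<^sup>2))
        \<le> cmod a * (N * ?n + (M * ((K1 + K2) * ?n) + (L * ?n) * K2\<^sup>2))"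
      unfolding right_diff_distrib[of a, symmetric] norm_mult by (intro mult_left_mono) auto
    have 5: "cmod (a * \<omega> t - a * \<omega>' t) \<le> cmod a * ?n"
      unfolding right_diff_distrib[symmetric] norm_mult using n by (intro mult_left_mono) auto
    have "norm (X' t) \<le> cmod a * ?n + cmod a * (N * ?n + (M * ((K1 + K2) * ?n) + (L * ?n) * K2\<^sup>2))"
      unfolding X'_def by (rule order_trans[OF norm_Pair_le add_mono[OF 5 4]])
    also have "\<dots> = C * ?n" by (simp add: C_def algebra_simps)
    finally show "norm (X' t) \<le> C * norm (X t)" .
  qed (simp add: X_def init zero_prod_def)
  then show ?thesis by (auto simp: X_def zero_prod_def)
qed

lemma primitive_on_ball:
  assumes "f holomorphic_on ball z0 \<delta>"
  obtains g where "g z0 = 0" "\<And>z. z \<in> ball z0 \<delta> \<Longrightarrow> (g has_field_derivative f z) (at z)"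
proof -
  obtain g where g: "\<And>z. z \<in> ball z0 \<delta> \<Longrightarrow> (g has_field_derivative f z) (at z within ball z0 \<delta>)"
    by (rule holomorphic_convex_primitive[of "ball z0 \<delta>" "{}" f])
      (use assms in \<open>auto intro: holomorphic_on_imp_continuous_on holomorphic_on_imp_differentiable_at\<close>)
  show ?thesis
  proof (rule that[of "\<lambda>z. g z - g z0"])
    fix z assume z: "z \<in> ball z0 \<delta>"
    have "(g has_field_derivative f z) (at z)"
      using g[OF z] at_within_open[OF z open_ball] by simp
    then show "((\<lambda>z. g z - g z0) has_field_derivative f z) (at z)"
      by (auto intro!: derivative_eq_intros)
  qed simp
qed

text \<open>
  Picard iteration. One step integrates \<open>-\<tau> w\<close> twice from the centre, which on a small enough disc
  halves the supremum norm; so the corrections sum up together with their derivatives.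
\<close>

lemma linear_ode_exists:
  fixes \<tau> :: "complex \<Rightarrow> complex"
  assumes "\<tau> holomorphic_on ball z0 R" "R > 0"
  obtains \<delta> where "0 < \<delta>" "\<delta> \<le> R"
    "\<And>a b. \<exists>w w'. w z0 = a \<and> w' z0 = b \<and> (\<forall>z\<in>ball z0 \<delta>. (w has_field_derivative w' z) (at z) \<and>
        (w' has_field_derivative - (\<tau> z * w z)) (at z))"
proof -
  have "continuous_on (cball z0 (R/2)) \<tau>"
    using assms by (auto intro!: holomorphic_on_imp_continuous_on elim: holomorphic_on_subset)
  then have "bounded (\<tau> ` cball z0 (R/2))"
    by (intro compact_imp_bounded compact_continuous_image) auto
  then obtain M where M: "M > 0" "\<And>z. z \<in> cball z0 (R/2) \<Longrightarrow> cmod (\<tau> z) \<le> M"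
    by (force simp: bounded_pos)
  define \<delta> where "\<delta> = min (R/2) (min 1 (1 / (2 * M)))"
  have \<delta>: "\<delta> > 0" "\<delta> \<le> R/2" "\<delta> \<le> 1" "\<delta> \<le> 1 / (2 * M)"
    using assms(2) M(1) by (auto simp: \<delta>_def)
  have M\<delta>: "M * \<delta> \<le> 1/2" using \<delta>(4) M(1) by (simp add: field_simps)
  let ?B = "ball z0 \<delta>"
  have \<tau>h: "\<tau> holomorphic_on ?B" using assms(1) \<delta> by (auto elim!: holomorphic_on_subset)
  have \<tau>M: "cmod (\<tau> z) \<le> M" if "z \<in> ?B" for z using M(2)[of z] that \<delta> by auto
  define J where "J f = (SOME g. g z0 = 0 \<and> (\<forall>z\<in>?B. (g has_field_derivative f z) (at z)))" for f :: "complex \<Rightarrow> complex"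
  have J: "J f z0 = 0 \<and> (\<forall>z\<in>?B. (J f has_field_derivative f z) (at z))" if hf: "f holomorphic_on ?B" for f
  proof -
    obtain g where "g z0 = 0" "\<And>z. z \<in> ?B \<Longrightarrow> (g has_field_derivative f z) (at z)"
      by (rule primitive_on_ball[OF hf]) blast
    then have "g z0 = 0 \<and> (\<forall>z\<in>?B. (g has_field_derivative f z) (at z))" by simp
    then show ?thesis
      unfolding J_def by (rule someI[where P="\<lambda>g. g z0 = 0 \<and> (\<forall>z\<in>?B. (g has_field_derivative f z) (at z))"])
  qed
  have Jh: "J f holomorphic_on ?B" if "f holomorphic_on ?B" for f
    using J[OF that] holomorphic_on_open[OF open_ball] by blast
  have Jb: "cmod (J f z) \<le> K * \<delta>" if f: "f holomorphic_on ?B" "\<And>z. z \<in> ?B \<Longrightarrow> cmod (f z) \<le> K" and z: "z \<in> ?B" for f K z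
  proof -
    have "cmod (J f z - J f z0) \<le> K * cmod (z - z0)"
      by (rule field_differentiable_bound[of ?B]) (use J[OF f(1)] f(2) z \<delta> in \<open>auto intro: has_field_derivative_at_within\<close>)
    also have "\<dots> \<le> K * \<delta>"
    proof (rule mult_left_mono)
      show "cmod (z - z0) \<le> \<delta>" using z by (simp add: dist_norm norm_minus_commute)
      show "0 \<le> K" using f(2)[OF z] norm_ge_zero[of "f z"] by linarith
    qed
    finally show ?thesis using J[OF f(1)] by simp
  qed
  show ?thesis
  proof (rule that[of \<delta>])
    fix a b :: complex
    define w where "w = rec_nat (\<lambda>z. a + b * (z - z0)) (\<lambda>_ w. J (J (\<lambda>z. - (\<tau> z * w z))))"
    define w' where "w' n = (case n of 0 \<Rightarrow> (\<lambda>_. b) | Suc n \<Rightarrow> J (\<lambda>z. - (\<tau> z * w n z)))" for n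
    define w'' where "w'' n = (case n of 0 \<Rightarrow> (\<lambda>_. 0) | Suc n \<Rightarrow> (\<lambda>z. - (\<tau> z * w n z)))" for n
    have w_Suc: "w (Suc n) = J (J (\<lambda>z. - (\<tau> z * w n z)))" and w0: "w 0 = (\<lambda>z. a + b * (z - z0))" for n
      by (simp_all add: w_def)
    define K where "K = cmod a + cmod b + 1"
    have hol: "w n holomorphic_on ?B" for n
      by (induction n) (auto simp: w0 w_Suc intro!: holomorphic_intros Jh \<tau>h)
    have wb: "cmod (w n z) \<le> K * (1/2)^n" if "z \<in> ?B" for n z
      using that
    proof (induction n arbitrary: z)
      case 0
      have "cmod (a + b * (z - z0)) \<le> cmod a + cmod b * cmod (z - z0)"
        by (rule order_trans[OF norm_triangle_ineq]) (simp add: norm_mult)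
      also have "\<dots> \<le> cmod a + cmod b * 1"
        using 0 \<delta>(3) by (intro add_left_mono mult_left_mono) (auto simp: dist_norm norm_minus_commute)
      finally show ?case by (simp add: w0 K_def)
    next
      case (Suc n)
      have 1: "cmod (- (\<tau> z * w n z)) \<le> M * (K * (1/2)^n)" if "z \<in> ?B" for z
        using \<tau>M[OF that] Suc.IH[OF that] M(1) by (simp add: norm_mult mult_mono)
      have h: "(\<lambda>z. - (\<tau> z * w n z)) holomorphic_on ?B" by (intro holomorphic_intros hol \<tau>h)
      have "cmod (w (Suc n) z) \<le> (M * (K * (1/2)^n) * \<delta>) * \<delta>"
        unfolding w_Suc by (rule Jb[OF Jh[OF h] Jb[OF h 1] Suc.prems])
      also have "\<dots> \<le> (M * (K * (1/2)^n) * \<delta>) * 1"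
        using M(1) \<delta> by (intro mult_left_mono) (auto simp: K_def)
      also have "\<dots> = (M * \<delta>) * (K * (1/2)^n)" by simp
      also have "\<dots> \<le> (1/2) * (K * (1/2)^n)"
        using M\<delta> by (intro mult_right_mono) (auto simp: K_def)
      finally show ?case by simp
    qed
    have w'b: "cmod (w' n z) \<le> K * (1/2)^n" if z: "z \<in> ?B" for n z
    proof (cases n)
      case 0
      then show ?thesis by (simp add: w'_def K_def)
    next
      case (Suc n)
      have 1: "cmod (- (\<tau> z * w n z)) \<le> M * (K * (1/2)^n)" if "z \<in> ?B" for z
        using \<tau>M[OF that] wb[OF that, of n] M(1) by (simp add: norm_mult mult_mono)
      have h: "(\<lambda>z. - (\<tau> z * w n z)) holomorphic_on ?B" by (intro holomorphic_intros hol \<tau>h)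
      have "cmod (J (\<lambda>z. - (\<tau> z * w n z)) z) \<le> M * (K * (1/2)^n) * \<delta>"
        by (rule Jb[OF h 1 z])
      also have "\<dots> = (M * \<delta>) * (K * (1/2)^n)" by simp
      also have "\<dots> \<le> (1/2) * (K * (1/2)^n)"
        using M\<delta> by (intro mult_right_mono) (auto simp: K_def)
      finally show ?thesis by (simp add: w'_def Suc)
    qed
    have d1: "(w n has_field_derivative w' n z) (at z)" if "z \<in> ?B" for n z
    proof (cases n)
      case 0
      then show ?thesis by (auto simp: w0 w'_def intro!: derivative_eq_intros)
    next
      case (Suc m)
      have h: "(\<lambda>z. - (\<tau> z * w m z)) holomorphic_on ?B" by (intro holomorphic_intros hol \<tau>h)
      show ?thesis using J[OF Jh[OF h]] that by (simp add: Suc w_Suc w'_def)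
    qed
    have d2: "(w' n has_field_derivative w'' n z) (at z)" if "z \<in> ?B" for n z
    proof (cases n)
      case 0
      then show ?thesis by (auto simp: w'_def w''_def)
    next
      case (Suc m)
      have h: "(\<lambda>z. - (\<tau> z * w m z)) holomorphic_on ?B" by (intro holomorphic_intros hol \<tau>h)
      show ?thesis using J[OF h] that by (simp add: Suc w''_def w'_def)
    qed
    have sm: "summable (\<lambda>n. K * (1/2)^n)" by (intro summable_mult summable_geometric) simp
    obtain W W' where W: "\<forall>z\<in>?B. ((\<lambda>n. w n z) sums W z) \<and> ((\<lambda>n. w' n z) sums W' z) \<and> (W has_field_derivative W' z) (at z)"
      by (rule series_and_derivative_comparison[OF open_ball sm, of z0 \<delta> w w']) (use d1 wb in auto)
    obtain V V' where V: "\<forall>z\<in>?B. ((\<lambda>n. w' n z) sums V z) \<and> ((\<lambda>n. w'' n z) sums V' z) \<and> (V has_field_derivative V' z) (at z)"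
      by (rule series_and_derivative_comparison[OF open_ball sm, of z0 \<delta> w' w'']) (use d2 w'b in auto)
    have VW: "V z = W' z" if "z \<in> ?B" for z
      using V W that sums_unique2 by blast
    have V': "V' z = - (\<tau> z * W z)" if z: "z \<in> ?B" for z
    proof -
      have "(\<lambda>n. - (\<tau> z * w n z)) sums (- (\<tau> z * W z))"
        using W z by (intro sums_minus sums_mult) auto
      then have "(\<lambda>n. w'' (Suc n) z) sums (- (\<tau> z * W z))" by (simp add: w''_def)
      then have "(\<lambda>n. w'' n z) sums (- (\<tau> z * W z) + w'' 0 z)" by (subst (asm) sums_Suc_iff) simp
      then show ?thesis using V z sums_unique2 by (fastforce simp: w''_def)
    qed
    have z0: "z0 \<in> ?B" using \<delta> by simp
    have hh: "(\<lambda>z. - (\<tau> z * w n z)) holomorphic_on ?B" for n by (intro holomorphic_intros hol \<tau>h)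
    have "(\<lambda>n. w n z0) = (\<lambda>n. if n = 0 then a else 0)"
    proof
      fix n show "w n z0 = (if n = 0 then a else 0)"
        using J[OF Jh[OF hh]] by (cases n) (auto simp: w0 w_Suc)
    qed
    then have a: "W z0 = a" using W z0 sums_single[of 0 "\<lambda>_. a"] sums_unique2 by fastforce
    have "(\<lambda>n. w' n z0) = (\<lambda>n. if n = 0 then b else 0)"
    proof
      fix n show "w' n z0 = (if n = 0 then b else 0)"
        using J[OF hh] by (cases n) (auto simp: w'_def)
    qed
    then have b: "W' z0 = b" using W z0 sums_single[of 0 "\<lambda>_. b"] sums_unique2 by fastforce
    have "(V has_field_derivative - (\<tau> z * W z)) (at z)" if "z \<in> ?B" for z
      using V V' that by auto
    moreover have "V z0 = b" using VW[OF z0] b by simp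
    moreover have "(W has_field_derivative V z) (at z)" if "z \<in> ?B" for z using W VW that by auto
    ultimately show "\<exists>w w'. w z0 = a \<and> w' z0 = b \<and> (\<forall>z\<in>ball z0 \<delta>. (w has_field_derivative w' z) (at z) \<and>
        (w' has_field_derivative - (\<tau> z * w z)) (at z))" using a by blast
  qed (use \<delta> in auto)
qed

section \<open>Liouville's theorem on metrics of curvature \<open>-1\<close>\<close>

lemma pd_ln:
  fixes f :: "complex \<Rightarrow> real"
  assumes "f differentiable (at z)" "f z > 0"
  shows "(\<lambda>z. ln (f z)) differentiable (at z)"
    "pdx (\<lambda>z. ln (f z)) z = pdx f z * inverse (f z)"
    "pdy (\<lambda>z. ln (f z)) z = pdy f z * inverse (f z)"
  using pd_eqI[OF has_derivative_ln[OF assms(2) has_derivative_pd[OF assms(1)]]]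
  by (simp_all add: field_simps)

lemma C_on_ln:
  fixes f :: "complex \<Rightarrow> real"
  assumes "open S" "\<And>z. z \<in> S \<Longrightarrow> f z > 0" "C_on k f S"
  shows "C_on k (\<lambda>z. ln (f z)) S"
proof (cases k)
  case 0
  then show ?thesis using assms(2,3) by (auto intro!: continuous_on_ln simp: less_imp_neq[symmetric])
next
  case (Suc j)
  have nz: "f z \<noteq> 0" if "z \<in> S" for z using assms(2)[OF that] by simp
  have d: "f differentiable (at z)" if "z \<in> S" for z using assms(3) that by (simp add: Suc)
  have C: "C_on j (pdx f) S" "C_on j (pdy f) S" "C_on j (\<lambda>z. inverse (f z)) S"
    using assms(3) C_on_inverse[OF assms(1) nz C_on_Suc_imp[of j f S]] by (simp_all add: Suc)
  have "C_on j (pdx (\<lambda>z. ln (f z))) S"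
    by (rule C_on_cong[OF assms(1), THEN iffD2, rotated], rule C_on_mult[OF assms(1) C(1,3)])
      (rule pd_ln(2)[OF d assms(2)])
  moreover have "C_on j (pdy (\<lambda>z. ln (f z))) S"
    by (rule C_on_cong[OF assms(1), THEN iffD2, rotated], rule C_on_mult[OF assms(1) C(2,3)])
      (rule pd_ln(3)[OF d assms(2)])
  ultimately show ?thesis using pd_ln(1)[OF d assms(2)] by (simp add: Suc)
qed

lemma cauchy_riemann_holomorphic:
  assumes "open S" "\<And>z. z \<in> S \<Longrightarrow> f differentiable (at z)"
    "\<And>z. z \<in> S \<Longrightarrow> pdx f z + \<i> * pdy f z = 0"
  shows "f holomorphic_on S"
proof -
  have "(f has_field_derivative pdx f z) (at z)" if z: "z \<in> S" for z
  proof -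
    have "pdy f z = \<i> * pdx f z"
      using assms(3)[OF z] by (simp add: complex_eq_iff)
    then have "(\<lambda>e. Re e *\<^sub>R pdx f z + Im e *\<^sub>R pdy f z) = (*) (pdx f z)"
      by (simp add: fun_eq_iff complex_eq_iff)
    then show ?thesis
      using has_derivative_pd[OF assms(2)[OF z]] by (simp add: has_field_derivative_def)
  qed
  then show ?thesis using holomorphic_on_open[OF assms(1)] by blast
qed

text \<open>
  Here \<open>X\<close> and \<open>Y\<close> stand for the partial derivatives of \<open>P = 2 \<partial>h/\<partial>\<zeta>\<close>; the hypothesis holds because
  \<open>2 \<partial>P/\<partial>\<zeta>' = \<Delta>h\<close> is real, with \<open>\<zeta>'\<close> the conjugate of \<open>\<zeta>\<close>. The identity makes the
  antiholomorphic derivative of \<open>\<tau>\<close> below vanish.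
\<close>

lemma wirtinger_identity:
  fixes P X Y :: complex
  assumes "Im (X + \<i> * Y) = 0"
  shows "2 * (of_real (P \<bullet> X) - \<i> * of_real (P \<bullet> Y)) - (X + \<i> * Y) * P = cnj P * (X - \<i> * Y)"
proof -
  have "Re Y = - Im X" using assms by simp
  then show ?thesis by (simp add: complex_eq_iff inner_complex_def algebra_simps)
qed

text \<open>
  The reciprocal \<open>h\<close> of a density of curvature \<open>-1\<close> and its Wirtinger derivative
  \<open>P = 2 \<partial>h/\<partial>\<zeta>\<close> obey a closed first order system whose only free coefficient \<open>\<tau>\<close> is holomorphic
  (it is half the Schwarzian derivative of the developing map to be constructed).
\<close>

lemma curvature_system:
  fixes \<rho> :: "complex \<Rightarrow> real"
  assumes S: "open S" and pos: "\<And>\<zeta>. \<zeta> \<in> S \<Longrightarrow> \<rho> \<zeta> > 0" and sm: "smooth_on \<rho> S"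
    and curv: "\<And>\<zeta>. \<zeta> \<in> S \<Longrightarrow> gauss_curvature \<rho> \<zeta> = -1"
  obtains P \<tau> where "\<tau> holomorphic_on S"
    "\<And>\<zeta>. \<zeta> \<in> S \<Longrightarrow> ((\<lambda>\<zeta>. inverse (\<rho> \<zeta>)) has_derivative (\<lambda>e. Re (P \<zeta> * e))) (at \<zeta>)"
    "\<And>\<zeta>. \<zeta> \<in> S \<Longrightarrow> (P has_derivative (\<lambda>e. - 2 * \<tau> \<zeta> * of_real (inverse (\<rho> \<zeta>)) * e +
        of_real (((cmod (P \<zeta>))\<^sup>2 - 1) / (2 * inverse (\<rho> \<zeta>))) * cnj e)) (at \<zeta>)"
proof -
  define h where "h = (\<lambda>\<zeta>. inverse (\<rho> \<zeta>))"
  define P where "P = (\<lambda>\<zeta>. of_real (pdx h \<zeta>) + (- \<i>) * of_real (pdy h \<zeta>))"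
  define \<alpha> where "\<alpha> = (\<lambda>\<zeta>. (1/2) * (pdx P \<zeta> + (- \<i>) * pdy P \<zeta>))"
  define \<tau> where "\<tau> = (\<lambda>\<zeta>. (- 1/2) * \<alpha> \<zeta> * of_real (\<rho> \<zeta>))"
  have C\<rho>: "C_on k \<rho> S" for k using sm by (simp add: smooth_on_def)
  have nz: "\<rho> \<zeta> \<noteq> 0" if "\<zeta> \<in> S" for \<zeta> using pos[OF that] by simp
  have Ch: "C_on k h S" for k unfolding h_def by (rule C_on_inverse[OF S nz C\<rho>])
  have Chd: "C_on k (pdx h) S" "C_on k (pdy h) S" for k using Ch[of "Suc k"] by simp_all
  have bl: "bounded_linear (\<lambda>x. c * complex_of_real x)" "bounded_linear (\<lambda>x. c * x)" for c :: complex
    by (rule bounded_linear_compose[OF bounded_linear_mult_right bounded_linear_of_real])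
      (rule bounded_linear_mult_right)
  note bo = bl(1)[of 1, simplified]
  have CP: "C_on k P S" for k
    unfolding P_def by (rule C_on_add[OF S C_on_linear[OF S bo Chd(1)] C_on_linear[OF S bl(1) Chd(2)]])
  have CPd: "C_on k (pdx P) S" "C_on k (pdy P) S" for k using CP[of "Suc k"] by simp_all
  have diff: "f differentiable (at \<zeta>)" if "\<zeta> \<in> S" "\<And>k. C_on k f S" for f :: "complex \<Rightarrow> 'b::real_normed_vector" and \<zeta>
    using that(2)[of 1] that(1) by simp
  note dif = diff[OF _ C\<rho>] diff[OF _ Ch] diff[OF _ Chd(1)] diff[OF _ Chd(2)] diff[OF _ CP] diff[OF _ CPd(1)] diff[OF _ CPd(2)]
  have \<rho>d: "pdx \<rho> \<zeta> = - (pdx h \<zeta> * \<rho> \<zeta> ^ 2)" "pdy \<rho> \<zeta> = - (pdy h \<zeta> * \<rho> \<zeta> ^ 2)" if z: "\<zeta> \<in> S" for \<zeta>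
    using pd_inverse(2,3)[OF dif(1)[OF z] nz[OF z]] nz[OF z] by (simp_all add: h_def power2_eq_square field_simps)
  have lnd: "pdx (\<lambda>z. ln (\<rho> z)) \<zeta> = - (pdx h \<zeta> * \<rho> \<zeta>)" "pdy (\<lambda>z. ln (\<rho> z)) \<zeta> = - (pdy h \<zeta> * \<rho> \<zeta>)" if z: "\<zeta> \<in> S" for \<zeta>
    using pd_ln(2,3)[OF dif(1)[OF z] pos[OF z]] \<rho>d[OF z] nz[OF z] by (simp_all add: power2_eq_square)
  note bln = bounded_linear_minus[OF bounded_linear_ident]
  note bm = pd_bilinear[OF bounded_bilinear_mult]
  have lap: "pdx (pdx h) \<zeta> + pdy (pdy h) \<zeta> = ((pdx h \<zeta>)\<^sup>2 + (pdy h \<zeta>)\<^sup>2 - 1) * \<rho> \<zeta>" if z: "\<zeta> \<in> S" for \<zeta>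
  proof -
    have "pdx (pdx (\<lambda>z. ln (\<rho> z))) \<zeta> = pdx (\<lambda>\<zeta>. - (pdx h \<zeta> * \<rho> \<zeta>)) \<zeta>"
      by (rule pd_cong_open(2)[OF S z lnd(1)])
    also have "\<dots> = - (pdx h \<zeta> * pdx \<rho> \<zeta> + pdx (pdx h) \<zeta> * \<rho> \<zeta>)"
      by (simp only: pd_linear(2)[OF bln bm(1)[OF dif(3)[OF z] dif(1)[OF z]]] bm(2)[OF dif(3)[OF z] dif(1)[OF z]])
    finally have 1: "pdx (pdx (\<lambda>z. ln (\<rho> z))) \<zeta> = \<dots>" .
    have "pdy (pdy (\<lambda>z. ln (\<rho> z))) \<zeta> = pdy (\<lambda>\<zeta>. - (pdy h \<zeta> * \<rho> \<zeta>)) \<zeta>"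
      by (rule pd_cong_open(3)[OF S z lnd(2)])
    also have "\<dots> = - (pdy h \<zeta> * pdy \<rho> \<zeta> + pdy (pdy h) \<zeta> * \<rho> \<zeta>)"
      by (simp only: pd_linear(3)[OF bln bm(1)[OF dif(4)[OF z] dif(1)[OF z]]] bm(3)[OF dif(4)[OF z] dif(1)[OF z]])
    finally have 2: "pdy (pdy (\<lambda>z. ln (\<rho> z))) \<zeta> = \<dots>" .
    have 3: "laplacian (\<lambda>z. ln (\<rho> z)) \<zeta> = \<rho> \<zeta> ^ 2"
      using curv[OF z] nz[OF z] by (simp add: gauss_curvature_def field_simps)
    have "(pdx (pdx h) \<zeta> + pdy (pdy h) \<zeta>) * \<rho> \<zeta> = ((pdx h \<zeta>)\<^sup>2 + (pdy h \<zeta>)\<^sup>2 - 1) * \<rho> \<zeta> * \<rho> \<zeta>"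
      using 3 unfolding laplacian_def 1 2 \<rho>d[OF z] by (simp add: algebra_simps power2_eq_square)
    then show ?thesis using nz[OF z] by simp
  qed
  have Pd: "pdx P \<zeta> = of_real (pdx (pdx h) \<zeta>) + (- \<i>) * of_real (pdx (pdy h) \<zeta>)"
    "pdy P \<zeta> = of_real (pdy (pdx h) \<zeta>) + (- \<i>) * of_real (pdy (pdy h) \<zeta>)" if z: "\<zeta> \<in> S" for \<zeta>
    unfolding P_def
      pd_add(2,3)[OF pd_linear(1)[OF bo dif(3)[OF z]] pd_linear(1)[OF bl(1)[of "- \<i>"] dif(4)[OF z]]]
      pd_linear(2,3)[OF bo dif(3)[OF z]] pd_linear(2,3)[OF bl(1)[of "- \<i>"] dif(4)[OF z]] by (rule refl)+
  have nP: "(cmod (P \<zeta>))\<^sup>2 = (pdx h \<zeta>)\<^sup>2 + (pdy h \<zeta>)\<^sup>2" for \<zeta>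
    by (simp add: P_def cmod_power2)
  have PB: "pdx P \<zeta> + \<i> * pdy P \<zeta> = of_real ((P \<zeta> \<bullet> P \<zeta> - 1) * \<rho> \<zeta>)" if z: "\<zeta> \<in> S" for \<zeta>
    unfolding Pd[OF z] using mixed_partials_real[OF S z Ch] lap[OF z] nP[of \<zeta>]
    by (simp add: complex_eq_iff dot_square_norm)
  have Bd: "pdx (pdx P) \<zeta> + pdy (pdy P) \<zeta> =
      of_real (\<rho> \<zeta>) * (cnj (P \<zeta>) * (pdx P \<zeta> - \<i> * pdy P \<zeta>))" if z: "\<zeta> \<in> S" for \<zeta>
  proof -
    let ?b = "\<lambda>\<zeta>. (P \<zeta> \<bullet> P \<zeta> + - 1) * \<rho> \<zeta>" and ?B = "\<lambda>\<zeta>. pdx P \<zeta> + \<i> * pdy P \<zeta>"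
    note bi = pd_bilinear[OF bounded_bilinear_inner]
    have d1: "(\<lambda>\<zeta>. P \<zeta> \<bullet> P \<zeta>) differentiable (at \<zeta>)" by (rule bi(1)[OF dif(5)[OF z] dif(5)[OF z]])
    have cst: "(\<lambda>_. - 1 :: real) differentiable (at \<zeta>)" "pdx (\<lambda>_. - 1 :: real) \<zeta> = 0" "pdy (\<lambda>_. - 1 :: real) \<zeta> = 0"
      by (auto simp: pdx_def pdy_def)
    note d2 = pd_add[OF d1 cst(1)]
    have bx: "pdx ?b \<zeta> = (P \<zeta> \<bullet> P \<zeta> - 1) * pdx \<rho> \<zeta> + 2 * (P \<zeta> \<bullet> pdx P \<zeta>) * \<rho> \<zeta>"
      unfolding bm(2)[OF d2(1) dif(1)[OF z]] d2(2) cst(2) bi(2)[OF dif(5)[OF z] dif(5)[OF z]]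
      by (simp add: inner_commute)
    have by': "pdy ?b \<zeta> = (P \<zeta> \<bullet> P \<zeta> - 1) * pdy \<rho> \<zeta> + 2 * (P \<zeta> \<bullet> pdy P \<zeta>) * \<rho> \<zeta>"
      unfolding bm(3)[OF d2(1) dif(1)[OF z]] d2(3) cst(3) bi(3)[OF dif(5)[OF z] dif(5)[OF z]]
      by (simp add: inner_commute)
    note db = bm(1)[OF d2(1) dif(1)[OF z]]
    note dL = pd_linear[OF bl(2)[of \<i>] dif(7)[OF z]]
    have "pdx ?B \<zeta> = pdx (\<lambda>\<zeta>. of_real (?b \<zeta>)) \<zeta>"
      by (rule pd_cong_open(2)[OF S z]) (simp add: PB)
    then have Bx: "pdx (pdx P) \<zeta> + \<i> * pdx (pdy P) \<zeta> = of_real (pdx ?b \<zeta>)"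
      by (simp only: pd_add(2)[OF dif(6)[OF z] dL(1)] dL(2) pd_linear(2)[OF bo db])
    have "pdy ?B \<zeta> = pdy (\<lambda>\<zeta>. of_real (?b \<zeta>)) \<zeta>"
      by (rule pd_cong_open(3)[OF S z]) (simp add: PB)
    then have By: "pdy (pdx P) \<zeta> + \<i> * pdy (pdy P) \<zeta> = of_real (pdy ?b \<zeta>)"
      by (simp only: pd_add(3)[OF dif(6)[OF z] dL(1)] dL(3) pd_linear(3)[OF bo db])
    have "pdx (pdx P) \<zeta> + pdy (pdy P) \<zeta> =
       (pdx (pdx P) \<zeta> + \<i> * pdx (pdy P) \<zeta>) - \<i> * (pdy (pdx P) \<zeta> + \<i> * pdy (pdy P) \<zeta>)"
      using mixed_partials[OF S z CP] by (simp add: algebra_simps)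
    also have "\<dots> = of_real (pdx ?b \<zeta>) - \<i> * of_real (pdy ?b \<zeta>)"
      unfolding Bx By ..
    also have "\<dots> = of_real (\<rho> \<zeta>) * (2 * (of_real (P \<zeta> \<bullet> pdx P \<zeta>) - \<i> * of_real (P \<zeta> \<bullet> pdy P \<zeta>))
         - of_real ((P \<zeta> \<bullet> P \<zeta> - 1) * \<rho> \<zeta>) * P \<zeta>)"
      unfolding bx by' \<rho>d[OF z] by (simp add: P_def algebra_simps power2_eq_square)
    also have "\<dots> = of_real (\<rho> \<zeta>) * (cnj (P \<zeta>) * (pdx P \<zeta> - \<i> * pdy P \<zeta>))"
      unfolding PB[OF z, symmetric] by (subst wirtinger_identity) (simp_all only: PB[OF z] Im_complex_of_real)
    finally show ?thesis .
  qed
  have C\<alpha>: "C_on k \<alpha> S" for k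
    unfolding \<alpha>_def by (rule C_on_linear[OF S bl(2) C_on_add[OF S CPd(1) C_on_linear[OF S bl(2) CPd(2)]]])
  have \<alpha>d: "pdx \<alpha> \<zeta> + \<i> * pdy \<alpha> \<zeta> = of_real (\<rho> \<zeta>) * cnj (P \<zeta>) * \<alpha> \<zeta>" if z: "\<zeta> \<in> S" for \<zeta>
  proof -
    note dL = pd_linear[OF bl(2)[of "- \<i>"] dif(7)[OF z]]
    note dA = pd_add[OF dif(6)[OF z] dL(1)]
    note dM = pd_linear[OF bl(2)[of "1/2"] dA(1)]
    have "pdx \<alpha> \<zeta> + \<i> * pdy \<alpha> \<zeta> = (1/2) * (pdx (pdx P) \<zeta> + pdy (pdy P) \<zeta>)"
      unfolding \<alpha>_def dM(2,3) dA(2,3) dL(2,3) mixed_partials[OF S z CP] by (simp add: algebra_simps)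
    also have "\<dots> = of_real (\<rho> \<zeta>) * cnj (P \<zeta>) * \<alpha> \<zeta>"
      unfolding Bd[OF z] by (simp add: \<alpha>_def algebra_simps)
    finally show ?thesis .
  qed
  have C\<alpha>': "C_on k (\<lambda>\<zeta>. (-1/2) * \<alpha> \<zeta>) S" for k by (rule C_on_linear[OF S bl(2) C\<alpha>])
  have C\<rho>': "C_on k (\<lambda>\<zeta>. complex_of_real (\<rho> \<zeta>)) S" for k by (rule C_on_linear[OF S bo C\<rho>])
  have C\<tau>: "C_on k \<tau> S" for k
    unfolding \<tau>_def by (rule C_on_mult[OF S C\<alpha>' C\<rho>'])
  have "\<tau> holomorphic_on S"
  proof (rule cauchy_riemann_holomorphic[OF S])
    fix \<zeta> assume z: "\<zeta> \<in> S"
    show "\<tau> differentiable (at \<zeta>)" by (rule diff[OF z C\<tau>])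
    note d\<alpha>' = pd_linear[OF bl(2)[of "-1/2"] diff[OF z C\<alpha>]]
    note d\<rho>' = pd_linear[OF bo dif(1)[OF z]]
    have "pdx \<tau> \<zeta> + \<i> * pdy \<tau> \<zeta> = (-1/2) * ((pdx \<alpha> \<zeta> + \<i> * pdy \<alpha> \<zeta>) * of_real (\<rho> \<zeta>)
       + \<alpha> \<zeta> * of_real (pdx \<rho> \<zeta>) + \<i> * (\<alpha> \<zeta> * of_real (pdy \<rho> \<zeta>)))"
      unfolding \<tau>_def bm(2,3)[OF d\<alpha>'(1) d\<rho>'(1)] d\<alpha>'(2,3) d\<rho>'(2,3) by (simp add: algebra_simps)
    also have "\<dots> = 0"
      unfolding \<alpha>d[OF z] \<rho>d[OF z] by (simp add: P_def algebra_simps power2_eq_square)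
    finally show "pdx \<tau> \<zeta> + \<i> * pdy \<tau> \<zeta> = 0" .
  qed
  moreover have "((\<lambda>\<zeta>. inverse (\<rho> \<zeta>)) has_derivative (\<lambda>e. Re (P \<zeta> * e))) (at \<zeta>)" if z: "\<zeta> \<in> S" for \<zeta>
    unfolding h_def[symmetric]
    by (rule has_derivative_eq_rhs[OF has_derivative_pd[OF dif(2)[OF z]]]) (auto simp: P_def algebra_simps)
  moreover have "(P has_derivative (\<lambda>e. - 2 * \<tau> \<zeta> * of_real (inverse (\<rho> \<zeta>)) * e +
        of_real (((cmod (P \<zeta>))\<^sup>2 - 1) / (2 * inverse (\<rho> \<zeta>))) * cnj e)) (at \<zeta>)" if z: "\<zeta> \<in> S" for \<zeta>
  proof (rule has_derivative_eq_rhs[OF has_derivative_pd[OF dif(5)[OF z]]], rule ext)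
    fix e
    have 1: "- 2 * \<tau> \<zeta> * of_real (inverse (\<rho> \<zeta>)) = (1/2) * (pdx P \<zeta> - \<i> * pdy P \<zeta>)"
      using nz[OF z] by (simp add: \<tau>_def \<alpha>_def)
    have 2: "complex_of_real (((cmod (P \<zeta>))\<^sup>2 - 1) / (2 * inverse (\<rho> \<zeta>))) = (1/2) * (pdx P \<zeta> + \<i> * pdy P \<zeta>)"
      using nz[OF z] unfolding PB[OF z] by (simp add: dot_square_norm field_simps)
    show "Re e *\<^sub>R pdx P \<zeta> + Im e *\<^sub>R pdy P \<zeta> = - 2 * \<tau> \<zeta> * of_real (inverse (\<rho> \<zeta>)) * e +
        of_real (((cmod (P \<zeta>))\<^sup>2 - 1) / (2 * inverse (\<rho> \<zeta>))) * cnj e"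
      unfolding 1 2 by (simp add: complex_eq_iff field_simps)
  qed
  ultimately show ?thesis by (rule that)
qed


text \<open>
  For two solutions of \<open>w'' = -\<tau> w\<close> the last term is the constant Wronskian; so this is the relation
  \<open>h \<Delta>h = |\<nabla>h|\<^sup>2 - const\<close> which the curvature equation imposes on the reciprocal \<open>h\<close> of the density.
\<close>

lemma wronskian_identity:
  fixes a b a' b' :: complex
  shows "((cmod a)\<^sup>2 - (cmod b)\<^sup>2) * ((cmod a')\<^sup>2 - (cmod b')\<^sup>2)
    = (cmod (a' * cnj a - b' * cnj b))\<^sup>2 - (cmod (b' * a - b * a'))\<^sup>2"
  unfolding cmod_power2 by (simp add: power2_eq_square algebra_simps)

text \<open>
  Liouville's theorem: with two solutions \<open>w\<^sub>1, w\<^sub>2\<close> of \<open>w'' = -\<tau> w\<close> the function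
  \<open>|w\<^sub>2|\<^sup>2 - |w\<^sub>1|\<^sup>2\<close> solves the same system as the reciprocal of the density. Matching the
  values at \<open>p\<close> forces the two to agree, which says that \<open>w\<^sub>1 / w\<^sub>2\<close> is a local isometry to the disc.
\<close>

theorem liouville_local:
  fixes \<rho> :: "complex \<Rightarrow> real"
  assumes S: "open S" "p \<in> S" and pos: "\<And>\<zeta>. \<zeta> \<in> S \<Longrightarrow> \<rho> \<zeta> > 0" and sm: "smooth_on \<rho> S"
    and curv: "\<And>\<zeta>. \<zeta> \<in> S \<Longrightarrow> gauss_curvature \<rho> \<zeta> = -1"
  obtains f r where "r > 0" "ball p r \<subseteq> S" "f holomorphic_on ball p r" "f p = 0"
    "\<And>\<zeta>. \<zeta> \<in> ball p r \<Longrightarrow> cmod (f \<zeta>) < 1 \<and> \<rho> \<zeta> = 2 * cmod (deriv f \<zeta>) / (1 - (cmod (f \<zeta>))\<^sup>2)"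
proof -
  define h where "h = (\<lambda>\<zeta>. inverse (\<rho> \<zeta>))"
  obtain P \<tau> where \<tau>: "\<tau> holomorphic_on S"
    and dh: "\<And>\<zeta>. \<zeta> \<in> S \<Longrightarrow> (h has_derivative (\<lambda>e. Re (P \<zeta> * e))) (at \<zeta>)"
    and dP: "\<And>\<zeta>. \<zeta> \<in> S \<Longrightarrow> (P has_derivative (\<lambda>e. - 2 * \<tau> \<zeta> * of_real (h \<zeta>) * e +
        of_real (((cmod (P \<zeta>))\<^sup>2 - 1) / (2 * h \<zeta>)) * cnj e)) (at \<zeta>)"
    unfolding h_def by (rule curvature_system[OF S(1) pos sm curv]) blast+
  obtain R where R: "R > 0" "ball p R \<subseteq> S" using S openE by blast
  obtain \<delta> where \<delta>: "0 < \<delta>" "\<delta> \<le> R"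
    and ode: "\<And>a b. \<exists>w w'. w p = a \<and> w' p = b \<and> (\<forall>z\<in>ball p \<delta>. (w has_field_derivative w' z) (at z) \<and>
        (w' has_field_derivative - (\<tau> z * w z)) (at z))"
    by (rule linear_ode_exists[OF holomorphic_on_subset[OF \<tau> R(2)] R(1)]) blast
  have hpos: "h \<zeta> > 0" if "\<zeta> \<in> S" for \<zeta> using pos[OF that] by (simp add: h_def)
  define s where "s = sqrt (h p)"
  have s: "s > 0" "s\<^sup>2 = h p" using hpos[OF S(2)] by (auto simp: s_def)
  let ?B = "ball p \<delta>"
  have BS: "?B \<subseteq> S" using R \<delta> by (auto intro: subset_trans[OF subset_ball])
  obtain a a' where a: "a p = of_real s" "a' p = P p / (2 * of_real s)"
    and da: "\<And>z. z \<in> ?B \<Longrightarrow> (a has_field_derivative a' z) (at z)"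
      "\<And>z. z \<in> ?B \<Longrightarrow> (a' has_field_derivative - (\<tau> z * a z)) (at z)"
    using ode[of "of_real s" "P p / (2 * of_real s)"] by blast
  obtain b b' where b: "b p = 0" "b' p = 1 / (2 * of_real s)"
    and db: "\<And>z. z \<in> ?B \<Longrightarrow> (b has_field_derivative b' z) (at z)"
      "\<And>z. z \<in> ?B \<Longrightarrow> (b' has_field_derivative - (\<tau> z * b z)) (at z)"
    using ode[of 0 "1 / (2 * of_real s)"] by blast
  have "((\<lambda>z. b' z * a z - b z * a' z) has_field_derivative 0) (at z within ?B)" if "z \<in> ?B" for z
    by (rule has_field_derivative_at_within)
      (auto intro!: derivative_eq_intros da[OF that] db[OF that])
  then obtain c where c: "\<And>z. z \<in> ?B \<Longrightarrow> b' z * a z - b z * a' z = c"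
    using has_field_derivative_zero_constant[OF convex_ball, of p \<delta> "\<lambda>z. b' z * a z - b z * a' z"] by blast
  have W: "b' z * a z - b z * a' z = 1/2" if "z \<in> ?B" for z
    using c[OF that] c[of p] \<delta> s a b by simp
  define k where "k z = (cmod (a z))\<^sup>2 - (cmod (b z))\<^sup>2" for z
  define Q where "Q z = 2 * (a' z * cnj (a z) - b' z * cnj (b z))" for z
  have da': "(a has_derivative (*) (a' z)) (at z)" "(a' has_derivative (*) (- (\<tau> z * a z))) (at z)"
      "(b has_derivative (*) (b' z)) (at z)" "(b' has_derivative (*) (- (\<tau> z * b z))) (at z)" if "z \<in> ?B" for z
    using da[OF that] db[OF that] by (simp_all add: has_field_derivative_def)
  note dcnj = bounded_linear.has_derivative[OF bounded_linear_cnj]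
  have dk: "(k has_derivative (\<lambda>e. Re (Q z * e))) (at z)" if z: "z \<in> ?B" for z
    unfolding k_def dot_square_norm[symmetric]
    by (rule has_derivative_eq_rhs[OF has_derivative_diff[OF has_derivative_inner[OF da'(1)[OF z] da'(1)[OF z]]
        has_derivative_inner[OF da'(3)[OF z] da'(3)[OF z]]]])
      (simp add: fun_eq_iff Q_def inner_complex_def algebra_simps)
  have kQ: "4 * k z * ((cmod (a' z))\<^sup>2 - (cmod (b' z))\<^sup>2) = (cmod (Q z))\<^sup>2 - 1" if "z \<in> ?B" for z
  proof -
    have "(cmod (Q z))\<^sup>2 = 4 * (cmod (a' z * cnj (a z) - b' z * cnj (b z)))\<^sup>2"
      unfolding Q_def norm_mult by (simp add: power_mult_distrib)
    moreover have "(cmod (b' z * a z - b z * a' z))\<^sup>2 = 1/4"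
      unfolding W[OF that] by (simp add: power2_eq_square)
    ultimately show ?thesis
      using wronskian_identity[of "a z" "b z" "a' z" "b' z"] unfolding k_def by linarith
  qed
  have dQ: "(Q has_derivative (\<lambda>e. - 2 * \<tau> z * of_real (k z) * e +
        of_real (((cmod (Q z))\<^sup>2 - 1) / (2 * k z)) * cnj e)) (at z)" if z: "z \<in> ?B" and k0: "k z > 0" for z
  proof -
    have e1: "((cmod (Q z))\<^sup>2 - 1) / (2 * k z) = 2 * ((cmod (a' z))\<^sup>2 - (cmod (b' z))\<^sup>2)"
      using kQ[OF z, symmetric] k0 by (simp add: field_simps)
    have e2: "complex_of_real ((cmod u)\<^sup>2) = u * cnj u" for u by (rule complex_norm_square)
    show ?thesis
      unfolding Q_def[abs_def]
      apply (rule has_derivative_eq_rhs[OF has_derivative_mult_right[OF has_derivative_diff[OF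
            has_derivative_mult[OF da'(2)[OF z] dcnj[OF da'(1)[OF z]]]
            has_derivative_mult[OF da'(4)[OF z] dcnj[OF da'(3)[OF z]]]]]])
      unfolding e1[unfolded Q_def] unfolding k_def of_real_diff of_real_mult e2
      by (simp add: fun_eq_iff algebra_simps)
  qed
  have "continuous_on ?B a" "continuous_on ?B a'" "continuous_on ?B b" "continuous_on ?B b'"
    using has_derivative_continuous[OF da'(1)] has_derivative_continuous[OF da'(2)]
      has_derivative_continuous[OF da'(3)] has_derivative_continuous[OF da'(4)]
    by (blast intro: continuous_at_imp_continuous_on)+
  then have kc: "continuous_on ?B k" and Qc: "continuous_on ?B Q"
    unfolding k_def[abs_def] Q_def[abs_def] by (auto intro!: continuous_intros)
  have kp: "k p > 0" using a b s hpos[OF S(2)] by (simp add: k_def)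
  have "open (?B \<inter> k -` {0<..})"
    by (rule continuous_open_preimage[OF kc open_ball open_greaterThan])
  moreover have "p \<in> ?B \<inter> k -` {0<..}" using kp \<delta> by simp
  ultimately obtain r where r: "r > 0" "ball p r \<subseteq> ?B \<inter> k -` {0<..}"
    using openE by blast
  have rB: "z \<in> ?B" "k z > 0" if "z \<in> ball p r" for z using r that by auto
  have main: "h z = k z" if z: "z \<in> ball p r" for z
  proof -
    define e where "e = z - p"
    define g where "g t = p + complex_of_real t * e" for t
    have g: "g t \<in> ball p r" if "t \<in> {0..1}" for t
    proof -
      have "cmod (complex_of_real t * e) \<le> 1 * cmod e"
        unfolding norm_mult using that by (intro mult_right_mono) auto
      then show ?thesis using z by (auto simp: g_def e_def dist_norm norm_minus_commute)
    qed
    have gS: "g t \<in> S" "g t \<in> ?B" "k (g t) > 0" if "t \<in> {0..1}" for t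
      using rB[OF g[OF that]] BS by auto
    have dg: "(g has_derivative (\<lambda>h. of_real h * e)) (at t within {0..1})" for t
      unfolding g_def by (auto intro!: derivative_eq_intros)
    define D where "D F y = - 2 * \<tau> y * of_real (fst F) * e +
        of_real (((cmod (snd F))\<^sup>2 - 1) / (2 * fst F)) * cnj e" for F :: "real \<times> complex" and y
    define X where "X t = (h (g t) - k (g t), P (g t) - Q (g t))" for t
    define X' where "X' t = (Re (P (g t) * e) - Re (Q (g t) * e), D (h (g t), P (g t)) (g t) - D (k (g t), Q (g t)) (g t))" for t
    have along: "((\<lambda>t. F (g t)) has_vector_derivative L e) (at t within {0..1})"
      if "(F has_derivative L) (at (g t))" for F :: "complex \<Rightarrow> 'b::real_normed_vector" and L t
    proof -
      interpret bounded_linear L using that has_derivative_bounded_linear by blast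
      show ?thesis
        using has_derivative_compose[OF dg that]
        by (simp add: has_vector_derivative_def scaleR_conv_of_real[symmetric] scaleR)
    qed
    define \<Lambda> where "\<Lambda> t = cmod e * (1 + 2 * cmod (\<tau> (g t)) + cmod (P (g t) + Q (g t)) / (2 * h (g t))
        + \<bar>(cmod (Q (g t)))\<^sup>2 - 1\<bar> / (2 * h (g t) * k (g t)))" for t
    have gc: "continuous_on {0..1} g" unfolding g_def by (intro continuous_intros)
    have Pc: "continuous_on S P" "continuous_on S h"
      using dP dh by (auto intro!: continuous_at_imp_continuous_on has_derivative_continuous)
    have "continuous_on {0..1} \<Lambda>"
      unfolding \<Lambda>_def using gS hpos
      by (intro continuous_intros continuous_on_compose2[OF holomorphic_on_imp_continuous_on[OF \<tau>] gc]
          continuous_on_compose2[OF Pc(1) gc] continuous_on_compose2[OF Pc(2) gc] continuous_on_compose2[OF kc gc]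
          continuous_on_compose2[OF Qc gc]) (force simp: image_subset_iff)+
    then have "bounded (\<Lambda> ` {0..1})"
      by (intro compact_imp_bounded compact_continuous_image) auto
    then obtain L where L: "\<And>t. t \<in> {0..1} \<Longrightarrow> \<Lambda> t \<le> L"
      by (auto simp: bounded_iff) (meson abs_le_D1 atLeastAtMost_iff)
    have "\<forall>t\<in>{0..1}. X t = 0"
    proof (rule gronwall_zero)
      fix t :: real assume t: "t \<in> {0..1}"
      show "(X has_vector_derivative X' t) (at t within {0..1})"
        unfolding X_def X'_def D_def fst_conv snd_conv
        by (intro has_vector_derivative_Pair has_vector_derivative_diff along[OF dh] along[OF dP] along[OF dk] along[OF dQ] gS t)
      define H K p q where "H = h (g t)" and "K = k (g t)" and "p = P (g t)" and "q = Q (g t)"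
      have HK: "H > 0" "K > 0" using gS[OF t] hpos by (auto simp: H_def K_def)
      let ?n = "norm (X t)"
      have n: "\<bar>H - K\<bar> \<le> ?n" "cmod (p - q) \<le> ?n"
        unfolding X_def H_def K_def p_def q_def
        using norm_fst_le[of "h (g t) - k (g t)" "P (g t) - Q (g t)"] norm_snd_le[of "P (g t) - Q (g t)" "h (g t) - k (g t)"]
        by simp_all
      have 0: "\<bar>Re (p * e) - Re (q * e)\<bar> \<le> cmod e * ?n"
      proof -
        have "\<bar>Re (p * e) - Re (q * e)\<bar> = \<bar>Re ((p - q) * e)\<bar>" by (simp add: algebra_simps)
        also have "\<dots> \<le> cmod ((p - q) * e)" by (rule abs_Re_le_cmod)
        also have "\<dots> \<le> cmod e * ?n" using n(2) by (simp add: norm_mult mult.commute mult_left_mono)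
        finally show ?thesis .
      qed
      have sq: "\<bar>(cmod p)\<^sup>2 - (cmod q)\<^sup>2\<bar> \<le> cmod (p + q) * ?n"
      proof -
        have "(cmod p)\<^sup>2 - (cmod q)\<^sup>2 = (p + q) \<bullet> (p - q)"
          by (simp add: dot_square_norm[symmetric] inner_diff_right inner_add_left inner_commute[of q p])
        also have "\<bar>\<dots>\<bar> \<le> cmod (p + q) * cmod (p - q)" by (rule Cauchy_Schwarz_ineq2)
        also have "\<dots> \<le> cmod (p + q) * ?n" using n(2) by (rule mult_left_mono) simp
        finally show ?thesis .
      qed
      have fe: "((cmod p)\<^sup>2 - 1) / (2 * H) - ((cmod q)\<^sup>2 - 1) / (2 * K)
        = ((cmod p)\<^sup>2 - (cmod q)\<^sup>2) / (2 * H) + ((cmod q)\<^sup>2 - 1) * (K - H) / (2 * H * K)"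
        using HK by (simp add: field_simps)
      have "\<bar>((cmod p)\<^sup>2 - 1) / (2 * H) - ((cmod q)\<^sup>2 - 1) / (2 * K)\<bar>
         \<le> (cmod (p + q) * ?n) / (2 * H) + \<bar>(cmod q)\<^sup>2 - 1\<bar> * ?n / (2 * H * K)"
        unfolding fe using HK sq n(1)
        by (intro order_trans[OF abs_triangle_ineq] add_mono)
          (auto simp: abs_mult abs_minus_commute intro!: divide_right_mono mult_left_mono)
      then have 1: "cmod (of_real (((cmod p)\<^sup>2 - 1) / (2 * H) - ((cmod q)\<^sup>2 - 1) / (2 * K)) * cnj e)
         \<le> ((cmod (p + q) * ?n) / (2 * H) + \<bar>(cmod q)\<^sup>2 - 1\<bar> * ?n / (2 * H * K)) * cmod e"
        unfolding norm_mult norm_of_real complex_mod_cnj by (rule mult_right_mono) simp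
      have 2: "cmod (- 2 * \<tau> (g t) * of_real (H - K) * e) \<le> 2 * cmod (\<tau> (g t)) * ?n * cmod e"
        unfolding norm_mult norm_of_real using n(1) by (intro mult_right_mono mult_mono) auto
      have "D (H, p) (g t) - D (K, q) (g t) = - 2 * \<tau> (g t) * of_real (H - K) * e
          + of_real (((cmod p)\<^sup>2 - 1) / (2 * H) - ((cmod q)\<^sup>2 - 1) / (2 * K)) * cnj e"
        unfolding D_def fst_conv snd_conv of_real_diff by (simp only: algebra_simps)
      then have 3: "cmod (D (H, p) (g t) - D (K, q) (g t)) \<le> 2 * cmod (\<tau> (g t)) * ?n * cmod e
         + ((cmod (p + q) * ?n) / (2 * H) + \<bar>(cmod q)\<^sup>2 - 1\<bar> * ?n / (2 * H * K)) * cmod e"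
        by (simp only:) (rule order_trans[OF norm_triangle_ineq add_mono[OF 2 1]])
      have "norm (X' t) \<le> cmod e * ?n + (2 * cmod (\<tau> (g t)) * ?n * cmod e
         + ((cmod (p + q) * ?n) / (2 * H) + \<bar>(cmod q)\<^sup>2 - 1\<bar> * ?n / (2 * H * K)) * cmod e)"
        unfolding X'_def H_def[symmetric] K_def[symmetric] p_def[symmetric] q_def[symmetric]
        by (rule order_trans[OF norm_Pair_le add_mono[OF _ 3]]) (use 0 in simp)
      also have "\<dots> = \<Lambda> t * ?n"
        unfolding \<Lambda>_def H_def[symmetric] K_def[symmetric] p_def[symmetric] q_def[symmetric] by (simp add: algebra_simps)
      also have "\<dots> \<le> L * ?n" by (rule mult_right_mono[OF L[OF t]]) simp
      finally show "norm (X' t) \<le> L * norm (X t)" .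
    next
      have "Q p = P p" using a b s by (simp add: Q_def)
      moreover have "k p = h p" using a b s by (simp add: k_def)
      ultimately show "X 0 = 0" by (simp add: X_def g_def zero_prod_def)
    qed simp
    then have "X 1 = 0" by simp
    then show ?thesis by (simp add: X_def g_def e_def zero_prod_def)
  qed
  define f where "f z = b z / a z" for z
  have nza: "a z \<noteq> 0" if "z \<in> ball p r" for z
    using rB[OF that] by (auto simp: k_def)
  have df: "(f has_field_derivative (1/2) / (a z)\<^sup>2) (at z)" if z: "z \<in> ball p r" for z
    unfolding f_def
    by (rule derivative_eq_intros da db rB[OF z] nza[OF z] refl)+
      (simp only: W[OF rB(1)[OF z]] power2_eq_square)
  show ?thesis
  proof (rule that[of r f])
    show "ball p r \<subseteq> S" using rB BS by auto
    show "f holomorphic_on ball p r" using df holomorphic_on_open by blast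
    show "f p = 0" by (simp add: f_def b)
    fix z assume z: "z \<in> ball p r"
    have k: "k z > 0" "inverse (\<rho> z) = k z" using rB[OF z] main[OF z] by (auto simp: h_def)
    have "(cmod (b z))\<^sup>2 < (cmod (a z))\<^sup>2" using k by (simp add: k_def)
    then have lt: "cmod (b z) < cmod (a z)" by (rule power2_less_imp_less) simp
    then have 1: "cmod (f z) < 1" by (simp add: f_def norm_divide divide_less_eq)
    have d: "deriv f z = (1/2) / (a z)\<^sup>2" using df[OF z] DERIV_imp_deriv by blast
    have e: "1 - (cmod (f z))\<^sup>2 = k z / (cmod (a z))\<^sup>2"
      using nza[OF z] by (simp add: f_def norm_divide power_divide k_def diff_divide_distrib)
    have "\<rho> z = inverse (k z)" using k by (metis inverse_inverse_eq)
    also have "\<dots> = 2 * cmod (deriv f z) / (1 - (cmod (f z))\<^sup>2)"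
      unfolding d e using nza[OF z] k by (simp add: norm_divide norm_power field_simps)
    finally show "cmod (f z) < 1 \<and> \<rho> z = 2 * cmod (deriv f z) / (1 - (cmod (f z))\<^sup>2)" using 1 by simp
  qed (use r in auto)
qed

text \<open>The inverse of the map given by Liouville's theorem.\<close>

lemma hyperbolic_coordinate:
  fixes \<rho> :: "complex \<Rightarrow> real"
  assumes S: "open S" "p \<in> S" and pos: "\<And>\<zeta>. \<zeta> \<in> S \<Longrightarrow> \<rho> \<zeta> > 0" and sm: "smooth_on \<rho> S"
    and curv: "\<And>\<zeta>. \<zeta> \<in> S \<Longrightarrow> gauss_curvature \<rho> \<zeta> = -1"
  obtains g \<epsilon> where "0 < \<epsilon>" "ball 0 \<epsilon> \<subseteq> ball (0::complex) 1" "g holomorphic_on ball 0 \<epsilon>" "g ` ball 0 \<epsilon> \<subseteq> S" "g 0 = p"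
    "inj_on g (ball 0 \<epsilon>)"
    "\<And>z. z \<in> ball 0 \<epsilon> \<Longrightarrow> \<rho> (g z) * cmod (deriv g z) = 2 / (1 - (cmod z)\<^sup>2)"
proof -
  obtain f r where r: "r > 0" "ball p r \<subseteq> S" and f: "f holomorphic_on ball p r" "f p = 0"
    and iso: "\<And>\<zeta>. \<zeta> \<in> ball p r \<Longrightarrow> cmod (f \<zeta>) < 1 \<and> \<rho> \<zeta> = 2 * cmod (deriv f \<zeta>) / (1 - (cmod (f \<zeta>))\<^sup>2)"
    by (rule liouville_local[OF S pos sm curv]; (assumption | rule that))
  have "deriv f p \<noteq> 0"
    using iso[of p] pos[of p] r S by auto
  then obtain r' where r': "r' > 0" "ball p r' \<subseteq> ball p r" "open (f ` ball p r')" "inj_on f (ball p r')"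
    using has_complex_derivative_locally_invertible[OF f(1), of p] r by auto
  have fh: "f holomorphic_on ball p r'" using f(1) r'(2) by (rule holomorphic_on_subset)
  obtain g where g: "g holomorphic_on f ` ball p r'" "\<And>z. z \<in> ball p r' \<Longrightarrow> deriv f z * deriv g (f z) = 1"
     "\<And>z. z \<in> ball p r' \<Longrightarrow> g (f z) = z"
    using holomorphic_has_inverse[OF fh open_ball r'(4)] by metis
  have "0 \<in> f ` ball p r'" using f(2) r'(1) by (metis centre_in_ball image_eqI)
  then obtain \<epsilon> where e: "\<epsilon> > 0" "ball 0 \<epsilon> \<subseteq> f ` ball p r'"
    using r'(3) openE by blast
  show ?thesis
  proof (rule that[of \<epsilon> g])
    show "ball 0 \<epsilon> \<subseteq> ball (0::complex) 1"
    proof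
      fix z :: complex assume "z \<in> ball 0 \<epsilon>"
      then obtain \<zeta> where "\<zeta> \<in> ball p r'" "z = f \<zeta>" using e(2) by blast
      then show "z \<in> ball 0 1" using iso[of \<zeta>] r'(2) by auto
    qed
    show "g holomorphic_on ball 0 \<epsilon>" using g(1) e(2) by (rule holomorphic_on_subset)
    show "g ` ball 0 \<epsilon> \<subseteq> S"
    proof
      fix x assume "x \<in> g ` ball 0 \<epsilon>"
      then obtain \<zeta> where "\<zeta> \<in> ball p r'" "x = g (f \<zeta>)" using e(2) by blast
      then show "x \<in> S" using g(3) r'(2) r(2) by auto
    qed
    show "g 0 = p" using g(3)[of p] f(2) r'(1) by simp
    show "inj_on g (ball 0 \<epsilon>)"
    proof (rule inj_on_subset[OF _ e(2)], rule inj_onI)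
      fix x y assume "x \<in> f ` ball p r'" "y \<in> f ` ball p r'" "g x = g y"
      then show "x = y" using g(3) by auto
    qed
    fix z :: complex assume "z \<in> ball 0 \<epsilon>"
    then obtain \<zeta> where \<zeta>: "\<zeta> \<in> ball p r'" "z = f \<zeta>" using e(2) by blast
    have i: "cmod z < 1" "\<rho> \<zeta> = 2 * cmod (deriv f \<zeta>) / (1 - (cmod z)\<^sup>2)"
      using iso[of \<zeta>] \<zeta> r'(2) by auto
    have "cmod (deriv f \<zeta>) * cmod (deriv g z) = 1"
      using g(2)[OF \<zeta>(1)] \<zeta>(2) by (metis norm_mult norm_one)
    then show "\<rho> (g z) * cmod (deriv g z) = 2 / (1 - (cmod z)\<^sup>2)"
      using g(3)[OF \<zeta>(1)] \<zeta>(2) i by (simp add: mult.assoc)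
  qed (use e in auto)
qed

section \<open>The second order equation of an isometry\<close>

text \<open>
  The Christoffel symbol, in the sense of \<^const>\<open>christoffel\<close>, of the density \<open>2 / (1 - |z|\<^sup>2)\<close> of the
  Poincare disc.
\<close>

definition disc_christoffel :: "complex \<Rightarrow> complex" where
  "disc_christoffel z = of_real (2 / (1 - (cmod z)\<^sup>2)) * cnj z"

text \<open>
  Differentiating the logarithm of the isometry condition shows that the Christoffel symbols
  transform like a connection, that is, an isometry satisfies a second order equation.
\<close>

lemma isometry_second_derivative:
  assumes S: "open S" "\<And>\<zeta>. \<zeta> \<in> S \<Longrightarrow> \<rho> \<zeta> > 0" "smooth_on \<rho> S"
    and U: "open U" "U \<subseteq> ball 0 1" "g holomorphic_on U" "g ` U \<subseteq> S"
    and iso: "\<And>z. z \<in> U \<Longrightarrow> \<rho> (g z) * cmod (deriv g z) = 2 / (1 - (cmod z)\<^sup>2)"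
    and z: "z \<in> U"
  shows "deriv (deriv g) z = deriv g z * (disc_christoffel z - christoffel \<rho> (g z) * deriv g z)"
proof -
  have lt: "(cmod w)\<^sup>2 < 1" if "w \<in> U" for w
    using U(2) that by (auto simp: abs_square_less_1)
  have n0: "deriv g w \<noteq> 0" if w: "w \<in> U" for w
    using iso[OF w] lt[OF w] by auto
  have gz: "g w \<in> S" if "w \<in> U" for w using U(4) that by auto
  define N where "N w = 2 * ln (\<rho> (g w)) + ln (deriv g w \<bullet> deriv g w) + 2 * ln (1 - w \<bullet> w)" for w
  have const: "N w = ln 4" if w: "w \<in> U" for w
  proof -
    have p: "\<rho> (g w) > 0" "cmod (deriv g w) > 0" "1 - (cmod w)\<^sup>2 > 0"
      using S(2) gz n0 lt w by auto
    have "N w = ln ((\<rho> (g w) * cmod (deriv g w) * (1 - (cmod w)\<^sup>2))\<^sup>2)"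
      unfolding N_def dot_square_norm using p by (simp add: ln_mult ln_realpow power_mult_distrib)
    also have "\<rho> (g w) * cmod (deriv g w) * (1 - (cmod w)\<^sup>2) = 2"
      using iso[OF w] p(3) by (metis less_irrefl nonzero_eq_divide_eq)
    finally show ?thesis by simp
  qed
  have "C_on 1 \<rho> S" using S(3) by (simp add: smooth_on_def)
  then have dl: "(\<lambda>\<zeta>. ln (\<rho> \<zeta>)) differentiable (at (g z))"
    using pd_ln(1)[of \<rho> "g z"] gz[OF z] S(2) by simp
  have dg: "(g has_derivative (*) (deriv g z)) (at z)" "(deriv g has_derivative (*) (deriv (deriv g) z)) (at z)"
    using holomorphic_derivI[OF U(3,1) z] holomorphic_derivI[OF holomorphic_deriv[OF U(3,1)] U(1) z]
    by (simp_all add: has_field_derivative_def)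
  have p2: "deriv g z \<bullet> deriv g z > 0" "1 - z \<bullet> z > 0"
    using n0[OF z] lt[OF z] by (simp_all add: dot_square_norm)
  define c where "c = 2 * christoffel \<rho> (g z) * deriv g z + 2 * deriv (deriv g) z / deriv g z - 2 * disc_christoffel z"
  have d1: "((\<lambda>w. ln (\<rho> (g w))) has_derivative (\<lambda>e. Re (christoffel \<rho> (g z) * deriv g z * e))) (at z)"
    by (rule has_derivative_eq_rhs[OF has_derivative_compose[OF dg(1) has_derivative_pd[OF dl]]])
      (simp add: fun_eq_iff christoffel_def algebra_simps)
  have q: "Re (a / b) = (b \<bullet> a) / (b \<bullet> b)" for a b :: complex
    by (simp add: Re_divide inner_complex_def power2_eq_square algebra_simps)
  have d2: "((\<lambda>w. ln (deriv g w \<bullet> deriv g w)) has_derivative (\<lambda>e. Re (2 * deriv (deriv g) z / deriv g z * e))) (at z)"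
  proof (rule has_derivative_eq_rhs[OF has_derivative_ln[OF p2(1) has_derivative_inner[OF dg(2) dg(2)]]], rule ext)
    fix e
    have "2 * deriv (deriv g) z / deriv g z * e = deriv (deriv g) z * e / deriv g z + deriv (deriv g) z * e / deriv g z"
      by (simp add: field_simps)
    then have "Re (2 * deriv (deriv g) z / deriv g z * e) = 2 * Re (deriv (deriv g) z * e / deriv g z)"
      by (simp only: plus_complex.simps)
    also have "\<dots> = (2 * (deriv g z \<bullet> (deriv (deriv g) z * e))) / (deriv g z \<bullet> deriv g z)"
      unfolding q by simp
    finally show "(deriv g z \<bullet> (deriv (deriv g) z * e) + (deriv (deriv g) z * e) \<bullet> deriv g z) * inverse (deriv g z \<bullet> deriv g z)
       = Re (2 * deriv (deriv g) z / deriv g z * e)"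
      by (simp add: inner_commute field_simps)
  qed
  have d3: "((\<lambda>w. ln (1 - w \<bullet> w)) has_derivative (\<lambda>e. - Re (disc_christoffel z * e))) (at z)"
    by (rule has_derivative_eq_rhs[OF has_derivative_ln[OF p2(2)
          has_derivative_diff[OF has_derivative_const has_derivative_inner[OF has_derivative_ident has_derivative_ident]]]])
      (use p2(2) in \<open>auto simp: fun_eq_iff disc_christoffel_def inner_complex_def dot_square_norm[symmetric] field_simps\<close>)
  have "(N has_derivative (\<lambda>e. 2 * Re (christoffel \<rho> (g z) * deriv g z * e)
      + Re (2 * deriv (deriv g) z / deriv g z * e) + 2 * (- Re (disc_christoffel z * e)))) (at z)"
    unfolding N_def by (intro has_derivative_add has_derivative_mult_right d1 d2 d3)
  moreover have "(N has_derivative (\<lambda>_. 0)) (at z)"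
    by (rule has_derivative_cong_open[OF U(1) z const, THEN iffD2]) auto
  ultimately have "(\<lambda>e. 2 * Re (christoffel \<rho> (g z) * deriv g z * e)
      + Re (2 * deriv (deriv g) z / deriv g z * e) + 2 * (- Re (disc_christoffel z * e))) = (\<lambda>_. 0)"
    by (rule has_derivative_unique)
  then have "2 * Re (christoffel \<rho> (g z) * deriv g z * e)
      + Re (2 * deriv (deriv g) z / deriv g z * e) + 2 * (- Re (disc_christoffel z * e)) = 0" for e
    by (rule fun_cong)
  then have "Re (c * e) = 0" for e by (simp add: c_def algebra_simps)
  from this[of "cnj c"] have "c = 0"
    by (simp add: complex_eq_iff sum_power2_eq_zero_iff flip: power2_eq_square)
  then have "2 * (christoffel \<rho> (g z) * deriv g z + deriv (deriv g) z / deriv g z - disc_christoffel z) = 0"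
    by (simp add: c_def algebra_simps)
  then have "christoffel \<rho> (g z) * deriv g z + deriv (deriv g) z / deriv g z - disc_christoffel z = 0"
    by (metis mult_eq_0_iff zero_neq_numeral)
  then show ?thesis using n0[OF z] by (simp add: field_simps)
qed

lemma christoffel_C_on:
  assumes "open S" "\<And>\<zeta>. \<zeta> \<in> S \<Longrightarrow> \<rho> \<zeta> > 0" "smooth_on \<rho> S"
  shows "C_on k (christoffel \<rho>) S"
proof -
  have "C_on (Suc k) (\<lambda>z. ln (\<rho> z)) S"
    using assms by (intro C_on_ln) (auto simp: smooth_on_def)
  then have C: "C_on k (pdx (\<lambda>z. ln (\<rho> z))) S" "C_on k (pdy (\<lambda>z. ln (\<rho> z))) S" by simp_all
  have bl: "bounded_linear complex_of_real" "bounded_linear (\<lambda>x. (- \<i>) * complex_of_real x)"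
    by (rule bounded_linear_of_real, rule bounded_linear_compose[OF bounded_linear_mult_right bounded_linear_of_real])
  have "christoffel \<rho> = (\<lambda>z. of_real (pdx (\<lambda>z. ln (\<rho> z)) z) + (- \<i>) * of_real (pdy (\<lambda>z. ln (\<rho> z)) z))"
    by (simp add: fun_eq_iff christoffel_def complex_eq_iff)
  then show ?thesis
    using C_on_add[OF assms(1) C_on_linear[OF assms(1) bl(1) C(1)] C_on_linear[OF assms(1) bl(2) C(2)]] by simp
qed

text \<open>The second order equation along segments shows that an isometry is determined by its 1-jet.\<close>

lemma isometry_unique_plane:
  assumes S: "open S" "\<And>\<zeta>. \<zeta> \<in> S \<Longrightarrow> \<rho> \<zeta> > 0" "smooth_on \<rho> S" and pr: "cball p r \<subseteq> S"
    and B: "ball z0 \<delta> \<subseteq> ball 0 1"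
    and g: "g holomorphic_on ball z0 \<delta>" "g ` ball z0 \<delta> \<subseteq> cball p r"
      "\<And>z. z \<in> ball z0 \<delta> \<Longrightarrow> \<rho> (g z) * cmod (deriv g z) = 2 / (1 - (cmod z)\<^sup>2)"
    and k: "k holomorphic_on ball z0 \<delta>" "k ` ball z0 \<delta> \<subseteq> cball p r"
      "\<And>z. z \<in> ball z0 \<delta> \<Longrightarrow> \<rho> (k z) * cmod (deriv k z) = 2 / (1 - (cmod z)\<^sup>2)"
    and init: "g z0 = k z0" "deriv g z0 = deriv k z0" and z: "z \<in> ball z0 \<delta>"
  shows "g z = k z"
proof -
  define e where "e = z - z0"
  define l where "l t = z0 + complex_of_real t * e" for t
  have l: "l t \<in> ball z0 \<delta>" if "t \<in> {0..1}" for t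
  proof -
    have "cmod (complex_of_real t * e) \<le> 1 * cmod e"
      unfolding norm_mult using that by (intro mult_right_mono) auto
    then show ?thesis using z by (auto simp: l_def e_def dist_norm norm_minus_commute)
  qed
  have dl: "(l has_vector_derivative e) (at t within {0..1})" for t
    unfolding l_def by (auto intro!: derivative_eq_intros simp: has_vector_derivative_def scaleR_conv_of_real)
  have d: "((\<lambda>t. f (l t)) has_vector_derivative e * deriv f (l t)) (at t within {0..1})"
    if "f holomorphic_on ball z0 \<delta>" "t \<in> {0..1}" for f t
    using field_vector_diff_chain_within[OF dl[of t] has_field_derivative_at_within[OF holomorphic_derivI[OF that(1) open_ball l[OF that(2)]]]]
    by (simp add: o_def)
  have dd: "((\<lambda>t. deriv f (l t)) has_vector_derivative
      e * (disc_christoffel (l t) * deriv f (l t) - christoffel \<rho> (f (l t)) * (deriv f (l t))\<^sup>2)) (at t within {0..1})"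
    if f: "f holomorphic_on ball z0 \<delta>" "f ` ball z0 \<delta> \<subseteq> cball p r"
      "\<And>z. z \<in> ball z0 \<delta> \<Longrightarrow> \<rho> (f z) * cmod (deriv f z) = 2 / (1 - (cmod z)\<^sup>2)" and t: "t \<in> {0..1}" for f t
  proof -
    have E: "deriv (deriv f) (l t) = deriv f (l t) * (disc_christoffel (l t) - christoffel \<rho> (f (l t)) * deriv f (l t))"
      by (rule isometry_second_derivative[OF S open_ball B f(1) subset_trans[OF f(2) pr] f(3) l[OF t]])
    have "e * (disc_christoffel (l t) * deriv f (l t) - christoffel \<rho> (f (l t)) * (deriv f (l t))\<^sup>2)
        = e * deriv (deriv f) (l t)"
      unfolding E by (simp add: algebra_simps power2_eq_square)
    then show ?thesis using d[OF holomorphic_deriv[OF f(1) open_ball] t] by (simp only:)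
  qed
  have lt: "1 - (cmod (l t))\<^sup>2 \<noteq> 0" if "t \<in> {0..1}" for t
    using subsetD[OF B l[OF that]] by (auto simp: power2_eq_1_iff) (metis norm_ge_zero zero_le_one abs_of_nonneg less_irrefl one_neq_neg_one neg_0_le_iff_le not_one_le_zero)
  have Bc: "continuous_on {0..1} (\<lambda>t. disc_christoffel (l t))"
    unfolding disc_christoffel_def l_def
    using lt[unfolded l_def] by (intro continuous_intros) auto
  have "\<forall>t\<in>{0..1}. g (l t) = k (l t) \<and> deriv g (l t) = deriv k (l t)"
    by (rule second_order_unique[OF _ christoffel_C_on[OF S] pr Bc])
      (use d[OF g(1)] d[OF k(1)] dd[OF g] dd[OF k] g(2) k(2) l init in \<open>auto simp: l_def image_subset_iff\<close>)
  then show ?thesis by (auto simp: l_def e_def dest: bspec[of _ _ 1])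
qed

section \<open>Local isometries into a Riemann surface\<close>

context riemann_surface
begin

lemma chart_at_props: "chart_at A p \<in> A" "p \<in> cdom (chart_at A p)"
proof -
  have "\<exists>c. c \<in> A \<and> p \<in> cdom c" using covering by blast
  then have "chart_at A p \<in> A \<and> p \<in> cdom (chart_at A p)"
    unfolding chart_at_def by (rule someI_ex)
  then show "chart_at A p \<in> A" "p \<in> cdom (chart_at A p)" by auto
qed

lemma cinv_coord: "c \<in> A \<Longrightarrow> p \<in> cdom c \<Longrightarrow> cinv c (coord c p) = p"
  using homeomorphism_apply1[OF homeomorphism_chart] by blast

lemma coord_cinv: "c \<in> A \<Longrightarrow> \<zeta> \<in> coord c ` cdom c \<Longrightarrow> coord c (cinv c \<zeta>) = \<zeta>"
  using homeomorphism_apply2[OF homeomorphism_chart] by blast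

lemma cinv_in_cdom: "c \<in> A \<Longrightarrow> \<zeta> \<in> coord c ` cdom c \<Longrightarrow> cinv c \<zeta> \<in> cdom c"
  using homeomorphism_image2[OF homeomorphism_chart] by blast

lemma continuous_coord: "c \<in> A \<Longrightarrow> continuous_on (cdom c) (coord c)"
  using homeomorphism_cont1[OF homeomorphism_chart] by blast

lemma continuous_cinv: "c \<in> A \<Longrightarrow> continuous_on (coord c ` cdom c) (cinv c)"
  using homeomorphism_cont2[OF homeomorphism_chart] by blast

lemma transition_coord: "c \<in> A \<Longrightarrow> p \<in> cdom c \<Longrightarrow> transition c d (coord c p) = coord d p"
  by (simp add: transition_def cinv_coord)

lemma open_cinv_image:
  assumes "c \<in> A" "open W" "W \<subseteq> coord c ` cdom c"
  shows "open (cinv c ` W)"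
proof -
  have "cinv c ` W = cdom c \<inter> coord c -` W"
  proof (intro equalityI subsetI)
    fix x assume "x \<in> cinv c ` W"
    then obtain w where "w \<in> W" "x = cinv c w" by blast
    then show "x \<in> cdom c \<inter> coord c -` W"
      using assms cinv_in_cdom[OF assms(1), of w] coord_cinv[OF assms(1), of w] by auto
  next
    fix x assume "x \<in> cdom c \<inter> coord c -` W"
    then show "x \<in> cinv c ` W" using cinv_coord[OF assms(1), of x] by (metis IntE image_eqI vimage_eq)
  qed
  then show ?thesis
    using continuous_open_preimage[OF continuous_coord open_cdom assms(2)] assms(1) by simp
qed

lemma open_overlap:
  assumes "c \<in> A" "d \<in> A"
  shows "open (coord c ` (cdom c \<inter> cdom d))"
proof -
  have "coord c ` (cdom c \<inter> cdom d) = coord c ` cdom c \<inter> cinv c -` cdom d"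
    using cinv_coord[OF assms(1)] by auto
  then show ?thesis
    using continuous_open_preimage[OF continuous_cinv open_coord_image open_cdom] assms by simp
qed

lemma transition_derivative:
  assumes "c \<in> A" "d \<in> A" "p \<in> cdom c" "p \<in> cdom d"
  shows "(transition c d has_field_derivative deriv (transition c d) (coord c p)) (at (coord c p))"
  by (rule holomorphic_derivI[OF holomorphic_transition open_overlap]) (use assms in auto)

lemma chart_change_derivative:
  assumes "open U" "z \<in> U" "continuous_on U E" "c \<in> A" "d \<in> A" "E z \<in> cdom c" "E z \<in> cdom d"
    "((coord c \<circ> E) has_field_derivative g') (at z)"
  shows "((coord d \<circ> E) has_field_derivative deriv (transition c d) (coord c (E z)) * g') (at z)"
proof -
  have o: "open (U \<inter> E -` cdom c)" using assms by (intro continuous_open_preimage open_cdom)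
  have "(transition c d \<circ> (coord c \<circ> E) has_field_derivative deriv (transition c d) (coord c (E z)) * g') (at z)"
    using transition_derivative[OF assms(4-7)] by (intro DERIV_chain assms(8)) simp
  then show ?thesis
    by (rule has_field_derivative_transform_within_open[OF _ o]) (use assms transition_coord in auto)
qed

end

text \<open>
  The source carries the metric of the Poincare disc. The condition is imposed in all charts, so that
  any of them can be chosen when it is used; it suffices to check it in one chart around each image point.
\<close>

definition local_isometry :: "'a::t2_space chart set \<Rightarrow> ('a chart \<Rightarrow> complex \<Rightarrow> real) \<Rightarrow>
    complex set \<Rightarrow> (complex \<Rightarrow> 'a) \<Rightarrow> bool" where
  "local_isometry A \<rho> U E \<longleftrightarrow> open U \<and> U \<subseteq> ball 0 1 \<and> continuous_on U E \<and>
     (\<forall>z\<in>U. \<forall>c\<in>A. E z \<in> cdom c \<longrightarrow> (\<exists>g'. ((coord c \<circ> E) has_field_derivative g') (at z) \<and>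
        \<rho> c (coord c (E z)) * cmod g' = 2 / (1 - (cmod z)\<^sup>2)))"

lemma local_isometryD:
  assumes "local_isometry A \<rho> U E"
  shows "open U" "U \<subseteq> ball 0 1" "continuous_on U E"
  using assms by (auto simp: local_isometry_def)

lemma local_isometry_subset:
  "local_isometry A \<rho> U E \<Longrightarrow> open V \<Longrightarrow> V \<subseteq> U \<Longrightarrow> local_isometry A \<rho> V E"
  unfolding local_isometry_def by (meson continuous_on_subset subset_iff order_trans)

lemma local_isometry_derivative:
  assumes "local_isometry A \<rho> U E" "z \<in> U" "c \<in> A" "E z \<in> cdom c"
  shows "((coord c \<circ> E) has_field_derivative deriv (coord c \<circ> E) z) (at z)"
    "\<rho> c (coord c (E z)) * cmod (deriv (coord c \<circ> E) z) = 2 / (1 - (cmod z)\<^sup>2)"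
proof -
  obtain g' where g': "((coord c \<circ> E) has_field_derivative g') (at z)"
        "\<rho> c (coord c (E z)) * cmod g' = 2 / (1 - (cmod z)\<^sup>2)"
    using assms unfolding local_isometry_def by blast
  moreover have "deriv (coord c \<circ> E) z = g'" by (rule DERIV_imp_deriv[OF g'(1)])
  ultimately show "((coord c \<circ> E) has_field_derivative deriv (coord c \<circ> E) z) (at z)"
    "\<rho> c (coord c (E z)) * cmod (deriv (coord c \<circ> E) z) = 2 / (1 - (cmod z)\<^sup>2)" by simp_all
qed

lemma local_isometry_holomorphic:
  assumes "local_isometry A \<rho> U E" "open V" "V \<subseteq> U" "c \<in> A" "E ` V \<subseteq> cdom c"
  shows "(coord c \<circ> E) holomorphic_on V"
proof -
  have "((coord c \<circ> E) has_field_derivative deriv (coord c \<circ> E) z) (at z)" if "z \<in> V" for z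
    using local_isometry_derivative(1)[OF assms(1) _ assms(4), of z] assms(3,5) that by blast
  then show ?thesis using holomorphic_on_open[OF assms(2)] by blast
qed

lemma local_isometry_local:
  assumes "open U" "U \<subseteq> ball 0 1"
    "\<And>z. z \<in> U \<Longrightarrow> \<exists>N F. open N \<and> z \<in> N \<and> local_isometry A \<rho> N F \<and> (\<forall>w\<in>N. F w = E w)"
  shows "local_isometry A \<rho> U E"
proof -
  have "isCont E z \<and> (\<forall>c\<in>A. E z \<in> cdom c \<longrightarrow> (\<exists>g'. ((coord c \<circ> E) has_field_derivative g') (at z) \<and>
        \<rho> c (coord c (E z)) * cmod g' = 2 / (1 - (cmod z)\<^sup>2)))" if z: "z \<in> U" for z
  proof -
    obtain N F where N: "open N" "z \<in> N" "local_isometry A \<rho> N F" "\<And>w. w \<in> N \<Longrightarrow> F w = E w"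
      using assms(3)[OF z] by blast
    have "continuous_on N E"
      using local_isometryD(3)[OF N(3)] N(4) by (simp cong: continuous_on_cong)
    then have "isCont E z" using N by (simp add: continuous_on_eq_continuous_at)
    moreover have "\<exists>g'. ((coord c \<circ> E) has_field_derivative g') (at z) \<and>
        \<rho> c (coord c (E z)) * cmod g' = 2 / (1 - (cmod z)\<^sup>2)" if c: "c \<in> A" "E z \<in> cdom c" for c
    proof -
      have Fz: "F z \<in> cdom c" using N(2,4) c by simp
      have "((coord c \<circ> E) has_field_derivative deriv (coord c \<circ> F) z) (at z)"
        by (rule has_field_derivative_transform_within_open[OF
            local_isometry_derivative(1)[OF N(3,2) c(1) Fz] N(1,2)]) (simp add: N(4))
      then show ?thesis
        using local_isometry_derivative(2)[OF N(3,2) c(1) Fz] N(2,4) by auto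
    qed
    ultimately show ?thesis by blast
  qed
  then show ?thesis using assms(1,2)
    unfolding local_isometry_def by (blast intro: continuous_at_imp_continuous_on)
qed

lemma local_isometry_compose:
  assumes "local_isometry A \<rho> V E" "open U" "U \<subseteq> ball 0 1" "k ` U \<subseteq> V"
    and k: "\<And>z. z \<in> U \<Longrightarrow> (k has_field_derivative k' z) (at z)"
      "\<And>z. z \<in> U \<Longrightarrow> cmod (k' z) * (1 - (cmod z)\<^sup>2) = 1 - (cmod (k z))\<^sup>2"
  shows "local_isometry A \<rho> U (E \<circ> k)"
    "\<And>z c. z \<in> U \<Longrightarrow> c \<in> A \<Longrightarrow> E (k z) \<in> cdom c \<Longrightarrow>
       deriv (coord c \<circ> (E \<circ> k)) z = deriv (coord c \<circ> E) (k z) * k' z"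
proof -
  have d: "((coord c \<circ> (E \<circ> k)) has_field_derivative deriv (coord c \<circ> E) (k z) * k' z) (at z)"
    if "z \<in> U" "c \<in> A" "E (k z) \<in> cdom c" for z c
    using DERIV_chain[OF local_isometry_derivative(1)[OF assms(1) _ that(2), of "k z"] k(1)[OF that(1)]]
      that assms(4) by (auto simp: o_assoc)
  show "deriv (coord c \<circ> (E \<circ> k)) z = deriv (coord c \<circ> E) (k z) * k' z"
    if "z \<in> U" "c \<in> A" "E (k z) \<in> cdom c" for z c
    by (rule DERIV_imp_deriv[OF d[OF that]])
  have "continuous_on U k"
    using k(1) by (auto intro!: continuous_at_imp_continuous_on DERIV_isCont)
  then have "continuous_on U (E \<circ> k)"
    using continuous_on_subset[OF local_isometryD(3)[OF assms(1)] assms(4)] by (rule continuous_on_compose)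
  moreover have "\<exists>g'. ((coord c \<circ> (E \<circ> k)) has_field_derivative g') (at z) \<and>
        \<rho> c (coord c ((E \<circ> k) z)) * cmod g' = 2 / (1 - (cmod z)\<^sup>2)"
    if z: "z \<in> U" and c: "c \<in> A" "(E \<circ> k) z \<in> cdom c" for z c
  proof (intro exI conjI)
    have kV: "k z \<in> V" using z assms(4) by blast
    show "((coord c \<circ> (E \<circ> k)) has_field_derivative deriv (coord c \<circ> E) (k z) * k' z) (at z)"
      using d z c by simp
    have "cmod z < 1" "cmod (k z) < 1"
      using assms(3) local_isometryD(2)[OF assms(1)] z kV by auto
    then have "(cmod z)\<^sup>2 < 1" "(cmod (k z))\<^sup>2 < 1" by (simp_all add: abs_square_less_1)
    then have n: "1 - (cmod z)\<^sup>2 \<noteq> 0" "1 - (cmod (k z))\<^sup>2 \<noteq> 0" by simp_all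
    have "\<rho> c (coord c ((E \<circ> k) z)) * cmod (deriv (coord c \<circ> E) (k z) * k' z) =
       (2 / (1 - (cmod (k z))\<^sup>2)) * cmod (k' z)"
      using local_isometry_derivative(2)[OF assms(1) kV c(1)] c(2) by (simp add: norm_mult flip: mult.assoc)
    also have "\<dots> = 2 / (1 - (cmod z)\<^sup>2)"
      using n k(2)[OF z] by (simp add: field_simps)
    finally show "\<rho> c (coord c ((E \<circ> k) z)) * cmod (deriv (coord c \<circ> E) (k z) * k' z) = 2 / (1 - (cmod z)\<^sup>2)" .
  qed
  ultimately show "local_isometry A \<rho> U (E \<circ> k)"
    using assms(2,3) unfolding local_isometry_def by blast
qed

definition blaschke :: "complex \<Rightarrow> complex \<Rightarrow> complex" where
  "blaschke a w = (w - a) / (1 - cnj a * w)"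

lemma blaschke_denominator:
  assumes "cmod a < 1" "cmod w < 1"
  shows "1 - cmod a \<le> cmod (1 - cnj a * w)" "1 - cnj a * w \<noteq> 0"
proof -
  have "cmod a * cmod w \<le> cmod a * 1" using assms by (intro mult_left_mono) auto
  then show 1: "1 - cmod a \<le> cmod (1 - cnj a * w)"
    using norm_triangle_ineq2[of 1 "cnj a * w"] by (simp add: norm_mult)
  show "1 - cnj a * w \<noteq> 0"
  proof
    assume "1 - cnj a * w = 0"
    then have "cmod (1 - cnj a * w) = 0" by simp
    then show False using 1 assms by linarith
  qed
qed

lemma blaschke_isometry:
  assumes "cmod a < 1" "cmod w < 1"
  shows "(blaschke a has_field_derivative of_real (1 - (cmod a)\<^sup>2) / (1 - cnj a * w)\<^sup>2) (at w)"
    "cmod (of_real (1 - (cmod a)\<^sup>2) / (1 - cnj a * w)\<^sup>2) * (1 - (cmod w)\<^sup>2) = 1 - (cmod (blaschke a w))\<^sup>2"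
    "cmod (blaschke a w) < 1"
proof -
  note n = blaschke_denominator(2)[OF assms]
  have aa: "cnj a * a = of_real ((cmod a)\<^sup>2)" by (metis complex_norm_square mult.commute)
  have e: "1 * (1 - cnj a * w) - (w - a) * (- cnj a) = of_real (1 - (cmod a)\<^sup>2)"
    using aa by (simp add: algebra_simps)
  have "((\<lambda>w. (w - a) / (1 - cnj a * w)) has_field_derivative
      (1 * (1 - cnj a * w) - (w - a) * (- cnj a)) / ((1 - cnj a * w) * (1 - cnj a * w))) (at w)"
  proof (rule DERIV_divide)
    show "((\<lambda>w. w - a) has_field_derivative 1) (at w)"
      "((\<lambda>w. 1 - cnj a * w) has_field_derivative - cnj a) (at w)"
      by (auto intro!: derivative_eq_intros)
  qed (rule n)
  then show "(blaschke a has_field_derivative of_real (1 - (cmod a)\<^sup>2) / (1 - cnj a * w)\<^sup>2) (at w)"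
    unfolding blaschke_def[abs_def] e power2_eq_square[of "1 - cnj a * w"] .
  have id: "(cmod (1 - cnj a * w))\<^sup>2 - (cmod (w - a))\<^sup>2 = (1 - (cmod a)\<^sup>2) * (1 - (cmod w)\<^sup>2)"
    unfolding cmod_power2 by (simp add: power2_eq_square algebra_simps)
  have p: "1 - (cmod a)\<^sup>2 > 0" "1 - (cmod w)\<^sup>2 > 0" using assms by (simp_all add: abs_square_less_1)
  have nn: "(cmod (1 - cnj a * w))\<^sup>2 > 0" using n by simp
  have "1 - (cmod (blaschke a w))\<^sup>2 = ((cmod (1 - cnj a * w))\<^sup>2 - (cmod (w - a))\<^sup>2) / (cmod (1 - cnj a * w))\<^sup>2"
  proof -
    have "(cmod (blaschke a w))\<^sup>2 = (cmod (w - a))\<^sup>2 / (cmod (1 - cnj a * w))\<^sup>2"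
      by (simp only: blaschke_def norm_divide power_divide)
    moreover have "1 - x / y = (y - x) / y" if "y > 0" for x y :: real
      using that by (simp add: field_simps)
    ultimately show ?thesis using nn by (simp only:)
  qed
  then have q: "1 - (cmod (blaschke a w))\<^sup>2 = (1 - (cmod a)\<^sup>2) * (1 - (cmod w)\<^sup>2) / (cmod (1 - cnj a * w))\<^sup>2"
    unfolding id .
  show "cmod (of_real (1 - (cmod a)\<^sup>2) / (1 - cnj a * w)\<^sup>2) * (1 - (cmod w)\<^sup>2) = 1 - (cmod (blaschke a w))\<^sup>2"
    unfolding q norm_divide norm_power norm_of_real using p by simp
  have "1 - (cmod (blaschke a w))\<^sup>2 > 0" unfolding q using p nn by simp
  then show "cmod (blaschke a w) < 1" by (simp add: abs_square_less_1)
qed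

context riemann_surface_metric
begin

lemma local_isometryI:
  assumes "open U" "U \<subseteq> ball 0 1" "continuous_on U E"
    and "\<And>z. z \<in> U \<Longrightarrow> \<exists>c\<in>A. E z \<in> cdom c \<and> (\<exists>g'. ((coord c \<circ> E) has_field_derivative g') (at z) \<and>
        \<rho> c (coord c (E z)) * cmod g' = 2 / (1 - (cmod z)\<^sup>2))"
  shows "local_isometry A \<rho> U E"
proof -
  have "\<exists>g'. ((coord d \<circ> E) has_field_derivative g') (at z) \<and>
        \<rho> d (coord d (E z)) * cmod g' = 2 / (1 - (cmod z)\<^sup>2)" if z: "z \<in> U" and d: "d \<in> A" "E z \<in> cdom d" for z d
  proof -
    obtain c g' where c: "c \<in> A" "E z \<in> cdom c" "((coord c \<circ> E) has_field_derivative g') (at z)"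
        "\<rho> c (coord c (E z)) * cmod g' = 2 / (1 - (cmod z)\<^sup>2)"
      using assms(4)[OF z] by blast
    have "\<rho> c (coord c (E z)) * cmod g' = \<rho> d (coord d (E z)) * cmod (deriv (transition c d) (coord c (E z)) * g')"
      using density_transition[OF c(1) d(1) c(2) d(2)] by (simp add: norm_mult)
    then show ?thesis
      using chart_change_derivative[OF assms(1) z assms(3) c(1) d(1) c(2) d(2) c(3)] c(4) by auto
  qed
  then show ?thesis using assms(1-3) unfolding local_isometry_def by blast
qed

lemma local_isometries_near:
  assumes "local_isometry A \<rho> U E" "z \<in> U" "c \<in> A" "E z \<in> cdom c" "open W" "coord c (E z) \<in> W"
  obtains \<delta> where "\<delta> > 0" "ball z \<delta> \<subseteq> U" "E ` ball z \<delta> \<subseteq> cdom c" "(coord c \<circ> E) ` ball z \<delta> \<subseteq> W"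
proof -
  have "open (cdom c \<inter> coord c -` W)"
    using continuous_open_preimage[OF continuous_coord open_cdom assms(5)] assms(3) by simp
  then have "open (U \<inter> E -` (cdom c \<inter> coord c -` W))"
    by (rule continuous_open_preimage[OF local_isometryD(3,1)[OF assms(1)]])
  moreover have "z \<in> U \<inter> E -` (cdom c \<inter> coord c -` W)" using assms by simp
  ultimately obtain \<delta> where "\<delta> > 0" "ball z \<delta> \<subseteq> U \<inter> E -` (cdom c \<inter> coord c -` W)"
    by (rule openE)
  then show ?thesis by (intro that[of \<delta>]) auto
qed

text \<open>
  The interior of the set where the two maps agree is also relatively closed: at a limit point the
  values agree because the surface is Hausdorff, and then analytic continuation in a chart applies.
\<close>

lemma local_isometry_identity:
  assumes E: "local_isometry A \<rho> U E" and F: "local_isometry A \<rho> U F" and U: "connected U"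
    and N: "open N" "N \<noteq> {}" "N \<subseteq> U" "\<And>z. z \<in> N \<Longrightarrow> E z = F z" and z: "z \<in> U"
  shows "E z = F z"
proof -
  define W where "W = {w \<in> U. E w = F w}"
  define V where "V = interior W"
  have V: "open V" "V \<subseteq> U" and VW: "V \<subseteq> W"
    using interior_subset[of W] by (auto simp: V_def W_def)
  have VE: "E w = F w" if "w \<in> V" for w
    using subsetD[OF VW that] by (simp add: W_def)
  have Vmem: "M \<subseteq> V" if M: "open M" "M \<subseteq> U" "\<And>w. w \<in> M \<Longrightarrow> E w = F w" for M
    unfolding V_def
  proof (rule interior_maximal[OF _ M(1)], rule subsetI)
    fix w assume "w \<in> M"
    then show "w \<in> W" using M(2) M(3)[of w] by (simp add: W_def subset_iff)
  qed
  have "\<exists>B. open B \<and> x \<in> B \<and> B \<subseteq> U - V" if x: "x \<in> U - V" for x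
  proof (cases "E x = F x")
    case False
    from hausdorff[OF this] obtain S T where ST: "open S" "open T" "E x \<in> S" "F x \<in> T" "S \<inter> T = {}"
      by (elim exE conjE)
    have "open ((U \<inter> E -` S) \<inter> (U \<inter> F -` T))"
      by (rule open_Int[OF continuous_open_preimage[OF local_isometryD(3,1)[OF E] ST(1)]
            continuous_open_preimage[OF local_isometryD(3,1)[OF F] ST(2)]])
    moreover have "(U \<inter> E -` S) \<inter> (U \<inter> F -` T) \<subseteq> U - V"
    proof
      fix w assume w: "w \<in> (U \<inter> E -` S) \<inter> (U \<inter> F -` T)"
      then have "E w \<noteq> F w" using ST(5) by auto
      then show "w \<in> U - V" using VE[of w] w by auto
    qed
    ultimately show ?thesis using x ST by blast
  next
    case True
    let ?c = "chart_at A (E x)"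
    note c = chart_at_props[of "E x"]
    have xU: "x \<in> U" using x by simp
    have Fc: "F x \<in> cdom ?c" using c(2) True by simp
    obtain d1 where d1: "d1 > 0" "ball x d1 \<subseteq> U" "E ` ball x d1 \<subseteq> cdom ?c"
      by (rule local_isometries_near[OF E xU c open_UNIV]) auto
    obtain d2 where d2: "d2 > 0" "ball x d2 \<subseteq> U" "F ` ball x d2 \<subseteq> cdom ?c"
      by (rule local_isometries_near[OF F xU c(1) Fc open_UNIV]) auto
    define B where "B = ball x (min d1 d2)"
    have B: "open B" "connected B" "x \<in> B" "B \<subseteq> U" "E ` B \<subseteq> cdom ?c" "F ` B \<subseteq> cdom ?c"
      using d1 d2 by (auto simp: B_def)
    have "B \<inter> V = {}"
    proof (rule ccontr)
      assume ne: "B \<inter> V \<noteq> {}"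
      have "E w = F w" if w: "w \<in> B" for w
      proof -
        have "(coord ?c \<circ> E) w = (coord ?c \<circ> F) w"
          by (rule analytic_continuation_open[OF open_Int[OF B(1) V(1)] B(1) ne B(2) Int_lower1
                local_isometry_holomorphic[OF E B(1,4) c(1) B(5)] local_isometry_holomorphic[OF F B(1,4) c(1) B(6)] _ w])
            (simp add: VE)
        then have "cinv ?c (coord ?c (E w)) = cinv ?c (coord ?c (F w))" by simp
        then show ?thesis using cinv_coord[OF c(1)] B w by (metis image_subset_iff)
      qed
      then have "B \<subseteq> V" by (rule Vmem[OF B(1,4)])
      then show False using B(3) x by auto
    qed
    then show ?thesis using B by blast
  qed
  then have oW: "open (U - V)" using open_subopen[of "U - V"] by blast
  have "V \<inter> U = {} \<or> (U - V) \<inter> U = {}"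
    by (rule connectedD[OF U V(1) oW]) (use V in auto)
  moreover have "N \<subseteq> V" by (rule Vmem[OF N(1,3,4)])
  ultimately have "z \<in> V" using N(2,3) z by auto
  then show ?thesis by (rule VE)
qed

text \<open>
  Holomorphic maps in general are not determined by a 1-jet; here the second order equation of
  isometries does it.
\<close>

lemma local_isometry_same_jet:
  assumes E: "local_isometry A \<rho> U E" and F: "local_isometry A \<rho> V F" and z: "z \<in> U" "z \<in> V"
    and c: "c \<in> A" "E z \<in> cdom c" and jet: "E z = F z" "deriv (coord c \<circ> E) z = deriv (coord c \<circ> F) z"
  obtains \<delta> where "\<delta> > 0" "ball z \<delta> \<subseteq> U \<inter> V" "\<And>w. w \<in> ball z \<delta> \<Longrightarrow> E w = F w"
proof -
  let ?S = "coord c ` cdom c"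
  have S: "open ?S" "coord c (E z) \<in> ?S" using open_coord_image c by auto
  obtain r where r: "r > 0" "cball (coord c (E z)) r \<subseteq> ?S" using S open_contains_cball by blast
  have Fc: "F z \<in> cdom c" using c jet by simp
  obtain d1 where d1: "d1 > 0" "ball z d1 \<subseteq> U" "E ` ball z d1 \<subseteq> cdom c" "(coord c \<circ> E) ` ball z d1 \<subseteq> ball (coord c (E z)) r"
    by (rule local_isometries_near[OF E z(1) c open_ball[of "coord c (E z)" r]]) (use r in auto)
  obtain d2 where d2: "d2 > 0" "ball z d2 \<subseteq> V" "F ` ball z d2 \<subseteq> cdom c" "(coord c \<circ> F) ` ball z d2 \<subseteq> ball (coord c (E z)) r"
    by (rule local_isometries_near[OF F z(2) c(1) Fc open_ball[of "coord c (E z)" r]]) (use r jet in auto)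
  define \<delta> where "\<delta> = min d1 d2"
  have sub: "ball z \<delta> \<subseteq> ball z d1" "ball z \<delta> \<subseteq> ball z d2" by (auto simp: \<delta>_def)
  have BU: "ball z \<delta> \<subseteq> U" "ball z \<delta> \<subseteq> V" "E ` ball z \<delta> \<subseteq> cdom c" "F ` ball z \<delta> \<subseteq> cdom c"
    using sub d1 d2 by blast+
  have im: "(coord c \<circ> E) ` ball z \<delta> \<subseteq> cball (coord c (E z)) r" "(coord c \<circ> F) ` ball z \<delta> \<subseteq> cball (coord c (E z)) r"
    using sub d1 d2 ball_subset_cball by blast+
  have ball1: "ball z \<delta> \<subseteq> ball 0 1" using BU(1) local_isometryD(2)[OF E] by blast
  have "E w = F w" if w: "w \<in> ball z \<delta>" for w
  proof -
    have "(coord c \<circ> E) w = (coord c \<circ> F) w"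
    proof (rule isometry_unique_plane[OF S(1) density_pos[OF c(1)] density_smooth[OF c(1)] r(2) ball1
        local_isometry_holomorphic[OF E open_ball BU(1) c(1) BU(3)] im(1) _
        local_isometry_holomorphic[OF F open_ball BU(2) c(1) BU(4)] im(2) _ _ jet(2) w])
      fix x assume x: "x \<in> ball z \<delta>"
      show "\<rho> c ((coord c \<circ> E) x) * cmod (deriv (coord c \<circ> E) x) = 2 / (1 - (cmod x)\<^sup>2)"
        unfolding o_apply[of "coord c" E x] by (rule local_isometry_derivative(2)[OF E _ c(1)]) (use BU x in blast)+
      show "\<rho> c ((coord c \<circ> F) x) * cmod (deriv (coord c \<circ> F) x) = 2 / (1 - (cmod x)\<^sup>2)"
        unfolding o_apply[of "coord c" F x] by (rule local_isometry_derivative(2)[OF F _ c(1)]) (use BU x in blast)+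
    qed (simp_all add: jet(1))
    then have "cinv c (coord c (E w)) = cinv c (coord c (F w))" by simp
    then show ?thesis using cinv_coord[OF c(1)] BU w by (metis image_subset_iff)
  qed
  then show ?thesis using that[of \<delta>] d1(1) d2(1) BU by (auto simp: \<delta>_def)
qed

end

section \<open>The developing map\<close>

text \<open>
  The Euclidean radius \<open>\<kappa> (1 - |z0|)\<close> is, up to constant factors, the radius of a hyperbolic disc
  around \<open>z0\<close> whose size does not depend on \<open>z0\<close>.
\<close>

definition extendable :: "'a::t2_space chart set \<Rightarrow> ('a chart \<Rightarrow> complex \<Rightarrow> real) \<Rightarrow> real \<Rightarrow>
    complex set \<Rightarrow> (complex \<Rightarrow> 'a) \<Rightarrow> complex \<Rightarrow> bool" where
  "extendable A \<rho> \<kappa> U E z0 \<longleftrightarrow>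
     (\<exists>E' \<delta>. local_isometry A \<rho> (ball z0 (\<kappa> * (1 - cmod z0))) E' \<and> \<delta> > 0 \<and>
        ball z0 \<delta> \<subseteq> U \<inter> ball z0 (\<kappa> * (1 - cmod z0)) \<and> (\<forall>w\<in>ball z0 \<delta>. E' w = E w))"

context compact_hyperbolic_surface
begin

lemma local_isometry_exists:
  obtains E \<epsilon> c where "0 < \<epsilon>" "c \<in> A" "local_isometry A \<rho> (ball 0 \<epsilon>) E" "E ` ball 0 \<epsilon> \<subseteq> cdom c" "E 0 = p"
    "\<And>\<delta>. \<delta> \<le> \<epsilon> \<Longrightarrow> open (E ` ball 0 \<delta>)"
proof -
  define c where "c = chart_at A p"
  have c: "c \<in> A" "p \<in> cdom c" unfolding c_def by (rule chart_at_props)+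
  have pS: "coord c p \<in> coord c ` cdom c" using c by simp
  obtain g \<epsilon> where e: "0 < \<epsilon>" "ball 0 \<epsilon> \<subseteq> ball (0::complex) 1" and g: "g holomorphic_on ball 0 \<epsilon>"
      "g ` ball 0 \<epsilon> \<subseteq> coord c ` cdom c" "g 0 = coord c p" "inj_on g (ball 0 \<epsilon>)"
    and iso: "\<And>z. z \<in> ball 0 \<epsilon> \<Longrightarrow> \<rho> c (g z) * cmod (deriv g z) = 2 / (1 - (cmod z)\<^sup>2)"
    by (rule hyperbolic_coordinate[OF open_coord_image[OF c(1)] pS density_pos[OF c(1)] density_smooth[OF c(1)]
          curvature[OF c(1)]]; (assumption | rule that))
  define E where "E = cinv c \<circ> g"
  have cE: "coord c (E z) = g z" and Ec: "E z \<in> cdom c" if z: "z \<in> ball 0 \<epsilon>" for z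
  proof -
    have "g z \<in> coord c ` cdom c" using g(2) z by (rule subsetD[OF _ imageI])
    then show "coord c (E z) = g z" "E z \<in> cdom c"
      using coord_cinv[OF c(1)] cinv_in_cdom[OF c(1)] by (simp_all add: E_def)
  qed
  have dE: "((coord c \<circ> E) has_field_derivative deriv g z) (at z)" if z: "z \<in> ball 0 \<epsilon>" for z
    by (rule has_field_derivative_transform_within_open[OF holomorphic_derivI[OF g(1) open_ball z] open_ball z])
      (simp add: cE)
  have "local_isometry A \<rho> (ball 0 \<epsilon>) E"
  proof (rule local_isometryI[OF open_ball e(2)])
    show "continuous_on (ball 0 \<epsilon>) E"
      unfolding E_def
      by (rule continuous_on_compose[OF holomorphic_on_imp_continuous_on[OF g(1)] continuous_on_subset[OF continuous_cinv[OF c(1)] g(2)]])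
    fix z :: complex assume z: "z \<in> ball 0 \<epsilon>"
    show "\<exists>c\<in>A. E z \<in> cdom c \<and> (\<exists>g'. ((coord c \<circ> E) has_field_derivative g') (at z) \<and>
        \<rho> c (coord c (E z)) * cmod g' = 2 / (1 - (cmod z)\<^sup>2))"
      by (intro bexI[of _ c] conjI exI[of _ "deriv g z"] dE[OF z] Ec[OF z] c(1)) (simp add: cE[OF z] iso[OF z])
  qed
  moreover have "open (E ` ball 0 \<delta>)" if "\<delta> \<le> \<epsilon>" for \<delta>
  proof -
    have sub: "ball 0 \<delta> \<subseteq> ball (0::complex) \<epsilon>" using that by auto
    have "open (g ` ball 0 \<delta>)"
      by (rule open_mapping_thm3[OF holomorphic_on_subset[OF g(1) sub] open_ball inj_on_subset[OF g(4) sub]])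
    then show ?thesis unfolding E_def image_comp[symmetric]
      by (rule open_cinv_image[OF c(1)]) (rule subset_trans[OF image_mono[OF sub] g(2)])
  qed
  moreover have "E 0 = p" using g(3) cinv_coord[OF c] by (simp add: E_def)
  ultimately show ?thesis using e(1) c(1) Ec by (intro that[of \<epsilon> c E]) auto
qed

text \<open>
  Around each point there is a scale at which every local isometry can be extended: compose the
  local chart by the disc with the disc automorphism that has the given 1-jet.
\<close>

lemma extension_near_point:
  obtains V \<kappa> where "open V" "p \<in> V" "0 < \<kappa>" "\<kappa> \<le> (1::real)"
    "\<And>E U z0. local_isometry A \<rho> U E \<Longrightarrow> z0 \<in> U \<Longrightarrow> E z0 \<in> V \<Longrightarrow> extendable A \<rho> \<kappa> U E z0"
proof -
  obtain G \<epsilon> c where e: "0 < \<epsilon>" and c: "c \<in> A" and G: "local_isometry A \<rho> (ball 0 \<epsilon>) G" "G ` ball 0 \<epsilon> \<subseteq> cdom c" "G 0 = p"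
    and Go: "\<And>\<delta>. \<delta> \<le> \<epsilon> \<Longrightarrow> open (G ` ball 0 \<delta>)"
    by (rule local_isometry_exists[of p]) (rule that)
  have e1: "ball 0 \<epsilon> \<subseteq> ball (0::complex) 1" by (rule local_isometryD(2)[OF G(1)])
  have e1': "\<epsilon> \<le> 1"
  proof (rule ccontr)
    assume "\<not> ?thesis"
    then have "(1::complex) \<in> ball 0 \<epsilon>" by simp
    then have "(1::complex) \<in> ball 0 1" by (rule subsetD[OF e1])
    then show False by simp
  qed
  \<comment> \<open>disc automorphisms at most double small distances: from \<open>|z| < \<epsilon>/2\<close> one stays within \<open>\<epsilon>/2 + 2\<kappa>\<close>\<close>
  define \<kappa> where "\<kappa> = \<epsilon> / 4"
  show ?thesis
  proof (rule that[of "G ` ball 0 (\<epsilon>/2)" \<kappa>])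
    show "open (G ` ball 0 (\<epsilon>/2))" using e by (intro Go) simp
    show "p \<in> G ` ball 0 (\<epsilon>/2)" using e G(3) by (intro image_eqI[of _ _ 0]) auto
    show "0 < \<kappa>" "\<kappa> \<le> 1" using e e1' by (auto simp: \<kappa>_def)
    fix E U z0 assume E: "local_isometry A \<rho> U E" and z0: "z0 \<in> U" and "E z0 \<in> G ` ball 0 (\<epsilon>/2)"
    then obtain z where z: "cmod z < \<epsilon> / 2" "E z0 = G z" by auto
    have z0d: "cmod z0 < 1" using local_isometryD(2)[OF E] z0 by auto
    have zd: "cmod z < 1" "z \<in> ball 0 \<epsilon>" using z e1' e by auto
    have Gc: "G z \<in> cdom c" using G(2) zd(2) by blast
    define d where "d = deriv (coord c \<circ> E) z0"
    define d' where "d' = deriv (coord c \<circ> G) z"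
    have dn: "\<rho> c (coord c (G z)) * cmod d = 2 / (1 - (cmod z0)\<^sup>2)"
       "\<rho> c (coord c (G z)) * cmod d' = 2 / (1 - (cmod z)\<^sup>2)"
      using local_isometry_derivative(2)[OF E z0 c] local_isometry_derivative(2)[OF G(1) zd(2) c Gc] z(2) Gc
      by (simp_all add: d_def d'_def)
    have rp: "\<rho> c (coord c (G z)) > 0" using density_pos[OF c] Gc by simp
    have sq: "(cmod z0)\<^sup>2 < 1" "(cmod z)\<^sup>2 < 1" using z0d zd by (simp_all add: abs_square_less_1)
    have d'0: "d' \<noteq> 0" using dn(2) sq by auto
    \<comment> \<open>the rotation that matches the two derivatives; it is unimodular since both maps are isometric\<close>
    define \<alpha> where "\<alpha> = d * of_real (1 - (cmod z0)\<^sup>2) / (d' * of_real (1 - (cmod z)\<^sup>2))"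
    have \<alpha>1: "cmod \<alpha> = 1"
    proof -
      let ?r = "\<rho> c (coord c (G z))"
      have cancel: "2 / y * y = 2" if "y > 0" for y :: real using that by simp
      have "?r * (cmod d * (1 - (cmod z0)\<^sup>2)) = 2" "?r * (cmod d' * (1 - (cmod z)\<^sup>2)) = 2"
        unfolding mult.assoc[symmetric] dn using sq by (intro cancel; simp)+
      then have "cmod d * (1 - (cmod z0)\<^sup>2) = cmod d' * (1 - (cmod z)\<^sup>2)"
        using rp by (metis mult_left_cancel less_irrefl)
      then show ?thesis unfolding \<alpha>_def norm_divide norm_mult norm_of_real using sq d'0 by simp
    qed
    define B where "B = ball z0 (\<kappa> * (1 - cmod z0))"
    have Bw: "cmod w < 1" "cmod (blaschke z0 w) < \<kappa>" if w: "w \<in> B" for w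
    proof -
      have lt: "cmod (w - z0) < \<kappa> * (1 - cmod z0)" using w by (simp add: B_def dist_norm norm_minus_commute)
      also have "\<dots> \<le> 1 * (1 - cmod z0)"
        using e1' z0d by (intro mult_right_mono) (auto simp: \<kappa>_def)
      finally have "cmod (w - z0) < 1 - cmod z0" by simp
      then show w1: "cmod w < 1" using norm_triangle_ineq2[of w z0] by linarith
      have n: "0 < 1 - cmod z0" "1 - cmod z0 \<le> cmod (1 - cnj z0 * w)"
        using z0d blaschke_denominator(1)[OF z0d w1] by auto
      have "cmod (blaschke z0 w) = cmod (w - z0) / cmod (1 - cnj z0 * w)"
        by (simp add: blaschke_def norm_divide)
      also have "\<dots> \<le> cmod (w - z0) / (1 - cmod z0)"
        using n less_le_trans[OF n] by (intro divide_left_mono mult_pos_pos) simp_all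
      also have "\<dots> < \<kappa>" using lt n(1) by (simp add: divide_less_eq)
      finally show "cmod (blaschke z0 w) < \<kappa>" .
    qed
    have B1: "B \<subseteq> ball 0 1" using Bw(1) by auto
    have z0B: "z0 \<in> B" using z0d e by (simp add: B_def \<kappa>_def)
    define M where "M w = blaschke (- z) (\<alpha> * blaschke z0 w)" for w
    define m where "m w = \<alpha> * blaschke z0 w" for w
    have mk: "cmod (m w) < \<kappa>" "cmod (m w) < 1" if "w \<in> B" for w
      using Bw(2)[OF that] \<alpha>1 e1' e by (auto simp: m_def norm_mult \<kappa>_def)
    have zm: "cmod (- z) < 1" using zd by simp
    define k' where "k' w = of_real (1 - (cmod (- z))\<^sup>2) / (1 - cnj (- z) * m w)\<^sup>2 *
        (\<alpha> * (of_real (1 - (cmod z0)\<^sup>2) / (1 - cnj z0 * w)\<^sup>2))" for w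
    have dM: "(M has_field_derivative k' w) (at w)" if w: "w \<in> B" for w
    proof -
      have "((\<lambda>w. \<alpha> * blaschke z0 w) has_field_derivative (\<alpha> * (of_real (1 - (cmod z0)\<^sup>2) / (1 - cnj z0 * w)\<^sup>2))) (at w)"
        by (rule DERIV_cmult[OF blaschke_isometry(1)[OF z0d Bw(1)[OF w]]])
      from DERIV_chain2[OF blaschke_isometry(1)[OF zm mk(2)[OF w, unfolded m_def]] this]
      show ?thesis unfolding M_def[abs_def] k'_def m_def .
    qed
    have nM: "cmod (k' w) * (1 - (cmod w)\<^sup>2) = 1 - (cmod (M w))\<^sup>2" if w: "w \<in> B" for w
    proof -
      have "cmod (k' w) * (1 - (cmod w)\<^sup>2) = cmod (of_real (1 - (cmod (- z))\<^sup>2) / (1 - cnj (- z) * m w)\<^sup>2) *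
          (cmod (of_real (1 - (cmod z0)\<^sup>2) / (1 - cnj z0 * w)\<^sup>2) * (1 - (cmod w)\<^sup>2))"
        unfolding k'_def norm_mult \<alpha>1 by simp
      also have "\<dots> = cmod (of_real (1 - (cmod (- z))\<^sup>2) / (1 - cnj (- z) * m w)\<^sup>2) * (1 - (cmod (m w))\<^sup>2)"
        unfolding blaschke_isometry(2)[OF z0d Bw(1)[OF w]] by (simp add: m_def norm_mult \<alpha>1)
      also have "\<dots> = 1 - (cmod (M w))\<^sup>2"
        unfolding blaschke_isometry(2)[OF zm mk(2)[OF w]] by (simp add: M_def m_def)
      finally show ?thesis .
    qed
    have im: "M ` B \<subseteq> ball 0 \<epsilon>"
    proof
      fix x assume "x \<in> M ` B"
      then obtain w where w: "w \<in> B" "x = M w" by blast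
      have n: "0 < 1 - cmod z" "1 - cmod z \<le> cmod (1 - cnj (- z) * m w)"
        using zd blaschke_denominator(1)[OF zm mk(2)[OF w(1)]] by auto
      then have n0: "1 - cnj (- z) * m w \<noteq> 0" by (auto simp del: complex_cnj_minus)
      have "M w - z = (m w + z - z * (1 - cnj (- z) * m w)) / (1 - cnj (- z) * m w)"
        using n0 by (simp add: M_def m_def blaschke_def diff_divide_distrib)
      also have "m w + z - z * (1 - cnj (- z) * m w) = m w * of_real (1 - (cmod z)\<^sup>2)"
        by (simp add: complex_norm_square algebra_simps del: of_real_power)
      finally have "cmod (M w - z) = cmod (m w) * (1 - (cmod z)\<^sup>2) / cmod (1 - cnj (- z) * m w)"
        using sq by (simp add: norm_divide norm_mult del: of_real_diff of_real_power)
      also have "\<dots> \<le> cmod (m w) * (1 - (cmod z)\<^sup>2) / (1 - cmod z)"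
        using n less_le_trans[OF n] sq by (intro divide_left_mono mult_pos_pos) simp_all
      also have "\<dots> = cmod (m w) * (1 + cmod z)"
        using n(1) by (simp add: field_simps power2_eq_square)
      also have "\<dots> \<le> cmod (m w) * 2"
        using zd by (intro mult_left_mono) auto
      finally have "cmod (M w - z) < \<epsilon> / 2" using mk(1)[OF w(1)] by (simp add: \<kappa>_def)
      then show "x \<in> ball 0 \<epsilon>" using z(1) norm_triangle_ineq2[of "M w" z] w(2) by simp
    qed
    note comp = local_isometry_compose[OF G(1) _ B1 im dM nM]
    have E': "local_isometry A \<rho> B (G \<circ> M)" by (rule comp(1)) (simp add: B_def)
    have b0: "blaschke z0 z0 = 0" "m z0 = 0" "M z0 = z" by (simp_all add: blaschke_def m_def M_def)
    have jet: "deriv (coord c \<circ> (G \<circ> M)) z0 = deriv (coord c \<circ> E) z0"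
    proof -
      have "deriv (coord c \<circ> (G \<circ> M)) z0 = d' * k' z0"
        using comp(2)[OF _ _ _ z0B c] Gc b0 by (simp add: d'_def B_def)
      also have "k' z0 = of_real (1 - (cmod z)\<^sup>2) * (\<alpha> * (of_real (1 - (cmod z0)\<^sup>2) / (of_real (1 - (cmod z0)\<^sup>2))\<^sup>2))"
      proof -
        have "cnj z0 * z0 = of_real ((cmod z0)\<^sup>2)" by (metis complex_norm_square mult.commute)
        then have "1 - cnj z0 * z0 = of_real (1 - (cmod z0)\<^sup>2)" by simp
        then show ?thesis unfolding k'_def b0 by simp
      qed
      also have "d' * \<dots> = d"
      proof -
        have n: "complex_of_real (1 - (cmod z0)\<^sup>2) \<noteq> 0" "complex_of_real (1 - (cmod z)\<^sup>2) \<noteq> 0"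
          using sq by (simp_all only: of_real_eq_0_iff)
        show ?thesis unfolding \<alpha>_def using n d'0
          by (simp add: power2_eq_square[of "complex_of_real _"] del: of_real_diff of_real_power)
      qed
      finally show ?thesis unfolding d_def .
    qed
    obtain \<delta> where \<delta>: "\<delta> > 0" "ball z0 \<delta> \<subseteq> B \<inter> U" "\<And>w. w \<in> ball z0 \<delta> \<Longrightarrow> (G \<circ> M) w = E w"
      by (rule local_isometry_same_jet[OF E' E z0B z0 c _ _ jet]) (use Gc b0 z(2) in auto)
    show "extendable A \<rho> \<kappa> U E z0"
      unfolding extendable_def
    proof (intro exI conjI ballI)
      show "local_isometry A \<rho> (ball z0 (\<kappa> * (1 - cmod z0))) (G \<circ> M)" using E' by (simp add: B_def)
      show "ball z0 \<delta> \<subseteq> U \<inter> ball z0 (\<kappa> * (1 - cmod z0))" using \<delta>(2) by (auto simp: B_def)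
    qed (use \<delta> in auto)
  qed
qed

text \<open>
  Compactness of the surface makes the scale uniform. This replaces geodesic completeness.
\<close>

lemma extension_uniform:
  obtains \<kappa> where "0 < \<kappa>" "\<kappa> \<le> (1::real)"
    "\<And>E U z0. local_isometry A \<rho> U E \<Longrightarrow> z0 \<in> U \<Longrightarrow> extendable A \<rho> \<kappa> U E z0"
proof -
  define P where "P V \<kappa> \<longleftrightarrow> (\<forall>E U z0. local_isometry A \<rho> U E \<longrightarrow> z0 \<in> U \<longrightarrow> E z0 \<in> V \<longrightarrow> extendable A \<rho> \<kappa> U E z0)" for V and \<kappa> :: real
  have "\<exists>V \<kappa>. open V \<and> p \<in> V \<and> 0 < \<kappa> \<and> \<kappa> \<le> 1 \<and> P V \<kappa>" for p
  proof -
    obtain V \<kappa> where V: "open V" "p \<in> V" "0 < \<kappa>" "\<kappa> \<le> (1::real)"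
      and ex: "\<And>E U z0. local_isometry A \<rho> U E \<Longrightarrow> z0 \<in> U \<Longrightarrow> E z0 \<in> V \<Longrightarrow> extendable A \<rho> \<kappa> U E z0"
      by (rule extension_near_point[of p]) (rule that)
    have "P V \<kappa>" unfolding P_def by (intro allI impI ex)
    then show ?thesis using V by (intro exI[of _ V] exI[of _ \<kappa>]) simp
  qed
  then obtain V \<kappa> where V: "\<And>p. open (V p)" "\<And>p. p \<in> V p" "\<And>p. 0 < \<kappa> p" "\<And>p. \<kappa> p \<le> (1::real)" "\<And>p. P (V p) (\<kappa> p)"
    by metis
  obtain C where C: "finite C" "UNIV \<subseteq> \<Union> (V ` C)"
    by (rule compactE_image[OF compact_surface, of UNIV V]) (use V in auto)
  have Cne: "C \<noteq> {}" using C(2) by auto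
  define k where "k = Min (\<kappa> ` C)"
  have k: "0 < k" "\<And>p. p \<in> C \<Longrightarrow> k \<le> \<kappa> p"
    using C(1) Cne V(3) by (auto simp: k_def)
  have k1: "k \<le> 1" using k(2) V(4) Cne by (meson all_not_in_conv order_trans)
  show ?thesis
  proof (rule that[OF k(1) k1])
    fix E U z0 assume E: "local_isometry A \<rho> U E" and z0: "z0 \<in> U"
    obtain p where p: "p \<in> C" "E z0 \<in> V p" using C(2) by blast
    obtain E' \<delta> where E': "local_isometry A \<rho> (ball z0 (\<kappa> p * (1 - cmod z0))) E'" "\<delta> > 0"
         "ball z0 \<delta> \<subseteq> U \<inter> ball z0 (\<kappa> p * (1 - cmod z0))" "\<forall>w\<in>ball z0 \<delta>. E' w = E w"
      using V(5)[of p, unfolded P_def, rule_format, OF E z0 p(2)] unfolding extendable_def by (elim exE conjE)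
    have z0d: "cmod z0 < 1" using local_isometryD(2)[OF E] z0 by auto
    have le: "k * (1 - cmod z0) \<le> \<kappa> p * (1 - cmod z0)"
      using k(2)[OF p(1)] z0d by (intro mult_right_mono) auto
    have kp: "k * (1 - cmod z0) > 0" using k(1) z0d by simp
    define \<delta>' where "\<delta>' = min \<delta> (k * (1 - cmod z0))"
    show "extendable A \<rho> k U E z0"
      unfolding extendable_def
    proof (intro exI conjI ballI)
      show "local_isometry A \<rho> (ball z0 (k * (1 - cmod z0))) E'"
        by (rule local_isometry_subset[OF E'(1) open_ball subset_ball[OF le]])
      show "\<delta>' > 0" using E'(2) kp by (simp add: \<delta>'_def)
      show "ball z0 \<delta>' \<subseteq> U \<inter> ball z0 (k * (1 - cmod z0))" using E'(3) by (auto simp: \<delta>'_def)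
      fix w assume "w \<in> ball z0 \<delta>'"
      then have "w \<in> ball z0 \<delta>" by (simp add: \<delta>'_def)
      with E'(4) show "E' w = E w" by (rule bspec)
    qed
  qed
qed

text \<open>
  Extension from a disc to a larger one: the local extensions around the points of the smaller disc
  are compatible because the discs involved meet in convex sets that reach into the smaller disc.
\<close>

lemma extension_step:
  assumes E: "local_isometry A \<rho> (ball 0 R) E" and R: "0 < R" "R < 1" and \<kappa>: "0 < \<kappa>" "\<kappa> \<le> (1::real)"
    and ex: "\<And>E U z0. local_isometry A \<rho> U E \<Longrightarrow> z0 \<in> U \<Longrightarrow> extendable A \<rho> \<kappa> U E z0"
  obtains E' where "local_isometry A \<rho> (ball 0 (R + \<kappa> / 4 * (1 - R))) E'" "\<And>w. w \<in> ball 0 R \<Longrightarrow> E' w = E w"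
proof -
  \<comment> \<open>extensions live on discs of radius \<open>4\<eta>\<close> but are used only on discs of radius \<open>2\<eta>\<close>: if two of the
     latter meet, the centre of one lies in both of the former\<close>
  define \<eta> where "\<eta> = \<kappa> / 4 * (1 - R)"
  have \<eta>: "\<eta> > 0" "R + \<eta> \<le> 1"
  proof -
    show "\<eta> > 0" using \<kappa> R by (simp add: \<eta>_def)
    have "\<eta> \<le> 1 * (1 - R)" unfolding \<eta>_def using \<kappa> R by (intro mult_right_mono) auto
    then show "R + \<eta> \<le> 1" by simp
  qed
  have "\<exists>F. \<forall>z\<in>ball 0 R. local_isometry A \<rho> (ball z (4 * \<eta>)) (F z) \<and>
     (\<exists>\<delta>>0. ball z \<delta> \<subseteq> ball 0 R \<inter> ball z (4 * \<eta>) \<and> (\<forall>w\<in>ball z \<delta>. F z w = E w))"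
  proof (rule bchoice, rule ballI)
    fix z :: complex assume z: "z \<in> ball 0 R"
    obtain F \<delta> where F: "local_isometry A \<rho> (ball z (\<kappa> * (1 - cmod z))) F" "\<delta> > 0"
         "ball z \<delta> \<subseteq> ball 0 R \<inter> ball z (\<kappa> * (1 - cmod z))" "\<forall>w\<in>ball z \<delta>. F w = E w"
      using ex[OF E z] unfolding extendable_def by (elim exE conjE)
    have "\<kappa> * (1 - R) \<le> \<kappa> * (1 - cmod z)" using z \<kappa> by (intro mult_left_mono) auto
    then have le: "4 * \<eta> \<le> \<kappa> * (1 - cmod z)" by (simp add: \<eta>_def)
    show "\<exists>F. local_isometry A \<rho> (ball z (4 * \<eta>)) F \<and>
     (\<exists>\<delta>>0. ball z \<delta> \<subseteq> ball 0 R \<inter> ball z (4 * \<eta>) \<and> (\<forall>w\<in>ball z \<delta>. F w = E w))"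
    proof (intro exI conjI ballI)
      show "local_isometry A \<rho> (ball z (4 * \<eta>)) F"
        by (rule local_isometry_subset[OF F(1) open_ball subset_ball[OF le]])
      show "min \<delta> (4 * \<eta>) > 0" using F(2) \<eta>(1) by simp
      show "ball z (min \<delta> (4 * \<eta>)) \<subseteq> ball 0 R \<inter> ball z (4 * \<eta>)" using F(3) by auto
      fix w assume "w \<in> ball z (min \<delta> (4 * \<eta>))"
      then have "w \<in> ball z \<delta>" by simp
      with F(4) show "F w = E w" by (rule bspec)
    qed
  qed
  then obtain F where F: "\<And>z. z \<in> ball 0 R \<Longrightarrow> local_isometry A \<rho> (ball z (4 * \<eta>)) (F z)"
    and FE: "\<And>z. z \<in> ball 0 R \<Longrightarrow> \<exists>\<delta>>0. ball z \<delta> \<subseteq> ball 0 R \<inter> ball z (4 * \<eta>) \<and> (\<forall>w\<in>ball z \<delta>. F z w = E w)"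
    by (elim exE) (rule that, (drule (1) bspec, elim conjE, assumption)+)
  have agree: "F z w = E w" if z: "z \<in> ball 0 R" and w: "w \<in> ball 0 R \<inter> ball z (4 * \<eta>)" for z w
  proof -
    obtain \<delta> where \<delta>: "\<delta> > 0" "ball z \<delta> \<subseteq> ball 0 R \<inter> ball z (4 * \<eta>)" "\<forall>w\<in>ball z \<delta>. F z w = E w"
      using FE[OF z] by (elim exE conjE)
    show ?thesis
    proof (rule local_isometry_identity[OF _ _ _ open_ball _ \<delta>(2) _ w])
      show "local_isometry A \<rho> (ball 0 R \<inter> ball z (4 * \<eta>)) (F z)"
        by (rule local_isometry_subset[OF F[OF z]]) auto
      show "local_isometry A \<rho> (ball 0 R \<inter> ball z (4 * \<eta>)) E"
        by (rule local_isometry_subset[OF E]) auto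
      show "connected (ball 0 R \<inter> ball z (4 * \<eta>))"
        by (intro convex_connected convex_Int convex_ball)
      show "ball z \<delta> \<noteq> {}" using \<delta>(1) by simp
    qed (use \<delta>(3) in simp)
  qed
  have agree2: "F z w = F z' w" if z: "z \<in> ball 0 R" "z' \<in> ball 0 R" and w: "w \<in> ball z (2 * \<eta>)" "w \<in> ball z' (2 * \<eta>)" for z z' w
  proof -
    let ?I = "ball z (4 * \<eta>) \<inter> ball z' (4 * \<eta>)"
    have "dist z z' < 4 * \<eta>" using dist_triangle2[of z z' w] w by simp
    then have "z' \<in> ball 0 R \<inter> ?I" using z \<eta> by simp
    then have ne: "ball 0 R \<inter> ?I \<noteq> {}" by blast
    have wI: "w \<in> ?I" using w \<eta> by simp
    show ?thesis
    proof (rule local_isometry_identity[OF _ _ _ _ ne _ _ wI])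
      show "local_isometry A \<rho> ?I (F z)" by (rule local_isometry_subset[OF F[OF z(1)]]) auto
      show "local_isometry A \<rho> ?I (F z')" by (rule local_isometry_subset[OF F[OF z(2)]]) auto
      show "connected ?I" by (intro convex_connected convex_Int convex_ball)
      show "open (ball 0 R \<inter> ?I)" by (intro open_Int open_ball)
      fix x assume "x \<in> ball 0 R \<inter> ?I"
      then show "F z x = F z' x" using agree[OF z(1), of x] agree[OF z(2), of x] by simp
    qed (rule Int_lower2)
  qed
  have near: "\<exists>z. z \<in> ball 0 R \<and> w \<in> ball z (2 * \<eta>)" if w: "w \<in> ball 0 (R + \<eta>)" for w :: complex
  proof (cases "cmod w < 2 * \<eta>")
    case True
    then show ?thesis using R by (intro exI[of _ 0]) simp
  next
    case False
    then have w0: "cmod w > 0" using \<eta> by linarith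
    define z where "z = of_real (1 - \<eta> / cmod w) * w"
    have p: "0 \<le> 1 - \<eta> / cmod w" using False w0 \<eta> by (simp add: divide_le_eq)
    have "cmod z = (1 - \<eta> / cmod w) * cmod w" unfolding z_def norm_mult norm_of_real using p by simp
    also have "\<dots> = cmod w - \<eta>" using w0 by (simp add: field_simps)
    finally have "z \<in> ball 0 R" using w by simp
    moreover have "z - w = - of_real (\<eta> / cmod w) * w" by (simp add: z_def algebra_simps)
    then have "cmod (z - w) = \<eta>" using w0 \<eta> by (simp add: norm_mult norm_divide)
    then have "w \<in> ball z (2 * \<eta>)" using \<eta> by (simp add: dist_norm)
    ultimately show ?thesis by blast
  qed
  define s where "s w = (SOME z. z \<in> ball 0 R \<and> w \<in> ball z (2 * \<eta>))" for w :: complex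
  have s: "s w \<in> ball 0 R" "w \<in> ball (s w) (2 * \<eta>)" if "w \<in> ball 0 (R + \<eta>)" for w :: complex
    using someI_ex[OF near[OF that]] unfolding s_def by auto
  define E' where "E' w = F (s w) w" for w
  have E'E: "E' w = E w" if "w \<in> ball 0 R" for w
  proof -
    have "w \<in> ball 0 (R + \<eta>)" using that \<eta> by simp
    from s[OF this] show ?thesis unfolding E'_def using that \<eta> by (intro agree) simp_all
  qed
  have "local_isometry A \<rho> (ball 0 (R + \<eta>)) E'"
  proof (rule local_isometry_local[OF open_ball])
    show "ball 0 (R + \<eta>) \<subseteq> ball (0::complex) 1" using \<eta>(2) by (rule subset_ball)
    fix w :: complex assume w: "w \<in> ball 0 (R + \<eta>)"
    let ?N = "ball (s w) (2 * \<eta>) \<inter> ball 0 (R + \<eta>)"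
    have "local_isometry A \<rho> ?N (F (s w))"
      by (rule local_isometry_subset[OF F[OF s(1)[OF w]]]) (use \<eta> in auto)
    moreover have "F (s w) x = E' x" if x: "x \<in> ?N" for x
      unfolding E'_def using agree2[OF s(1)[OF w] s(1)] s(2) x by auto
    ultimately show "\<exists>N F. open N \<and> w \<in> N \<and> local_isometry A \<rho> N F \<and> (\<forall>x\<in>N. F x = E' x)"
      using s(2)[OF w] w by (intro exI[of _ ?N] exI[of _ "F (s w)"] conjI ballI open_Int open_ball IntI)
  qed
  then show ?thesis unfolding \<eta>_def using E'E by (rule that)
qed

text \<open>
  Each extension step shrinks the defect \<open>1 - R\<close> of the radius by a fixed factor, so the discs
  exhaust the unit disc; any two of the extensions agree where both are defined.
\<close>

theorem developing_map:
  assumes c: "c \<in> A" "p \<in> cdom c" and d: "\<rho> c (coord c p) * cmod d = 2"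
  obtains E where "local_isometry A \<rho> (ball 0 1) E" "E 0 = p" "deriv (coord c \<circ> E) 0 = d"
proof -
  obtain \<kappa> where \<kappa>: "0 < \<kappa>" "\<kappa> \<le> (1::real)"
    and ex: "\<And>E U z0. local_isometry A \<rho> U E \<Longrightarrow> z0 \<in> U \<Longrightarrow> extendable A \<rho> \<kappa> U E z0"
    by (rule extension_uniform) (rule that)
  obtain G \<epsilon> c' where e: "0 < \<epsilon>" and G: "local_isometry A \<rho> (ball 0 \<epsilon>) G" "G 0 = p"
    by (rule local_isometry_exists[of p])
  define \<epsilon>' where "\<epsilon>' = min \<epsilon> (1/2)"
  have e': "\<epsilon>' > 0" "\<epsilon>' \<le> \<epsilon>" "\<epsilon>' < 1" using e by (auto simp: \<epsilon>'_def)
  have z0: "0 \<in> ball (0::complex) \<epsilon>" "0 \<in> ball (0::complex) \<epsilon>'" using e e' by auto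
  have Gc: "G 0 \<in> cdom c" using G c by simp
  define d' where "d' = deriv (coord c \<circ> G) 0"
  have d': "\<rho> c (coord c p) * cmod d' = 2"
    using local_isometry_derivative(2)[OF G(1) z0(1) c(1) Gc] G(2) by (simp add: d'_def)
  have dd: "cmod d = cmod d'" "d' \<noteq> 0" using d d' by (metis mult_cancel_left mult_zero_left zero_neq_numeral) (use d' in auto)
  define \<alpha> where "\<alpha> = d / d'"
  have \<alpha>: "cmod \<alpha> = 1" using dd by (simp add: \<alpha>_def norm_divide)
  define E0 where "E0 = G \<circ> (\<lambda>z. \<alpha> * z)"
  have D: "((\<lambda>z. \<alpha> * z) has_field_derivative \<alpha>) (at z)" for z by (auto intro!: derivative_eq_intros)
  have sub: "ball 0 \<epsilon>' \<subseteq> ball (0::complex) 1" using e'(3) by (intro subset_ball) simp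
  have im: "(\<lambda>z. \<alpha> * z) ` ball 0 \<epsilon>' \<subseteq> ball 0 \<epsilon>" using \<alpha> e'(2) by (auto simp: norm_mult)
  have nn: "cmod \<alpha> * (1 - (cmod z)\<^sup>2) = 1 - (cmod (\<alpha> * z))\<^sup>2" for z by (simp add: \<alpha> norm_mult)
  note comp = local_isometry_compose[OF G(1) open_ball sub im D nn]
  have d\<alpha>: "d' * \<alpha> = d" using dd by (simp add: \<alpha>_def)
  have E0: "local_isometry A \<rho> (ball 0 \<epsilon>') E0"
    unfolding E0_def by (rule comp(1))
  have E00: "E0 0 = p" using G(2) by (simp add: E0_def)
  have dE0: "deriv (coord c \<circ> E0) 0 = d"
    unfolding E0_def by (subst comp(2)[OF z0(2) c(1)]) (use Gc d\<alpha> in \<open>simp_all add: d'_def[symmetric]\<close>)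
  define r where "r n = 1 - (1 - \<epsilon>') * (1 - \<kappa> / 4) ^ n" for n :: nat
  have q: "0 < 1 - \<kappa> / 4" "1 - \<kappa> / 4 < 1" using \<kappa> by auto
  have r: "0 < r n" "r n < 1" for n
  proof -
    have "(1 - \<kappa> / 4) ^ n \<le> 1" "0 < (1 - \<kappa> / 4) ^ n" using q by (auto intro: power_le_one)
    then have b: "(1 - \<epsilon>') * (1 - \<kappa> / 4) ^ n \<le> (1 - \<epsilon>') * 1" "0 < (1 - \<epsilon>') * (1 - \<kappa> / 4) ^ n"
      using e' by (auto intro!: mult_left_mono mult_pos_pos)
    define x where "x = (1 - \<epsilon>') * (1 - \<kappa> / 4) ^ n"
    have "x \<le> 1 - \<epsilon>'" "0 < x" using b by (simp_all only: x_def mult_1_right)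
    then show "0 < r n" "r n < 1" using e' by (simp_all add: r_def x_def[symmetric])
  qed
  have r_Suc: "r (Suc n) = r n + \<kappa> / 4 * (1 - r n)" for n by (simp add: r_def field_simps)
  have le_r: "\<epsilon>' \<le> r n" for n
  proof (induction n)
    case (Suc n)
    have "0 \<le> \<kappa> / 4 * (1 - r n)" using \<kappa> r[of n] by simp
    then show ?case unfolding r_Suc using Suc by linarith
  qed (simp add: r_def)
  have "\<exists>E. local_isometry A \<rho> (ball 0 (r n)) E \<and> (\<forall>w\<in>ball 0 \<epsilon>'. E w = E0 w)" for n
  proof (induction n)
    case 0
    then show ?case using E0 by (intro exI[of _ E0]) (simp add: r_def)
  next
    case (Suc n)
    then obtain E where E: "local_isometry A \<rho> (ball 0 (r n)) E" "\<forall>w\<in>ball 0 \<epsilon>'. E w = E0 w"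
      by (elim exE conjE)
    obtain E' where E': "local_isometry A \<rho> (ball 0 (r n + \<kappa> / 4 * (1 - r n))) E'"
        "\<And>w. w \<in> ball 0 (r n) \<Longrightarrow> E' w = E w"
      by (rule extension_step[OF E(1) r \<kappa> ex]; (assumption | rule that))
    show ?case
    proof (intro exI conjI ballI)
      show "local_isometry A \<rho> (ball 0 (r (Suc n))) E'" unfolding r_Suc by (rule E'(1))
      fix w :: complex assume w: "w \<in> ball 0 \<epsilon>'"
      then have "w \<in> ball 0 (r n)" using le_r[of n] by simp
      then show "E' w = E0 w" using E'(2) E(2) w by simp
    qed
  qed
  then obtain E where E: "\<And>n. local_isometry A \<rho> (ball 0 (r n)) (E n)" "\<And>n w. w \<in> ball 0 \<epsilon>' \<Longrightarrow> E n w = E0 w"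
    by metis
  have agree: "E n w = E m w" if w: "w \<in> ball 0 (r n)" "w \<in> ball 0 (r m)" for n m w
  proof (rule local_isometry_identity[where U = "ball 0 (r n) \<inter> ball 0 (r m)" and N = "ball 0 \<epsilon>'"])
    show "local_isometry A \<rho> (ball 0 (r n) \<inter> ball 0 (r m)) (E n)" by (rule local_isometry_subset[OF E(1)[of n]]) auto
    show "local_isometry A \<rho> (ball 0 (r n) \<inter> ball 0 (r m)) (E m)" by (rule local_isometry_subset[OF E(1)[of m]]) auto
    show "connected (ball (0::complex) (r n) \<inter> ball 0 (r m))" by (intro convex_connected convex_Int convex_ball)
    show "ball 0 \<epsilon>' \<subseteq> ball (0::complex) (r n) \<inter> ball 0 (r m)"
      using subset_ball[OF le_r[of n], of "0::complex"] subset_ball[OF le_r[of m], of "0::complex"] by (rule Int_greatest)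
    show "ball (0::complex) \<epsilon>' \<noteq> {}" using e' by simp
    fix z :: complex assume z: "z \<in> ball 0 \<epsilon>'"
    show "E n z = E m z" unfolding E(2)[OF z] ..
  qed (use w in auto)
  have cover: "\<exists>n. w \<in> ball 0 (r n)" if w: "w \<in> ball 0 1" for w :: complex
  proof -
    obtain n where n: "(1 - \<kappa> / 4) ^ n < 1 - cmod w"
      using real_arch_pow_inv[of "1 - cmod w" "1 - \<kappa> / 4"] w q by auto
    have "(1 - \<epsilon>') * (1 - \<kappa> / 4) ^ n \<le> 1 * (1 - \<kappa> / 4) ^ n"
      using e' q by (intro mult_right_mono) auto
    then have "cmod w < r n" using n by (simp add: r_def)
    then show ?thesis by auto
  qed
  define N where "N w = (SOME n. w \<in> ball 0 (r n))" for w :: complex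
  have N: "w \<in> ball 0 (r (N w))" if "w \<in> ball 0 1" for w
    unfolding N_def by (rule someI_ex[OF cover[OF that]])
  define D where "D w = E (N w) w" for w
  have DE: "D w = E n w" if "w \<in> ball 0 (r n)" for n w
  proof -
    have "w \<in> ball 0 1" using that r(2)[of n] by simp
    then show ?thesis unfolding D_def using that by (intro agree N)
  qed
  have "local_isometry A \<rho> (ball 0 1) D"
  proof (rule local_isometry_local[OF open_ball subset_refl])
    fix w :: complex assume w: "w \<in> ball 0 1"
    show "\<exists>M F. open M \<and> w \<in> M \<and> local_isometry A \<rho> M F \<and> (\<forall>x\<in>M. F x = D x)"
      by (intro exI[of _ "ball 0 (r (N w))"] exI[of _ "E (N w)"] conjI ballI open_ball N w E(1) DE[symmetric])
  qed
  moreover have D0: "D z = E0 z" if "z \<in> ball 0 \<epsilon>'" for z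
  proof -
    have "z \<in> ball 0 (r 0)" using that by (simp add: r_def)
    then show ?thesis using DE[of z 0] E(2)[OF that, of 0] by simp
  qed
  moreover have "D 0 = p" using D0[OF z0(2)] E00 by simp
  moreover have "deriv (coord c \<circ> D) 0 = d"
  proof -
    have "((coord c \<circ> E0) has_field_derivative d) (at 0)"
      using local_isometry_derivative(1)[OF E0 z0(2) c(1)] c E00 dE0 by simp
    then have "((coord c \<circ> D) has_field_derivative d) (at 0)"
      by (rule has_field_derivative_transform_within_open[OF _ open_ball z0(2)]) (simp add: D0)
    then show ?thesis by (rule DERIV_imp_deriv)
  qed
  ultimately show ?thesis by (intro that)
qed

end

section \<open>Geodesics and the exponential map\<close>

lemma has_vector_derivative_tanh_ray:
  fixes u :: complex and s :: real
  shows "((\<lambda>t. of_real (tanh (s * t / 2)) * u) has_vector_derivative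
      of_real (s / 2 * (1 - (tanh (s * t / 2))\<^sup>2)) * u) (at t)"
    "((\<lambda>t. of_real (s / 2 * (1 - (tanh (s * t / 2))\<^sup>2)) * u) has_vector_derivative
      of_real (- (s\<^sup>2 / 2) * tanh (s * t / 2) * (1 - (tanh (s * t / 2))\<^sup>2)) * u) (at t)"
proof -
  have ch: "cosh x \<noteq> 0" for x :: real using cosh_real_pos[of x] by simp
  have d: "((\<lambda>t. tanh (s * t / 2)) has_real_derivative s / 2 * (1 - (tanh (s * t / 2))\<^sup>2)) (at t)"
    by (rule derivative_eq_intros ch refl | simp)+
  have d2: "((\<lambda>t. s / 2 * (1 - (tanh (s * t / 2))\<^sup>2)) has_real_derivative
      - (s\<^sup>2 / 2) * tanh (s * t / 2) * (1 - (tanh (s * t / 2))\<^sup>2)) (at t)"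
    by (rule derivative_eq_intros d refl)+ (simp add: power2_eq_square field_simps)
  have lift: "((\<lambda>t. of_real (f t) * u) has_vector_derivative of_real f' * u) (at t)"
    if "(f has_real_derivative f') (at t)" for f f'
    using has_vector_derivative_scaleR[OF that has_vector_derivative_const[of u]]
    by (simp add: scaleR_conv_of_real)
  show "((\<lambda>t. of_real (tanh (s * t / 2)) * u) has_vector_derivative
      of_real (s / 2 * (1 - (tanh (s * t / 2))\<^sup>2)) * u) (at t)"
    by (rule lift[OF d])
  show "((\<lambda>t. of_real (s / 2 * (1 - (tanh (s * t / 2))\<^sup>2)) * u) has_vector_derivative
      of_real (- (s\<^sup>2 / 2) * tanh (s * t / 2) * (1 - (tanh (s * t / 2))\<^sup>2)) * u) (at t)"
    by (rule lift[OF d2])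
qed

context riemann_surface_metric
begin

text \<open>Radial segments of the disc, run through with constant hyperbolic speed, develop to geodesics.\<close>

lemma geodesic_ray:
  fixes s :: real and u :: complex
  assumes E: "local_isometry A \<rho> (ball 0 1) E" and u: "cmod u = 1"
  defines "\<gamma> \<equiv> \<lambda>t. E (of_real (tanh (s * t / 2)) * u)"
  shows "geodesic A \<rho> \<gamma>"
    "\<And>c. c \<in> A \<Longrightarrow> E 0 \<in> cdom c \<Longrightarrow> vector_derivative (coord c \<circ> \<gamma>) (at 0) = of_real (s / 2) * u * deriv (coord c \<circ> E) 0"
proof -
  define z where "z t = of_real (tanh (s * t / 2)) * u" for t
  define z1 where "z1 t = of_real (s / 2 * (1 - (tanh (s * t / 2))\<^sup>2)) * u" for t
  have zb: "z t \<in> ball 0 1" for t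
    using tanh_real_bounds[of "s * t / 2"] u by (auto simp: z_def norm_mult abs_less_iff)
  note dz = has_vector_derivative_tanh_ray[where u=u and s=s, folded z_def z1_def]
  have zc: "continuous_on UNIV z"
    by (rule continuous_on_vector_derivative[of _ _ z1]) (rule dz(1))
  have \<gamma>z: "\<gamma> = E \<circ> z" by (simp add: fun_eq_iff \<gamma>_def z_def)
  have \<gamma>c: "continuous_on UNIV \<gamma>"
    unfolding \<gamma>z using zb by (intro continuous_on_compose[OF zc] continuous_on_subset[OF local_isometryD(3)[OF E]]) auto
  have d1: "((coord c \<circ> \<gamma>) has_vector_derivative z1 t * deriv (coord c \<circ> E) (z t)) (at t)"
    if c: "c \<in> A" "\<gamma> t \<in> cdom c" for c t
  proof -
    have "E (z t) \<in> cdom c" using c(2) by (simp add: \<gamma>z)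
    from field_vector_diff_chain_at[OF dz(1)[of t] local_isometry_derivative(1)[OF E zb c(1) this]]
    show ?thesis unfolding \<gamma>z o_assoc .
  qed
  have d2: "((\<lambda>s. vector_derivative (coord c \<circ> \<gamma>) (at s)) has_vector_derivative
           - (christoffel (\<rho> c) (coord c (\<gamma> t)) * (vector_derivative (coord c \<circ> \<gamma>) (at t))\<^sup>2)) (at t)"
    if c: "c \<in> A" "\<gamma> t \<in> cdom c" for c t
  proof -
    have Ec: "E (z t) \<in> cdom c" using c(2) by (simp add: \<gamma>z)
    let ?g = "coord c \<circ> E"
    obtain \<delta> where \<delta>: "\<delta> > 0" "ball (z t) \<delta> \<subseteq> ball 0 1" "E ` ball (z t) \<delta> \<subseteq> cdom c"
      by (rule local_isometries_near[OF E zb c(1) Ec open_UNIV UNIV_I])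
    have h: "?g holomorphic_on ball (z t) \<delta>"
      by (rule local_isometry_holomorphic[OF E open_ball \<delta>(2) c(1) \<delta>(3)])
    have iso: "\<rho> c (?g w) * cmod (deriv ?g w) = 2 / (1 - (cmod w)\<^sup>2)" if w: "w \<in> ball (z t) \<delta>" for w
      unfolding o_apply[of "coord c" E w]
      by (rule local_isometry_derivative(2)[OF E subsetD[OF \<delta>(2) w] c(1) subsetD[OF \<delta>(3) imageI[OF w]]])
    have im: "?g ` ball (z t) \<delta> \<subseteq> coord c ` cdom c"
      unfolding image_comp[symmetric] by (rule image_mono[OF \<delta>(3)])
    have zt: "z t \<in> ball (z t) \<delta>" using \<delta>(1) by simp
    have g2: "deriv (deriv ?g) (z t) = deriv ?g (z t) * (disc_christoffel (z t) - christoffel (\<rho> c) (?g (z t)) * deriv ?g (z t))"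
      by (rule isometry_second_derivative[OF open_coord_image[OF c(1)] density_pos[OF c(1)] density_smooth[OF c(1)]
            open_ball \<delta>(2) h im iso zt])
    let ?T = "tanh (s * t / 2)"
    have zT: "(cmod (z t))\<^sup>2 = ?T\<^sup>2" using u by (simp add: z_def norm_mult)
    have uu: "cnj u * u = 1" using u by (metis complex_norm_square mult.commute of_real_1 one_power2)
    have Tn: "1 - ?T\<^sup>2 \<noteq> 0" using zb[of t] zT by (metis abs_norm_cancel abs_square_less_1 diff_gt_0_iff_gt dist_0_norm less_irrefl mem_ball)
    have zz: "of_real (- (s\<^sup>2 / 2) * ?T * (1 - ?T\<^sup>2)) * u = - disc_christoffel (z t) * (z1 t)\<^sup>2"
    proof -
      have gen: "of_real a * cnj (of_real b * u) * (of_real e * u)\<^sup>2 = of_real (a * b * e\<^sup>2) * (cnj u * u) * u" for a b e :: real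
        by (simp add: power2_eq_square algebra_simps)
      have "disc_christoffel (z t) * (z1 t)\<^sup>2 = of_real (2 / (1 - ?T\<^sup>2) * ?T * (s / 2 * (1 - ?T\<^sup>2))\<^sup>2) * (cnj u * u) * u"
        unfolding disc_christoffel_def zT unfolding z_def z1_def by (rule gen)
      also have "2 / (1 - ?T\<^sup>2) * ?T * (s / 2 * (1 - ?T\<^sup>2))\<^sup>2 = s\<^sup>2 / 2 * ?T * (1 - ?T\<^sup>2)"
        using Tn by (simp add: power2_eq_square field_simps)
      finally show ?thesis unfolding uu by simp
    qed
    have N: "open (z -` ball (z t) \<delta>)" using continuous_on_open_vimage[OF open_UNIV, of z] zc by simp
    have tN: "t \<in> z -` ball (z t) \<delta>" using zt by simp
    have vd: "vector_derivative (coord c \<circ> \<gamma>) (at r) = z1 r * deriv ?g (z r)" if "r \<in> z -` ball (z t) \<delta>" for r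
    proof -
      have "E (z r) \<in> cdom c" using \<delta>(3) that by blast
      then show ?thesis by (intro vector_derivative_at d1[OF c(1)]) (simp add: \<gamma>z)
    qed
    have dg: "((deriv ?g \<circ> z) has_vector_derivative z1 t * deriv (deriv ?g) (z t)) (at t)"
      by (rule field_vector_diff_chain_at[OF dz(1) holomorphic_derivI[OF holomorphic_deriv[OF h open_ball] open_ball zt]])
    have "((\<lambda>r. z1 r * (deriv ?g \<circ> z) r) has_vector_derivative
        z1 t * (z1 t * deriv (deriv ?g) (z t)) + (of_real (- (s\<^sup>2 / 2) * ?T * (1 - ?T\<^sup>2)) * u) * (deriv ?g \<circ> z) t) (at t)"
      by (rule has_vector_derivative_mult[OF dz(2) dg])
    also have "z1 t * (z1 t * deriv (deriv ?g) (z t)) + (of_real (- (s\<^sup>2 / 2) * ?T * (1 - ?T\<^sup>2)) * u) * (deriv ?g \<circ> z) t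
        = - (christoffel (\<rho> c) (coord c (\<gamma> t)) * (vector_derivative (coord c \<circ> \<gamma>) (at t))\<^sup>2)"
      unfolding zz g2 vd[OF tN] by (simp add: \<gamma>z algebra_simps power2_eq_square)
    finally show ?thesis
      by (rule has_vector_derivative_transform_within_open[OF _ N tN]) (simp only: vd o_apply[of "deriv ?g" z])
  qed
  show "geodesic A \<rho> \<gamma>"
    unfolding geodesic_def using \<gamma>c d1 d2 by (auto simp: has_vector_derivative_def differentiable_def)
  have "z 0 = 0" "z1 0 = of_real (s / 2) * u" by (simp_all add: z_def z1_def)
  then show "vector_derivative (coord c \<circ> \<gamma>) (at 0) = of_real (s / 2) * u * deriv (coord c \<circ> E) 0"
    if "c \<in> A" "E 0 \<in> cdom c" for c
    using vector_derivative_at[OF d1[OF that(1), of 0]] that(2) by (simp add: \<gamma>z)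
qed

lemma geodesicD:
  assumes "geodesic A \<rho> \<gamma>" "c \<in> A" "\<gamma> t \<in> cdom c"
  shows "(coord c \<circ> \<gamma>) differentiable (at t)"
    "((\<lambda>s. vector_derivative (coord c \<circ> \<gamma>) (at s)) has_vector_derivative
       - (christoffel (\<rho> c) (coord c (\<gamma> t)) * (vector_derivative (coord c \<circ> \<gamma>) (at t))\<^sup>2)) (at t)"
  using assms unfolding geodesic_def by blast+

text \<open>
  \<^const>\<open>exp_map\<close> is a definite description, so geodesics with given initial velocity have to be shown
  unique before it can be evaluated. Both directions of time are covered by the factor \<open>\<sigma>\<close>.
\<close>

lemma geodesic_germ_unique:
  assumes g: "geodesic A \<rho> \<gamma>" "geodesic A \<rho> \<gamma>'" and c: "c \<in> A" "\<gamma> t0 \<in> cdom c"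
    and init: "\<gamma> t0 = \<gamma>' t0" "vector_derivative (coord c \<circ> \<gamma>) (at t0) = vector_derivative (coord c \<circ> \<gamma>') (at t0)"
  shows "\<exists>\<delta>>0. \<forall>t. \<bar>t - t0\<bar> < \<delta> \<longrightarrow> \<gamma> t = \<gamma>' t"
proof -
  let ?S = "coord c ` cdom c" and ?p = "coord c (\<gamma> t0)"
  obtain r where r: "r > 0" "cball ?p r \<subseteq> ?S" using open_coord_image[OF c(1)] c(2) open_contains_cball by blast
  have o: "open (cdom c \<inter> coord c -` ball ?p r)"
    by (rule continuous_open_preimage[OF continuous_coord[OF c(1)] open_cdom[OF c(1)] open_ball])
  have cont: "continuous_on UNIV \<gamma>" "continuous_on UNIV \<gamma>'" using g by (simp_all add: geodesic_def)
  have "open (\<gamma> -` (cdom c \<inter> coord c -` ball ?p r) \<inter> \<gamma>' -` (cdom c \<inter> coord c -` ball ?p r))"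
    by (rule open_Int[OF open_vimage[OF o cont(1)] open_vimage[OF o cont(2)]])
  moreover have "t0 \<in> \<gamma> -` (cdom c \<inter> coord c -` ball ?p r) \<inter> \<gamma>' -` (cdom c \<inter> coord c -` ball ?p r)"
    using c(2) r(1) init(1) by simp
  ultimately obtain e where e: "e > 0" "ball t0 e \<subseteq> \<gamma> -` (cdom c \<inter> coord c -` ball ?p r) \<inter> \<gamma>' -` (cdom c \<inter> coord c -` ball ?p r)"
    by (rule openE)
  have near: "\<beta> t \<in> cdom c" "coord c (\<beta> t) \<in> cball ?p r" if "\<bar>t - t0\<bar> < e" "\<beta> = \<gamma> \<or> \<beta> = \<gamma>'" for \<beta> t
  proof -
    have "t \<in> ball t0 e" using that(1) by (simp add: dist_real_def abs_minus_commute)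
    from subsetD[OF e(2) this] that(2) show "\<beta> t \<in> cdom c" "coord c (\<beta> t) \<in> cball ?p r" by auto
  qed
  have one_side: "coord c (\<gamma> (t0 + \<sigma> * T)) = coord c (\<gamma>' (t0 + \<sigma> * T))" if \<sigma>: "\<bar>\<sigma>\<bar> = 1" and T: "0 \<le> T" "T < e" for \<sigma> T
  proof -
    let ?v = "\<lambda>\<beta> t. vector_derivative (coord c \<circ> \<beta>) (at t)"
    have ab: "\<bar>t0 + \<sigma> * t - t0\<bar> < e" if "t \<in> {0..T}" for t using that T \<sigma> by (simp add: abs_mult)
    have lin: "((\<lambda>t. t0 + \<sigma> * t) has_vector_derivative \<sigma>) (at t within {0..T})" for t
      by (auto intro!: derivative_eq_intros simp: has_vector_derivative_def)
    have D: "((\<lambda>t. coord c (\<beta> (t0 + \<sigma> * t))) has_vector_derivative of_real \<sigma> * ?v \<beta> (t0 + \<sigma> * t)) (at t within {0..T})"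
       "((\<lambda>t. ?v \<beta> (t0 + \<sigma> * t)) has_vector_derivative of_real \<sigma> * (0 * ?v \<beta> (t0 + \<sigma> * t)
          - christoffel (\<rho> c) (coord c (\<beta> (t0 + \<sigma> * t))) * (?v \<beta> (t0 + \<sigma> * t))\<^sup>2)) (at t within {0..T})"
      if t: "t \<in> {0..T}" and \<beta>: "\<beta> = \<gamma> \<or> \<beta> = \<gamma>'" for \<beta> t
    proof -
      have gb: "geodesic A \<rho> \<beta>" using g \<beta> by auto
      have b: "(coord c \<circ> \<beta>) differentiable (at (t0 + \<sigma> * t))"
         "((\<lambda>s. ?v \<beta> s) has_vector_derivative
           - (christoffel (\<rho> c) (coord c (\<beta> (t0 + \<sigma> * t))) * (?v \<beta> (t0 + \<sigma> * t))\<^sup>2)) (at (t0 + \<sigma> * t))"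
        by (rule geodesicD[OF gb c(1) near(1)[OF ab[OF t] \<beta>]])+
      have b1: "((coord c \<circ> \<beta>) has_vector_derivative ?v \<beta> (t0 + \<sigma> * t)) (at (t0 + \<sigma> * t))"
        using b(1) by (simp add: vector_derivative_works)
      from vector_diff_chain_within[OF lin has_vector_derivative_at_within[OF b1]]
      show "((\<lambda>t. coord c (\<beta> (t0 + \<sigma> * t))) has_vector_derivative of_real \<sigma> * ?v \<beta> (t0 + \<sigma> * t)) (at t within {0..T})"
        by (simp add: o_def scaleR_conv_of_real)
      from vector_diff_chain_within[OF lin has_vector_derivative_at_within[OF b(2)]]
      show "((\<lambda>t. ?v \<beta> (t0 + \<sigma> * t)) has_vector_derivative of_real \<sigma> * (0 * ?v \<beta> (t0 + \<sigma> * t)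
          - christoffel (\<rho> c) (coord c (\<beta> (t0 + \<sigma> * t))) * (?v \<beta> (t0 + \<sigma> * t))\<^sup>2)) (at t within {0..T})"
        by (simp add: o_def scaleR_conv_of_real)
    qed
    have p: "coord c (\<beta> (t0 + \<sigma> * t)) \<in> cball ?p r" if "t \<in> {0..T}" "\<beta> = \<gamma> \<or> \<beta> = \<gamma>'" for \<beta> t
      by (rule near(2)[OF ab[OF that(1)] that(2)])
    have "\<forall>t\<in>{0..T}. coord c (\<gamma> (t0 + \<sigma> * t)) = coord c (\<gamma>' (t0 + \<sigma> * t)) \<and> ?v \<gamma> (t0 + \<sigma> * t) = ?v \<gamma>' (t0 + \<sigma> * t)"
      by (rule second_order_unique[where a = "of_real \<sigma>", OF T(1) christoffel_C_on[OF open_coord_image[OF c(1)] density_pos[OF c(1)] density_smooth[OF c(1)]]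
            r(2) continuous_on_const D D p p]) (simp_all add: init)
    then show ?thesis using T(1) by simp
  qed
  have "\<gamma> t = \<gamma>' t" if t: "\<bar>t - t0\<bar> < e" for t
  proof -
    have "coord c (\<gamma> t) = coord c (\<gamma>' t)"
      using one_side[of 1 "t - t0"] one_side[of "-1" "t0 - t"] t by (cases "t0 \<le> t") auto
    then have "cinv c (coord c (\<gamma> t)) = cinv c (coord c (\<gamma>' t))" by simp
    then show ?thesis using cinv_coord[OF c(1)] near(1)[OF t] by simp
  qed
  then show ?thesis using e(1) by blast
qed

text \<open>
  The interior of the set of times of agreement is closed: at a limit time positions and velocities
  agree by continuity, and the local uniqueness applies there.
\<close>

lemma geodesic_unique:
  assumes g: "geodesic A \<rho> \<gamma>" "geodesic A \<rho> \<gamma>'" and init: "\<gamma> 0 = \<gamma>' 0" "velocity A \<gamma> 0 = velocity A \<gamma>' 0"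
  shows "\<gamma> = \<gamma>'"
proof -
  have cont: "continuous_on UNIV \<gamma>" "continuous_on UNIV \<gamma>'" using g by (simp_all add: geodesic_def)
  define W where "W = {t. \<gamma> t = \<gamma>' t}"
  define V where "V = interior W"
  have Wc: "closed W" unfolding W_def by (rule closed_Collect_eq[OF cont])
  have germ: "t \<in> V" if jet: "c \<in> A" "\<gamma> t \<in> cdom c" "\<gamma> t = \<gamma>' t"
    "vector_derivative (coord c \<circ> \<gamma>) (at t) = vector_derivative (coord c \<circ> \<gamma>') (at t)" for c t
  proof -
    obtain \<delta> where \<delta>: "\<delta> > 0" "\<forall>s. \<bar>s - t\<bar> < \<delta> \<longrightarrow> \<gamma> s = \<gamma>' s"
      using geodesic_germ_unique[OF g jet] by (elim exE conjE)
    have "ball t \<delta> \<subseteq> W" using \<delta>(2) by (auto simp: W_def dist_real_def abs_minus_commute)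
    then have "ball t \<delta> \<subseteq> V" unfolding V_def by (rule interior_maximal) simp
    then show ?thesis using \<delta>(1) by auto
  qed
  have "0 \<in> V"
  proof (rule germ[OF chart_at_props[of "\<gamma> 0"] init(1)])
    have "velocity A \<gamma> 0 (chart_at A (\<gamma> 0)) = velocity A \<gamma>' 0 (chart_at A (\<gamma> 0))" by (simp add: init(2))
    then show "vector_derivative (coord (chart_at A (\<gamma> 0)) \<circ> \<gamma>) (at 0) = vector_derivative (coord (chart_at A (\<gamma> 0)) \<circ> \<gamma>') (at 0)"
      using chart_at_props[of "\<gamma> 0"] init(1) by (simp add: velocity_def)
  qed
  moreover have "closed V"
  proof -
    have "t \<in> V" if t: "t \<in> closure V" for t
    proof -
      have "t \<in> W" using t closure_mono[OF interior_subset[of W]] Wc by (auto simp: V_def)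
      then have eq: "\<gamma> t = \<gamma>' t" by (simp add: W_def)
      define c where "c = chart_at A (\<gamma> t)"
      have c: "c \<in> A" "\<gamma> t \<in> cdom c" unfolding c_def by (rule chart_at_props)+
      let ?v = "\<lambda>\<beta> t. vector_derivative (coord c \<circ> \<beta>) (at t)"
      have iv: "isCont (?v \<gamma>) t" "isCont (?v \<gamma>') t"
        using geodesicD(2)[OF g(1) c] geodesicD(2)[OF g(2) c(1), of t] c(2) eq
        by (simp_all add: has_vector_derivative_continuous)
      have "?v \<gamma> t = ?v \<gamma>' t"
      proof (rule ccontr)
        assume "\<not> ?thesis"
        then have n: "?v \<gamma> t - ?v \<gamma>' t \<noteq> 0" by simp
        have "isCont (\<lambda>s. ?v \<gamma> s - ?v \<gamma>' s) t" by (rule continuous_diff[OF iv])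
        from continuous_at_avoid[OF this n] obtain e where e: "e > 0" "\<forall>s. dist t s < e \<longrightarrow> ?v \<gamma> s - ?v \<gamma>' s \<noteq> 0"
          by (elim exE conjE)
        obtain s where s: "s \<in> V" "dist s t < e" using closure_approachable t e(1) by metis
        have eqV: "\<gamma> x = \<gamma>' x" if "x \<in> V" for x
          using subsetD[OF interior_subset[of W]] that by (simp add: V_def W_def)
        have "((coord c \<circ> \<gamma>) has_vector_derivative d) (at s) \<longleftrightarrow> ((coord c \<circ> \<gamma>') has_vector_derivative d) (at s)" for d
          using has_vector_derivative_transform_within_open[of "coord c \<circ> \<gamma>" d s V "coord c \<circ> \<gamma>'"]
            has_vector_derivative_transform_within_open[of "coord c \<circ> \<gamma>'" d s V "coord c \<circ> \<gamma>"] s(1) eqV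
          by (auto simp: V_def)
        then have "?v \<gamma> s = ?v \<gamma>' s" by (simp add: vector_derivative_def)
        then show False using e(2) s(2) by (simp add: dist_commute)
      qed
      then show ?thesis by (rule germ[OF c eq])
    qed
    then have "closure V \<subseteq> V" by blast
    then show ?thesis by (simp add: closure_subset_eq)
  qed
  ultimately have "V = UNIV" using clopen[of V] by (auto simp: V_def)
  then have "W = UNIV" using interior_subset[of W] by (auto simp: V_def)
  then show ?thesis unfolding W_def by (intro ext) blast
qed

end

context compact_hyperbolic_surface
begin

text \<open>
  Prescribing the derivative of the developing map at the centre turns the radii of the disc into the
  geodesics from \<open>p\<close>, and \<open>tanh (s/2)\<close> is the Euclidean radius at hyperbolic distance \<open>s\<close>. The frame need
  not be positively oriented for the complex structure, hence the sign \<open>\<epsilon>\<close>.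
\<close>

theorem geodesic_circle_developed:
  assumes fr: "orthonormal_frame A \<rho> p u1 u2"
  obtains E \<epsilon> where "local_isometry A \<rho> (ball 0 1) E" "\<epsilon> = 1 \<or> \<epsilon> = (-1 :: real)"
    "\<And>r \<theta>. geodesic_circle A \<rho> p u1 u2 r \<theta> = E (of_real (tanh (r / 2)) * cis (\<epsilon> * (2 * pi * \<theta>)))"
proof -
  define d where "d = chart_at A p"
  have d: "d \<in> A" "p \<in> cdom d" unfolding d_def by (rule chart_at_props)+
  have ts: "u1 \<in> tangent_space A p" "u2 \<in> tangent_space A p" using fr by (auto simp: orthonormal_frame_def)
  have rp: "\<rho> d (coord d p) > 0" using density_pos[OF d(1)] d(2) by simp
  have ri: "riem_inner A \<rho> p u w = (\<rho> d (coord d p))\<^sup>2 * (u d \<bullet> w d)" for u w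
    by (simp only: riem_inner_def Let_def d_def)
  note fr1 = fr[unfolded orthonormal_frame_def, THEN conjunct2, THEN conjunct2]
  note fr' = fr1[THEN conjunct1] fr1[THEN conjunct2, THEN conjunct1] fr1[THEN conjunct2, THEN conjunct2]
  note o = fr'(1,2)[unfolded ri]
  have o3: "u1 d \<bullet> u2 d = 0" using fr'(3)[unfolded ri] rp by simp
  have n1: "\<rho> d (coord d p) * cmod (u1 d) = 1"
  proof (rule power2_eq_imp_eq)
    show "(\<rho> d (coord d p) * cmod (u1 d))\<^sup>2 = 1\<^sup>2"
      unfolding power_mult_distrib using o(1) by (simp only: dot_square_norm power_one)
  qed (use rp in simp_all)
  have "(\<rho> d (coord d p))\<^sup>2 \<noteq> 0" using rp by simp
  moreover have "(\<rho> d (coord d p))\<^sup>2 * (u2 d \<bullet> u2 d) = (\<rho> d (coord d p))\<^sup>2 * (u1 d \<bullet> u1 d)"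
    unfolding o(1,2) ..
  ultimately have "u2 d \<bullet> u2 d = u1 d \<bullet> u1 d" by (rule mult_left_cancel[THEN iffD1])
  then have n2: "cmod (u2 d) = cmod (u1 d)" by (simp add: norm_eq_sqrt_inner)
  have u10: "u1 d \<noteq> 0" using n1 by auto
  define q where "q = u2 d / u1 d"
  have u2q: "u2 d = q * u1 d" using u10 by (simp add: q_def)
  have "Re q * (u1 d \<bullet> u1 d) = 0" using o3 unfolding u2q
    by (simp add: inner_complex_def algebra_simps)
  then have Rq: "Re q = 0" using u10 by simp
  have "cmod q = 1" using n2 u10 by (simp add: q_def norm_divide)
  then have "\<bar>Im q\<bar> = 1" using Rq by (simp add: cmod_def)
  then have Iq: "Im q = 1 \<or> Im q = -1" by linarith
  define \<epsilon> where "\<epsilon> = Im q"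
  have \<epsilon>: "\<epsilon> = 1 \<or> \<epsilon> = -1" using Iq by (simp add: \<epsilon>_def)
  have qe: "q = \<i> * of_real \<epsilon>" using Rq by (simp add: complex_eq_iff \<epsilon>_def)
  have u2: "u2 c = \<i> * of_real \<epsilon> * u1 c" for c
  proof (cases "c \<in> A \<and> p \<in> cdom c")
    case True
    then have "u1 c = deriv (transition d c) (coord d p) * u1 d" "u2 c = deriv (transition d c) (coord d p) * u2 d"
      using ts d unfolding tangent_space_def by blast+
    then show ?thesis unfolding u2q qe by simp
  next
    case False
    then have "u1 c = 0" "u2 c = 0" using ts unfolding tangent_space_def by blast+
    then show ?thesis by simp
  qed
  have "\<rho> d (coord d p) * cmod (2 * u1 d) = 2" using n1 by (simp add: norm_mult)
  then obtain E where E: "local_isometry A \<rho> (ball 0 1) E" "E 0 = p" "deriv (coord d \<circ> E) 0 = 2 * u1 d"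
    using developing_map[OF d] by metis
  have "geodesic_circle A \<rho> p u1 u2 r \<theta> = E (of_real (tanh (r / 2)) * cis (\<epsilon> * (2 * pi * \<theta>)))" for r \<theta>
  proof -
    define w where "w = cis (\<epsilon> * (2 * pi * \<theta>))"
    have w: "of_real (cos (2 * pi * \<theta>)) + \<i> * of_real \<epsilon> * of_real (sin (2 * pi * \<theta>)) = w"
      using \<epsilon> by (auto simp: w_def complex_eq_iff)
    have w1: "cmod w = 1" by (simp add: w_def)
    define u where "u = (\<lambda>c. r *\<^sub>R (cos (2 * pi * \<theta>) *\<^sub>R u1 c + sin (2 * pi * \<theta>) *\<^sub>R u2 c))"
    have u: "u c = of_real r * w * u1 c" for c
      unfolding u_def w[symmetric] u2 by (simp add: scaleR_conv_of_real algebra_simps)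
    define \<gamma> where "\<gamma> = (\<lambda>t. E (of_real (tanh (r * t / 2)) * w))"
    note ray = geodesic_ray[OF E(1) w1, where s=r, folded \<gamma>_def]
    have g0: "\<gamma> 0 = p" using E(2) by (simp add: \<gamma>_def)
    have dE: "deriv (coord c \<circ> E) 0 = 2 * u1 c" if c: "c \<in> A" "p \<in> cdom c" for c
    proof -
      have z: "(0::complex) \<in> ball 0 1" by simp
      have "((coord d \<circ> E) has_field_derivative 2 * u1 d) (at 0)"
        using local_isometry_derivative(1)[OF E(1) z d(1)] d(2) E by simp
      then have "((coord c \<circ> E) has_field_derivative deriv (transition d c) (coord d (E 0)) * (2 * u1 d)) (at 0)"
        by (rule chart_change_derivative[OF open_ball z local_isometryD(3)[OF E(1)] d(1) c(1), rotated 2]) (simp_all add: E(2) d c)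
      moreover have "u1 c = deriv (transition d c) (coord d p) * u1 d"
        using ts d c unfolding tangent_space_def by blast
      ultimately show ?thesis by (simp add: E(2) DERIV_imp_deriv)
    qed
    have v0: "velocity A \<gamma> 0 = u"
    proof
      fix c
      show "velocity A \<gamma> 0 c = u c"
      proof (cases "c \<in> A \<and> p \<in> cdom c")
        case True
        then show ?thesis using ray(2)[of c] dE[of c] by (simp add: velocity_def g0 E(2) u)
      next
        case False
        then have "u1 c = 0" using ts unfolding tangent_space_def by blast
        then show ?thesis using False by (auto simp: velocity_def g0 u)
      qed
    qed
    have "exp_map A \<rho> p u = \<gamma> 1"
      unfolding exp_map_def
    proof (rule the_equality)
      show "\<exists>\<gamma>'. geodesic A \<rho> \<gamma>' \<and> \<gamma>' 0 = p \<and> velocity A \<gamma>' 0 = u \<and> \<gamma> 1 = \<gamma>' 1"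
        using ray(1) g0 v0 by (intro exI[of _ \<gamma>]) simp
      fix x assume "\<exists>\<gamma>'. geodesic A \<rho> \<gamma>' \<and> \<gamma>' 0 = p \<and> velocity A \<gamma>' 0 = u \<and> x = \<gamma>' 1"
      then obtain \<gamma>' where g': "geodesic A \<rho> \<gamma>'" "\<gamma>' 0 = p" "velocity A \<gamma>' 0 = u" "x = \<gamma>' 1" by (elim exE conjE)
      have "\<gamma> = \<gamma>'" by (rule geodesic_unique[OF ray(1) g'(1)]) (simp_all add: g0 g' v0)
      then show "x = \<gamma> 1" using g'(4) by simp
    qed
    then show ?thesis by (simp add: geodesic_circle_def u_def \<gamma>_def w_def)
  qed
  with E(1) \<epsilon> show ?thesis by (rule that)
qed

text \<open>
  Rotations of the disc are isometries, so the speed of the developed circle does not depend on the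
  angle. For \<open>R = tanh (r/2)\<close> it is \<open>2 \<pi> sinh r\<close>.
\<close>

lemma line_integral_circle:
  assumes E: "local_isometry A \<rho> (ball 0 1) E" and R: "0 \<le> R" "R < 1" and \<epsilon>: "\<epsilon> = 1 \<or> \<epsilon> = (-1 :: real)"
  shows "line_integral A \<rho> (\<lambda>\<theta>. E (of_real R * cis (\<epsilon> * (2 * pi * \<theta>)))) f =
    (4 * pi * R / (1 - R\<^sup>2)) *\<^sub>R integral {0..1} (\<lambda>\<theta>. f (E (of_real R * cis (\<epsilon> * (2 * pi * \<theta>)))))"
proof -
  define \<alpha> where "\<alpha> = (\<lambda>\<theta>. E (of_real R * cis (\<epsilon> * (2 * pi * \<theta>))))"
  have "sqrt (riem_inner A \<rho> (\<alpha> \<theta>) (velocity A \<alpha> \<theta>) (velocity A \<alpha> \<theta>)) = 4 * pi * R / (1 - R\<^sup>2)" for \<theta>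
  proof -
    define c where "c = chart_at A (\<alpha> \<theta>)"
    have c: "c \<in> A" "\<alpha> \<theta> \<in> cdom c" unfolding c_def by (rule chart_at_props)+
    define z where "z = (\<lambda>\<theta>. of_real R * cis (\<epsilon> * (2 * pi * \<theta>)))"
    have nz: "cmod (z \<theta>) = R" using R by (simp add: z_def norm_mult)
    have zb: "z \<theta> \<in> ball 0 1" using nz R by simp
    have Ec: "E (z \<theta>) \<in> cdom c" using c(2) by (simp add: \<alpha>_def z_def)
    have dz: "(z has_vector_derivative of_real R * (of_real (\<epsilon> * (2 * pi)) * (\<i> * cis (\<epsilon> * (2 * pi * \<theta>))))) (at \<theta>)"
    proof -
      have "((\<lambda>\<theta>. \<i> * of_real (\<epsilon> * (2 * pi * \<theta>))) has_vector_derivative \<i> * of_real (\<epsilon> * (2 * pi))) (at \<theta>)"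
        by (auto intro!: derivative_eq_intros simp: has_vector_derivative_def scaleR_conv_of_real)
      from field_vector_diff_chain_at[OF this DERIV_exp]
      have "((\<lambda>\<theta>. cis (\<epsilon> * (2 * pi * \<theta>))) has_vector_derivative of_real (\<epsilon> * (2 * pi)) * (\<i> * cis (\<epsilon> * (2 * pi * \<theta>)))) (at \<theta>)"
        by (simp add: o_def cis_conv_exp mult_ac)
      then show ?thesis unfolding z_def by (rule has_vector_derivative_mult_right)
    qed
    have "((coord c \<circ> E \<circ> z) has_vector_derivative
        of_real R * (of_real (\<epsilon> * (2 * pi)) * (\<i> * cis (\<epsilon> * (2 * pi * \<theta>)))) * deriv (coord c \<circ> E) (z \<theta>)) (at \<theta>)"
      by (rule field_vector_diff_chain_at[OF dz local_isometry_derivative(1)[OF E zb c(1) Ec]])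
    then have v: "velocity A \<alpha> \<theta> c = of_real R * (of_real (\<epsilon> * (2 * pi)) * (\<i> * cis (\<epsilon> * (2 * pi * \<theta>)))) * deriv (coord c \<circ> E) (z \<theta>)"
      using c by (simp add: velocity_def \<alpha>_def z_def o_def vector_derivative_at)
    have "cmod (velocity A \<alpha> \<theta> c) = 2 * pi * R * cmod (deriv (coord c \<circ> E) (z \<theta>))"
      unfolding v using R \<epsilon> by (auto simp: norm_mult)
    then have "\<rho> c (coord c (\<alpha> \<theta>)) * cmod (velocity A \<alpha> \<theta> c) = 2 * pi * R * (\<rho> c (coord c (E (z \<theta>))) * cmod (deriv (coord c \<circ> E) (z \<theta>)))"
      by (simp add: \<alpha>_def z_def)
    also have "\<dots> = 4 * pi * R / (1 - R\<^sup>2)"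
      unfolding local_isometry_derivative(2)[OF E zb c(1) Ec] nz by simp
    finally have s: "\<rho> c (coord c (\<alpha> \<theta>)) * cmod (velocity A \<alpha> \<theta> c) = 4 * pi * R / (1 - R\<^sup>2)" .
    have "riem_inner A \<rho> (\<alpha> \<theta>) (velocity A \<alpha> \<theta>) (velocity A \<alpha> \<theta>) = (\<rho> c (coord c (\<alpha> \<theta>)) * cmod (velocity A \<alpha> \<theta> c))\<^sup>2"
      by (simp add: riem_inner_def Let_def c_def[symmetric] power_mult_distrib dot_square_norm)
    also have "\<dots> = (4 * pi * R / (1 - R\<^sup>2))\<^sup>2" unfolding s ..
    finally show ?thesis using R by (simp add: abs_square_le_1 power_le_one)
  qed
  then show ?thesis unfolding line_integral_def \<alpha>_def[symmetric] by (simp add: \<alpha>_def)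
qed

end

section \<open>Eigenfunctions on the universal cover\<close>

text \<open>
  The conditions of \<^const>\<open>eigenfunction\<close> that are local, with the eigenvalue as a parameter.
\<close>

definition eigenvalue :: "'a chart set \<Rightarrow> ('a chart \<Rightarrow> complex \<Rightarrow> real) \<Rightarrow> ('a \<Rightarrow> complex) \<Rightarrow> real \<Rightarrow> bool" where
  "eigenvalue A \<rho> \<phi> \<mu> \<longleftrightarrow> (\<forall>c\<in>A. C_on 2 (\<phi> \<circ> cinv c) (coord c ` cdom c)) \<and>
     (\<forall>p. laplace_beltrami A \<rho> \<phi> p = \<mu> *\<^sub>R \<phi> p)"

context riemann_surface_metric
begin

lemma eigenvalue_chart:
  assumes "eigenvalue A \<rho> \<phi> \<mu>"
  shows "laplacian (\<phi> \<circ> cinv (chart_at A p)) (coord (chart_at A p) p) =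
    ((\<rho> (chart_at A p) (coord (chart_at A p) p))\<^sup>2 * \<mu>) *\<^sub>R \<phi> p"
proof -
  define c where "c = chart_at A p"
  have c: "c \<in> A" "p \<in> cdom c" unfolding c_def by (rule chart_at_props)+
  have r: "\<rho> c (coord c p) > 0" using density_pos[OF c(1)] c(2) by simp
  have "laplacian (\<phi> \<circ> cinv c) (coord c p) /\<^sub>R (\<rho> c (coord c p))\<^sup>2 = \<mu> *\<^sub>R \<phi> p"
    using assms unfolding eigenvalue_def laplace_beltrami_def Let_def c_def by (elim conjE) (erule spec)
  then have "(\<rho> c (coord c p))\<^sup>2 *\<^sub>R (laplacian (\<phi> \<circ> cinv c) (coord c p) /\<^sub>R (\<rho> c (coord c p))\<^sup>2)
      = (\<rho> c (coord c p))\<^sup>2 *\<^sub>R (\<mu> *\<^sub>R \<phi> p)" by (rule arg_cong)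
  then have "laplacian (\<phi> \<circ> cinv c) (coord c p) = ((\<rho> c (coord c p))\<^sup>2 * \<mu>) *\<^sub>R \<phi> p"
    using r by simp
  then show ?thesis unfolding c_def .
qed

text \<open>
  The conformal factor of the Laplacian under \<open>E\<close> is cancelled against that of the metric by the
  isometry condition.
\<close>

lemma eigenfunction_pullback:
  assumes E: "local_isometry A \<rho> (ball 0 1) E" and \<phi>: "eigenvalue A \<rho> \<phi> \<mu>"
  shows "C_on 2 (\<phi> \<circ> E) (ball 0 1)"
    "\<And>z. z \<in> ball 0 1 \<Longrightarrow> laplacian (\<phi> \<circ> E) z = ((2 / (1 - (cmod z)\<^sup>2))\<^sup>2 * \<mu>) *\<^sub>R \<phi> (E z)"
proof -
  have C2: "C_on 2 (\<phi> \<circ> cinv c) (coord c ` cdom c)" if "c \<in> A" for c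
    using \<phi> that unfolding eigenvalue_def by (elim conjE) (erule (1) bspec)
  have near: "\<exists>\<delta>>0. C_on 2 (\<phi> \<circ> E) (ball z \<delta>) \<and>
      laplacian (\<phi> \<circ> E) z = ((2 / (1 - (cmod z)\<^sup>2))\<^sup>2 * \<mu>) *\<^sub>R \<phi> (E z)" if z: "z \<in> ball 0 1" for z
  proof -
    define c where "c = chart_at A (E z)"
    have c: "c \<in> A" "E z \<in> cdom c" unfolding c_def by (rule chart_at_props)+
    let ?g = "coord c \<circ> E"
    obtain \<delta> where \<delta>: "\<delta> > 0" "ball z \<delta> \<subseteq> ball 0 1" "E ` ball z \<delta> \<subseteq> cdom c"
      by (rule local_isometries_near[OF E z c open_UNIV UNIV_I])
    have h: "?g holomorphic_on ball z \<delta>"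
      by (rule local_isometry_holomorphic[OF E open_ball \<delta>(2) c(1) \<delta>(3)])
    have im: "?g ` ball z \<delta> \<subseteq> coord c ` cdom c"
      unfolding image_comp[symmetric] by (rule image_mono[OF \<delta>(3)])
    have eq: "(\<phi> \<circ> E) w = ((\<phi> \<circ> cinv c) \<circ> ?g) w" if "w \<in> ball z \<delta>" for w
      using cinv_coord[OF c(1) subsetD[OF \<delta>(3) imageI[OF that]]] by simp
    have zb: "z \<in> ball z \<delta>" using \<delta>(1) by simp
    have "C_on 2 (\<phi> \<circ> E) (ball z \<delta>)"
      by (rule C_on_cong[OF open_ball eq, THEN iffD2]) (assumption, rule C_on_compose_holomorphic[OF open_ball h im C2[OF c(1)]])
    moreover have "laplacian (\<phi> \<circ> E) z = ((2 / (1 - (cmod z)\<^sup>2))\<^sup>2 * \<mu>) *\<^sub>R \<phi> (E z)"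
    proof -
      have "laplacian (\<phi> \<circ> E) z = laplacian ((\<phi> \<circ> cinv c) \<circ> ?g) z"
        by (rule laplacian_cong_open[OF open_ball zb eq])
      also have "\<dots> = (cmod (deriv ?g z))\<^sup>2 *\<^sub>R laplacian (\<phi> \<circ> cinv c) (?g z)"
        by (rule laplacian_compose_holomorphic[OF open_ball h im C2[OF c(1)] zb])
      also have "laplacian (\<phi> \<circ> cinv c) (?g z) = ((\<rho> c (coord c (E z)))\<^sup>2 * \<mu>) *\<^sub>R \<phi> (E z)"
        using eigenvalue_chart[OF \<phi>, of "E z"] by (simp add: c_def)
      also have "(cmod (deriv ?g z))\<^sup>2 *\<^sub>R (((\<rho> c (coord c (E z)))\<^sup>2 * \<mu>) *\<^sub>R \<phi> (E z))
          = ((\<rho> c (coord c (E z)) * cmod (deriv ?g z))\<^sup>2 * \<mu>) *\<^sub>R \<phi> (E z)"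
        by (simp only: scaleR_scaleR power_mult_distrib mult_ac)
      finally show ?thesis unfolding local_isometry_derivative(2)[OF E z c] .
    qed
    ultimately show ?thesis using \<delta>(1) by (intro exI[of _ \<delta>] conjI)
  qed
  show "laplacian (\<phi> \<circ> E) z = ((2 / (1 - (cmod z)\<^sup>2))\<^sup>2 * \<mu>) *\<^sub>R \<phi> (E z)" if "z \<in> ball 0 1" for z
    using near[OF that] by (elim exE conjE)
  show "C_on 2 (\<phi> \<circ> E) (ball 0 1)"
  proof (rule C_on_local)
    fix z :: complex assume "z \<in> ball 0 1"
    from near[OF this] obtain \<delta> where "\<delta> > 0" "C_on 2 (\<phi> \<circ> E) (ball z \<delta>)" by (elim exE conjE)
    then show "\<exists>N. open N \<and> z \<in> N \<and> C_on 2 (\<phi> \<circ> E) N" by (intro exI[of _ "ball z \<delta>"]) simp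
  qed
qed

text \<open>
  In the logarithmic coordinate \<open>w = log z\<close> rotations become translations, and circular means of
  an eigenfunction become means over vertical segments.
\<close>

lemma eigenfunction_log_pullback:
  assumes E: "local_isometry A \<rho> (ball 0 1) E" and \<phi>: "eigenvalue A \<rho> \<phi> \<mu>"
  shows "C_on 2 (\<phi> \<circ> E \<circ> exp) {w. Re w < 0}"
    "\<And>w. Re w < 0 \<Longrightarrow> laplacian (\<phi> \<circ> E \<circ> exp) w = (\<mu> / (sinh (Re w))\<^sup>2) *\<^sub>R (\<phi> \<circ> E \<circ> exp) w"
proof -
  let ?H = "{w. Re w < 0}"
  have o: "open ?H" by (rule open_halfspace_Re_lt)
  have hol: "exp holomorphic_on ?H" by (intro holomorphic_intros)
  have im: "exp ` ?H \<subseteq> ball (0::complex) 1" by auto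
  show "C_on 2 (\<phi> \<circ> E \<circ> exp) ?H"
    by (rule C_on_compose_holomorphic[OF o hol im eigenfunction_pullback(1)[OF E \<phi>]])
  fix w :: complex assume w: "Re w < 0"
  have wH: "w \<in> ?H" and ew: "exp w \<in> ball 0 1" using w im by auto
  let ?t = "Re w"
  have e1: "exp ?t \<noteq> 0" "1 - (exp ?t)\<^sup>2 \<noteq> 0"
    using w by (auto simp: power2_eq_1_iff) (metis exp_gt_zero less_numeral_extra(1) neg_less_0_iff_less not_less_iff_gr_or_eq)
  have sh: "sinh ?t = ((exp ?t)\<^sup>2 - 1) / (2 * exp ?t)"
    by (simp add: sinh_def exp_minus field_simps power2_eq_square)
  have "(exp ?t)\<^sup>2 * (2 / (1 - (exp ?t)\<^sup>2))\<^sup>2 * (sinh ?t)\<^sup>2 = 1"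
  proof -
    have a: "(x::real)\<^sup>2 * (2 / (1 - x\<^sup>2))\<^sup>2 * ((x\<^sup>2 - 1) / (2 * x))\<^sup>2 = 1" if "x \<noteq> 0" "1 - x\<^sup>2 \<noteq> 0" for x
    proof -
      have "x * (2 / (1 - x\<^sup>2)) * ((x\<^sup>2 - 1) / (2 * x)) = -1"
        using that by (simp add: field_simps)
      then have "(x * (2 / (1 - x\<^sup>2)) * ((x\<^sup>2 - 1) / (2 * x)))\<^sup>2 = 1" by simp
      then show ?thesis by (simp only: power_mult_distrib)
    qed
    show ?thesis unfolding sh by (rule a[OF e1])
  qed
  moreover have "sinh ?t \<noteq> 0" using w by simp
  ultimately have Q: "(exp ?t)\<^sup>2 * (2 / (1 - (exp ?t)\<^sup>2))\<^sup>2 = 1 / (sinh ?t)\<^sup>2"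
    by (simp add: eq_divide_eq)
  have "laplacian (\<phi> \<circ> E \<circ> exp) w = (cmod (deriv exp w))\<^sup>2 *\<^sub>R laplacian (\<phi> \<circ> E) (exp w)"
    by (rule laplacian_compose_holomorphic[OF o hol im eigenfunction_pullback(1)[OF E \<phi>] wH])
  also have "\<dots> = ((exp ?t)\<^sup>2 * (2 / (1 - (exp ?t)\<^sup>2))\<^sup>2 * \<mu>) *\<^sub>R \<phi> (E (exp w))"
    unfolding eigenfunction_pullback(2)[OF E \<phi> ew] DERIV_imp_deriv[OF DERIV_exp] by (simp add: norm_exp_eq_Re mult.assoc)
  finally show "laplacian (\<phi> \<circ> E \<circ> exp) w = (\<mu> / (sinh (Re w))\<^sup>2) *\<^sub>R (\<phi> \<circ> E \<circ> exp) w"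
    unfolding Q by simp
qed

end

text \<open>A second derivative test, used to exclude positive eigenvalues by the maximum principle.\<close>

lemma second_derivative_nonpos:
  fixes g :: "real \<Rightarrow> real"
  assumes d: "d > 0" and g: "\<And>t. \<bar>t\<bar> < d \<Longrightarrow> (g has_real_derivative g1 t) (at t)"
    and g1: "(g1 has_real_derivative g2) (at 0)" and mx: "\<And>t. \<bar>t\<bar> < d \<Longrightarrow> g t \<le> g 0"
  shows "g2 \<le> 0"
proof (rule ccontr)
  assume "\<not> g2 \<le> 0"
  then have g2: "0 < g2" by simp
  have z: "g1 0 = 0"
    by (rule DERIV_local_max[OF g d]) (use d mx in auto)
  obtain e where e: "e > 0" "\<And>h. h > 0 \<Longrightarrow> h < e \<Longrightarrow> g1 0 < g1 (0 + h)"
    using DERIV_pos_inc_right[OF g1 g2] by blast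
  define s where "s = min d e / 2"
  have s: "0 < s" "s < d" "s < e" using d e(1) by (auto simp: s_def)
  have "g 0 < g s"
  proof (rule DERIV_pos_imp_increasing_open[OF s(1)])
    fix x assume x: "0 < x" "x < s"
    show "\<exists>y. (g has_real_derivative y) (at x) \<and> 0 < y"
      by (rule exI[of _ "g1 x"], rule conjI, rule g) (use x s e(2)[of x] z in auto)
  next
    show "continuous_on {0..s} g"
      by (rule continuous_at_imp_continuous_on, rule ballI, rule DERIV_isCont, rule g) (use s in auto)
  qed
  then show False using mx[of s] s by simp
qed

lemma laplacian_max_nonpos:
  fixes k :: "complex \<Rightarrow> real"
  assumes S: "open S" "\<zeta> \<in> S" "C_on 2 k S" and mx: "\<And>z. z \<in> S \<Longrightarrow> k z \<le> k \<zeta>"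
  shows "laplacian k \<zeta> \<le> 0"
proof -
  obtain d where d: "d > 0" "ball \<zeta> d \<subseteq> S" using S openE by blast
  have C: "C_on (Suc 1) k S" "C_on (Suc 0) (pdx k) S" "C_on (Suc 0) (pdy k) S"
    using S(3) by (auto simp: numeral_2_eq_2)
  have inS: "\<zeta> + of_real t * e \<in> S" if "\<bar>t\<bar> < d" "cmod e = 1" for t e
    using that d(2) by (auto simp: subset_iff dist_norm norm_mult)
  have "pdx (pdx k) \<zeta> \<le> 0"
  proof (rule second_derivative_nonpos[OF d(1), of "\<lambda>t. k (\<zeta> + of_real t * 1)" "\<lambda>t. pdx k (\<zeta> + of_real t * 1)"])
    fix t assume t: "\<bar>t\<bar> < d"
    show "((\<lambda>t. k (\<zeta> + of_real t * 1)) has_real_derivative pdx k (\<zeta> + of_real t * 1)) (at t)"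
      using C_on_has_vector_derivative_line[OF C(1) inS[OF t, of 1], of UNIV] by (simp add: has_real_derivative_iff_has_vector_derivative)
    show "k (\<zeta> + of_real t * 1) \<le> k (\<zeta> + of_real 0 * 1)" using mx[OF inS[OF t, of 1]] by simp
  next
    show "((\<lambda>t. pdx k (\<zeta> + of_real t * 1)) has_real_derivative pdx (pdx k) \<zeta>) (at 0)"
      using C_on_has_vector_derivative_line[OF C(2) inS[of 0 1], of UNIV] d(1) by (simp add: has_real_derivative_iff_has_vector_derivative)
  qed
  moreover have "pdy (pdy k) \<zeta> \<le> 0"
  proof (rule second_derivative_nonpos[OF d(1), of "\<lambda>t. k (\<zeta> + of_real t * \<i>)" "\<lambda>t. pdy k (\<zeta> + of_real t * \<i>)"])
    fix t assume t: "\<bar>t\<bar> < d"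
    show "((\<lambda>t. k (\<zeta> + of_real t * \<i>)) has_real_derivative pdy k (\<zeta> + of_real t * \<i>)) (at t)"
      using C_on_has_vector_derivative_line[OF C(1) inS[OF t, of \<i>], of UNIV] by (simp add: has_real_derivative_iff_has_vector_derivative)
    show "k (\<zeta> + of_real t * \<i>) \<le> k (\<zeta> + of_real 0 * \<i>)" using mx[OF inS[OF t, of \<i>]] by simp
  next
    show "((\<lambda>t. pdy k (\<zeta> + of_real t * \<i>)) has_real_derivative pdy (pdy k) \<zeta>) (at 0)"
      using C_on_has_vector_derivative_line[OF C(3) inS[of 0 \<i>], of UNIV] d(1) by (simp add: has_real_derivative_iff_has_vector_derivative)
  qed
  ultimately show ?thesis by (simp add: laplacian_def)
qed

lemma laplacian_linear:
  assumes "open S" "\<zeta> \<in> S" "C_on 2 f S" "bounded_linear L"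
  shows "laplacian (\<lambda>z. L (f z)) \<zeta> = L (laplacian f \<zeta>)"
proof -
  have d: "f differentiable (at z)" "pdx f differentiable (at z)" "pdy f differentiable (at z)" if "z \<in> S" for z
    using assms(3) that by (auto simp: numeral_2_eq_2)
  have "pdx (pdx (\<lambda>z. L (f z))) \<zeta> = pdx (\<lambda>z. L (pdx f z)) \<zeta>"
    by (rule pd_cong_open(2)[OF assms(1,2)]) (rule pd_linear(2)[OF assms(4) d(1)])
  moreover have "pdy (pdy (\<lambda>z. L (f z))) \<zeta> = pdy (\<lambda>z. L (pdy f z)) \<zeta>"
    by (rule pd_cong_open(3)[OF assms(1,2)]) (rule pd_linear(3)[OF assms(4) d(1)])
  ultimately show ?thesis
    unfolding laplacian_def using pd_linear(2)[OF assms(4) d(2)[OF assms(2)]] pd_linear(3)[OF assms(4) d(3)[OF assms(2)]]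
    by (simp add: linear_simps[OF assms(4)])
qed

context compact_hyperbolic_surface
begin

lemma eigenfunction_continuous:
  assumes "eigenvalue A \<rho> \<phi> \<mu>"
  shows "continuous_on UNIV \<phi>"
proof -
  have "isCont \<phi> p" for p
  proof -
    define c where "c = chart_at A p"
    have c: "c \<in> A" "p \<in> cdom c" unfolding c_def by (rule chart_at_props)+
    have "C_on 2 (\<phi> \<circ> cinv c) (coord c ` cdom c)"
      using assms c(1) unfolding eigenvalue_def by (elim conjE) (erule (1) bspec)
    from continuous_on_compose[OF continuous_coord[OF c(1)] C_on_imp_continuous[OF this]]
    have "continuous_on (cdom c) \<phi>"
      by (rule continuous_on_eq) (simp add: cinv_coord[OF c(1)])
    then show ?thesis using open_cdom[OF c(1)] c(2) by (simp add: continuous_on_eq_continuous_at)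
  qed
  then show ?thesis by (simp add: continuous_at_imp_continuous_on)
qed

text \<open>At a maximum point of \<open>Re (\<omega> \<phi>)\<close>, for the right unimodular \<open>\<omega>\<close>, the Laplacian is nonpositive.\<close>

lemma eigenvalue_nonpos:
  assumes \<phi>: "eigenvalue A \<rho> \<phi> \<mu>" and nz: "\<phi> p0 \<noteq> 0"
  shows "\<mu> \<le> 0"
proof -
  have "continuous_on UNIV (\<lambda>p. cmod (\<phi> p))"
    using eigenfunction_continuous[OF \<phi>] by (rule continuous_on_norm)
  then obtain p where p: "\<And>q. cmod (\<phi> q) \<le> cmod (\<phi> p)"
    using continuous_attains_sup[OF compact_surface UNIV_not_empty] by blast
  have pp: "cmod (\<phi> p) > 0" using p[of p0] nz by (meson less_le_trans zero_less_norm_iff)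
  define \<omega> where "\<omega> = cnj (\<phi> p) / of_real (cmod (\<phi> p))"
  have \<omega>: "cmod \<omega> = 1" using pp by (simp add: \<omega>_def norm_divide)
  have \<omega>p: "\<omega> * \<phi> p = of_real (cmod (\<phi> p))"
  proof -
    have "\<omega> * \<phi> p = (\<phi> p * cnj (\<phi> p)) / of_real (cmod (\<phi> p))" by (simp add: \<omega>_def)
    also have "\<dots> = of_real (cmod (\<phi> p))"
      unfolding complex_norm_square[symmetric] using pp by (simp add: power2_eq_square)
    finally show ?thesis .
  qed
  define c where "c = chart_at A p"
  have c: "c \<in> A" "p \<in> cdom c" unfolding c_def by (rule chart_at_props)+
  let ?S = "coord c ` cdom c"
  have S: "open ?S" "coord c p \<in> ?S" using open_coord_image[OF c(1)] c(2) by auto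
  have C2: "C_on 2 (\<phi> \<circ> cinv c) ?S"
    using \<phi> c(1) unfolding eigenvalue_def by (elim conjE) (erule (1) bspec)
  have L: "bounded_linear (\<lambda>x. Re (\<omega> * x))"
    by (rule bounded_linear_compose[OF bounded_linear_Re bounded_linear_mult_right])
  have "laplacian (\<lambda>z. Re (\<omega> * (\<phi> \<circ> cinv c) z)) (coord c p) \<le> 0"
  proof (rule laplacian_max_nonpos[OF S C_on_linear[OF S(1) L C2]])
    fix z assume "z \<in> ?S"
    have "Re (\<omega> * (\<phi> \<circ> cinv c) z) \<le> cmod (\<omega> * (\<phi> \<circ> cinv c) z)" by (rule complex_Re_le_cmod)
    also have "\<dots> \<le> cmod (\<phi> p)" unfolding norm_mult \<omega> using p[of "cinv c z"] by simp
    also have "\<dots> = Re (\<omega> * (\<phi> \<circ> cinv c) (coord c p))" using \<omega>p cinv_coord[OF c] by simp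
    finally show "Re (\<omega> * (\<phi> \<circ> cinv c) z) \<le> Re (\<omega> * (\<phi> \<circ> cinv c) (coord c p))" .
  qed
  also have "laplacian (\<lambda>z. Re (\<omega> * (\<phi> \<circ> cinv c) z)) (coord c p) = Re (\<omega> * laplacian (\<phi> \<circ> cinv c) (coord c p))"
    by (rule laplacian_linear[OF S C2 L])
  also have "laplacian (\<phi> \<circ> cinv c) (coord c p) = ((\<rho> c (coord c p))\<^sup>2 * \<mu>) *\<^sub>R \<phi> p"
    using eigenvalue_chart[OF \<phi>, of p] by (simp add: c_def)
  also have "Re (\<omega> * (((\<rho> c (coord c p))\<^sup>2 * \<mu>) *\<^sub>R \<phi> p)) = (\<rho> c (coord c p))\<^sup>2 * cmod (\<phi> p) * \<mu>"
    using \<omega>p by (simp add: mult_scaleR_right)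
  finally have "(\<rho> c (coord c p))\<^sup>2 * cmod (\<phi> p) * \<mu> \<le> 0" .
  moreover have "(\<rho> c (coord c p))\<^sup>2 * cmod (\<phi> p) > 0" using pp density_pos[OF c(1) S(2)] by simp
  ultimately show ?thesis by (metis linorder_not_le mult_pos_pos)
qed

end

section \<open>Means over vertical segments\<close>

lemma pd_shift:
  fixes h :: "complex \<Rightarrow> 'b::real_normed_vector"
  assumes "\<And>w. h (w + a) = h w" "h differentiable (at (w + a))"
  shows "pdx h (w + a) = pdx h w" "pdy h (w + a) = pdy h w"
proof -
  have s: "((\<lambda>x. x + a) has_derivative (\<lambda>e. e)) (at w)" by (auto intro!: derivative_eq_intros)
  have "(h has_derivative (\<lambda>e. Re e *\<^sub>R pdx h (w + a) + Im e *\<^sub>R pdy h (w + a))) (at w)"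
    using has_derivative_compose[OF s has_derivative_pd[OF assms(2)]] by (simp add: assms(1))
  from pd_eqI(2,3)[OF this] show "pdx h (w + a) = pdx h w" "pdy h (w + a) = pdy h w" by simp_all
qed

text \<open>
  For a solution of \<open>\<Delta>h = q(Re w) h\<close> with vertical period, \<open>\<integral>h\<^sub>y\<^sub>y\<close> over a period vanishes, so the
  vertical means satisfy an ordinary differential equation.
\<close>

lemma vertical_mean_ode:
  fixes h :: "complex \<Rightarrow> complex" and \<kappa> :: real
  assumes C: "C_on 2 h {w. Re w < 0}" and per: "\<And>w. h (w + \<i> * of_real \<kappa>) = h w" and \<kappa>: "\<kappa> \<noteq> 0"
    and lap: "\<And>w. Re w < 0 \<Longrightarrow> laplacian h w = q (Re w) *\<^sub>R h w" and t: "t < 0"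
  shows "((\<lambda>t. integral {0..1} (\<lambda>\<theta>. h (Complex t (\<kappa> * \<theta>)))) has_vector_derivative
        integral {0..1} (\<lambda>\<theta>. pdx h (Complex t (\<kappa> * \<theta>)))) (at t)"
    "((\<lambda>t. integral {0..1} (\<lambda>\<theta>. pdx h (Complex t (\<kappa> * \<theta>)))) has_vector_derivative
        q t *\<^sub>R integral {0..1} (\<lambda>\<theta>. h (Complex t (\<kappa> * \<theta>)))) (at t)"
proof -
  let ?H = "{w. Re w < 0}"
  have C1: "C_on (Suc 1) h ?H" "C_on (Suc 0) (pdx h) ?H" "C_on (Suc 0) (pdy h) ?H"
    using C by (auto simp: numeral_2_eq_2)
  have cont: "continuous_on ?H h" "continuous_on ?H (pdx h)" "continuous_on ?H (pdx (pdx h))" "continuous_on ?H (pdy (pdy h))"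
    using C1 C_on_imp_continuous[OF C1(1)] C_on_imp_continuous[OF C1(2)] by auto
  have Cx: "Complex t s = \<i> * of_real s + of_real t * 1" "Complex t s = of_real t + of_real s * \<i>" for t s
    by (simp_all add: complex_eq_iff)
  have c2: "continuous_on ({..<0} \<times> cbox 0 1) (\<lambda>(x, \<theta>). k (Complex x (\<kappa> * \<theta>)))" if "continuous_on ?H k" for k :: "complex \<Rightarrow> complex"
    unfolding split_beta
    by (rule continuous_on_compose2[OF that]) (auto intro!: continuous_intros simp: Cx(2))
  have c1: "continuous_on {0..1} (\<lambda>\<theta>. k (Complex x (\<kappa> * \<theta>)))" if "continuous_on ?H k" "x < 0" for k :: "complex \<Rightarrow> complex" and x
    by (rule continuous_on_compose2[OF that(1)]) (use that(2) in \<open>auto intro!: continuous_intros simp: Cx(2)\<close>)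
  have leib: "((\<lambda>t. integral {0..1} (\<lambda>\<theta>. k (Complex t (\<kappa> * \<theta>)))) has_vector_derivative
        integral {0..1} (\<lambda>\<theta>. pdx k (Complex t (\<kappa> * \<theta>)))) (at t)"
    if k: "C_on (Suc j) k ?H" "continuous_on ?H (pdx k)" for k :: "complex \<Rightarrow> complex" and j
  proof -
    have "((\<lambda>t. integral (cbox 0 1) (\<lambda>\<theta>. k (Complex t (\<kappa> * \<theta>)))) has_vector_derivative
        integral (cbox 0 1) (\<lambda>\<theta>. pdx k (Complex t (\<kappa> * \<theta>)))) (at t within {..<0})"
    proof (rule leibniz_rule_vector_derivative)
      fix x \<theta> :: real assume x: "x \<in> {..<0}"
      then show "((\<lambda>x. k (Complex x (\<kappa> * \<theta>))) has_vector_derivative pdx k (Complex x (\<kappa> * \<theta>))) (at x within {..<0})"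
        using C_on_has_vector_derivative_line[OF k(1), of "\<i> * of_real (\<kappa> * \<theta>)" x 1 "{..<0}"]
        unfolding Cx(1) by simp
      show "(\<lambda>\<theta>. k (Complex x (\<kappa> * \<theta>))) integrable_on cbox 0 1"
        using c1[OF C_on_imp_continuous[OF k(1)]] x by (simp add: integrable_continuous_real)
    qed (use t c2[OF k(2)] in auto)
    then show ?thesis using t at_within_open[of t "{..<0}"] by simp
  qed
  show "((\<lambda>t. integral {0..1} (\<lambda>\<theta>. h (Complex t (\<kappa> * \<theta>)))) has_vector_derivative
        integral {0..1} (\<lambda>\<theta>. pdx h (Complex t (\<kappa> * \<theta>)))) (at t)"
    by (rule leib[OF C1(1) cont(2)])
  have zero: "integral {0..1} (\<lambda>\<theta>. pdy (pdy h) (Complex t (\<kappa> * \<theta>))) = 0"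
  proof -
    have "((\<lambda>\<theta>. pdy h (Complex t (\<kappa> * \<theta>))) has_vector_derivative \<kappa> *\<^sub>R pdy (pdy h) (Complex t (\<kappa> * \<theta>))) (at \<theta> within {0..1})" for \<theta>
    proof -
      have e: "Complex t (\<kappa> * \<theta>) = of_real t + of_real \<theta> * (of_real \<kappa> * \<i>)" for \<theta>
        by (simp add: complex_eq_iff)
      show ?thesis
        using C_on_has_vector_derivative_line[OF C1(3), of "of_real t" \<theta> "of_real \<kappa> * \<i>" "{0..1}"] t
        unfolding e by simp
    qed
    then have "((\<lambda>\<theta>. \<kappa> *\<^sub>R pdy (pdy h) (Complex t (\<kappa> * \<theta>))) has_integral
        pdy h (Complex t (\<kappa> * 1)) - pdy h (Complex t (\<kappa> * 0))) {0..1}"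
      by (intro fundamental_theorem_of_calculus) auto
    moreover have "pdy h (Complex t (\<kappa> * 1)) = pdy h (Complex t (\<kappa> * 0))"
    proof -
      have "h differentiable (at (of_real t + \<i> * of_real \<kappa>))" using C1(1) t by simp
      from pd_shift(2)[OF per this] show ?thesis by (simp add: Cx(2) mult.commute)
    qed
    ultimately have "((\<lambda>\<theta>. \<kappa> *\<^sub>R pdy (pdy h) (Complex t (\<kappa> * \<theta>))) has_integral 0) {0..1}" by simp
    from has_integral_cmul[OF this, of "inverse \<kappa>"] show ?thesis using \<kappa> by (simp add: integral_unique)
  qed
  have "integral {0..1} (\<lambda>\<theta>. pdx (pdx h) (Complex t (\<kappa> * \<theta>))) =
      integral {0..1} (\<lambda>\<theta>. q t *\<^sub>R h (Complex t (\<kappa> * \<theta>)) - pdy (pdy h) (Complex t (\<kappa> * \<theta>)))"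
  proof (rule Henstock_Kurzweil_Integration.integral_cong)
    fix \<theta> :: real
    have "laplacian h (Complex t (\<kappa> * \<theta>)) = q t *\<^sub>R h (Complex t (\<kappa> * \<theta>))"
      using lap[of "Complex t (\<kappa> * \<theta>)"] t by simp
    then show "pdx (pdx h) (Complex t (\<kappa> * \<theta>)) = q t *\<^sub>R h (Complex t (\<kappa> * \<theta>)) - pdy (pdy h) (Complex t (\<kappa> * \<theta>))"
      unfolding laplacian_def by (simp add: algebra_simps)
  qed
  also have "\<dots> = q t *\<^sub>R integral {0..1} (\<lambda>\<theta>. h (Complex t (\<kappa> * \<theta>)))"
    using c1[OF cont(1) t] c1[OF cont(4) t] zero
    by (subst Henstock_Kurzweil_Integration.integral_diff) (auto intro!: integrable_continuous_real continuous_intros)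
  finally show "((\<lambda>t. integral {0..1} (\<lambda>\<theta>. pdx h (Complex t (\<kappa> * \<theta>)))) has_vector_derivative
        q t *\<^sub>R integral {0..1} (\<lambda>\<theta>. h (Complex t (\<kappa> * \<theta>)))) (at t)"
    using leib[OF C1(2) cont(3)] by simp
qed

section \<open>A uniform energy estimate\<close>

text \<open>
  The mass of the cutoff function used in the following estimate.
\<close>

lemma has_integral_cutoff:
  fixes a b :: real
  assumes "a \<le> b"
  shows "((\<lambda>t. ((t - a) * (b - t))\<^sup>2) has_integral (b - a) ^ 5 / 30) {a..b}"
proof -
  define L where "L = b - a"
  define P where "P t = L\<^sup>2 / 3 * (t - a) ^ 3 - L / 2 * (t - a) ^ 4 + 1 / 5 * (t - a) ^ 5" for t
  have "(P has_vector_derivative ((t - a) * (b - t))\<^sup>2) (at t within {a..b})" for t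
  proof -
    have e: "b - t = L - (t - a)" by (simp add: L_def)
    have "(P has_real_derivative ((t - a) * (b - t))\<^sup>2) (at t within {a..b})"
      unfolding P_def e
      by (auto intro!: derivative_eq_intros simp: field_simps eval_nat_numeral)
    then show ?thesis by (simp add: has_real_derivative_iff_has_vector_derivative)
  qed
  then have "((\<lambda>t. ((t - a) * (b - t))\<^sup>2) has_integral P b - P a) {a..b}"
    by (intro fundamental_theorem_of_calculus assms)
  moreover have "P b - P a = (b - a) ^ 5 / 30"
    by (simp add: P_def L_def field_simps eval_nat_numeral)
  ultimately show ?thesis by simp
qed

text \<open>
  Solutions of \<open>F'' = -\<nu>qF\<close> with \<open>\<nu> \<ge> 0\<close>: the energy \<open>|F'|\<^sup>2 + (\<nu>q + 1)|F|\<^sup>2\<close> grows at most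
  exponentially, at a rate that does not depend on \<open>\<nu>\<close>, and its mean over an earlier interval is
  controlled by \<open>(1 + \<nu>)\<integral>|F|\<^sup>2\<close> (Caccioppoli's inequality, with a polynomial cutoff). The factor
  \<open>1 + \<nu>\<close> appears on both sides and cancels.
\<close>

lemma energy_estimate:
  fixes q q' :: "real \<Rightarrow> real" and a b T :: real
  assumes ab: "a < b" "b \<le> T" and q: "\<And>t. t \<in> {a..T} \<Longrightarrow> (q has_real_derivative q' t) (at t)"
    and q'c: "continuous_on {a..T} q'" and qpos: "\<And>t. t \<in> {a..T} \<Longrightarrow> q t > 0"
  obtains C where "C > 0" "\<And>F F1 \<nu>. \<nu> \<ge> 0 \<Longrightarrow>
     \<forall>t\<in>{a..T}. ((F :: real \<Rightarrow> complex) has_vector_derivative F1 t) (at t) \<Longrightarrow>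
     \<forall>t\<in>{a..T}. (F1 has_vector_derivative - (\<nu> * q t) *\<^sub>R F t) (at t) \<Longrightarrow>
     (cmod (F T))\<^sup>2 \<le> C * integral {a..b} (\<lambda>t. (cmod (F t))\<^sup>2)"
proof -
  have T: "a \<le> T" "T \<in> {a..T}" using ab by auto
  have qc: "continuous_on {a..T} q"
    by (rule continuous_at_imp_continuous_on, rule ballI, rule DERIV_isCont, rule q)
  have "continuous_on {a..T} (\<lambda>t. \<bar>q' t\<bar> / q t)"
    using qpos by (intro continuous_intros q'c qc) force
  then have "bounded ((\<lambda>t. \<bar>q' t\<bar> / q t) ` {a..T})"
    by (intro compact_imp_bounded compact_continuous_image) auto
  then obtain K0 where K0: "K0 > 0" "\<forall>x\<in>(\<lambda>t. \<bar>q' t\<bar> / q t) ` {a..T}. norm x \<le> K0"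
    unfolding bounded_pos by (elim exE conjE)
  have q'le: "q' t \<le> K0 * q t" if "t \<in> {a..T}" for t
  proof -
    have "\<bar>q' t\<bar> / q t \<le> K0" by (rule order_trans[OF abs_ge_self bspec[OF K0(2)[unfolded real_norm_def] imageI[OF that]]])
    then have "\<bar>q' t\<bar> \<le> K0 * q t" using qpos[OF that] by (simp add: divide_le_eq)
    then show ?thesis by linarith
  qed
  have "bounded (q ` {a..T})"
    by (intro compact_imp_bounded compact_continuous_image qc) auto
  then obtain Q where Q: "Q > 0" "\<forall>x\<in>q ` {a..T}. norm x \<le> Q" unfolding bounded_pos by (elim exE conjE)
  have qQ: "q t \<le> Q" if "t \<in> {a..T}" for t
    by (rule order_trans[OF abs_ge_self bspec[OF Q(2)[unfolded real_norm_def] imageI[OF that]]])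
  define K where "K = K0 + 1"
  define X where "X = (b - a) ^ 4"
  define Y where "Y = (b - a)\<^sup>2"
  define D where "D = 3 * Q * X + 4 * Y + X"
  define m where "m = min (q T) 1"
  have m: "m > 0" using qpos[OF T(2)] by (simp add: m_def)
  have XY: "X > 0" "Y > 0" using ab by (auto simp: X_def Y_def)
  have D: "D > 0" using XY Q by (simp add: D_def add_pos_pos)
  define C where "C = D * exp (K * (T - a)) / (m * ((b - a) ^ 5 / 30))"
  show ?thesis
  proof (rule that[of C])
    show "C > 0" using D m ab by (simp add: C_def)
    fix F F1 :: "real \<Rightarrow> complex" and \<nu> :: real
    assume \<nu>: "\<nu> \<ge> 0" and "\<forall>t\<in>{a..T}. (F has_vector_derivative F1 t) (at t)"
      and "\<forall>t\<in>{a..T}. (F1 has_vector_derivative - (\<nu> * q t) *\<^sub>R F t) (at t)"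
    note dF = this(2)[THEN bspec] and dF1 = this(3)[THEN bspec]
    have dinner: "((\<lambda>t. f t \<bullet> g t) has_real_derivative f' \<bullet> g t + f t \<bullet> g') (at t)"
      if "(f has_vector_derivative f') (at t)" "(g has_vector_derivative g') (at t)" for f g :: "real \<Rightarrow> complex" and f' g' t
      using has_derivative_inner[OF that[unfolded has_vector_derivative_def]]
      unfolding has_field_derivative_def by (rule has_derivative_eq_rhs) (simp add: fun_eq_iff algebra_simps)
    define e where "e t = F1 t \<bullet> F1 t + (\<nu> * q t + 1) * (F t \<bullet> F t)" for t
    have de: "(e has_real_derivative \<nu> * q' t * (F t \<bullet> F t) + 2 * (F1 t \<bullet> F t)) (at t)" if t: "t \<in> {a..T}" for t
      unfolding e_def
      by (rule DERIV_cong, (rule derivative_intros dinner dF dF1 q t)+) (simp add: inner_commute algebra_simps)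
    have de_le: "\<nu> * q' t * (F t \<bullet> F t) + 2 * (F1 t \<bullet> F t) \<le> K * e t" if t: "t \<in> {a..T}" for t
    proof -
      have "(F1 t - F t) \<bullet> (F1 t - F t) \<ge> 0" by (rule inner_ge_zero)
      then have 1: "2 * (F1 t \<bullet> F t) \<le> F1 t \<bullet> F1 t + F t \<bullet> F t"
        by (simp add: inner_diff_left inner_diff_right inner_commute)
      have 2: "\<nu> * q' t * (F t \<bullet> F t) \<le> \<nu> * (K0 * q t) * (F t \<bullet> F t)"
        using q'le[OF t] \<nu> by (intro mult_right_mono mult_left_mono) auto
      have "0 \<le> K0 * (F1 t \<bullet> F1 t)" "0 \<le> K0 * (F t \<bullet> F t)" "0 \<le> \<nu> * q t * (F t \<bullet> F t)"
        using K0(1) \<nu> qpos[OF t] by (auto intro!: mult_nonneg_nonneg)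
      then show ?thesis using 1 2 by (simp add: e_def K_def algebra_simps)
    qed
    have e_nonneg: "e t \<ge> 0" if "t \<in> {a..T}" for t
      using \<nu> qpos[OF that] by (simp add: e_def)
    have e_grow: "exp (- (K * T)) * e T \<le> exp (- (K * t)) * e t" if t: "t \<in> {a..b}" for t
    proof (rule DERIV_nonpos_imp_nonincreasing[where f = "\<lambda>t. exp (- (K * t)) * e t"])
      show "t \<le> T" using t ab by simp
      fix x assume x: "t \<le> x" "x \<le> T"
      then have xT: "x \<in> {a..T}" using t by simp
      show "\<exists>y. ((\<lambda>t. exp (- (K * t)) * e t) has_real_derivative y) (at x) \<and> y \<le> 0"
      proof (intro exI conjI)
        show "((\<lambda>t. exp (- (K * t)) * e t) has_real_derivative
           exp (- (K * x)) * ((\<nu> * q' x * (F x \<bullet> F x) + 2 * (F1 x \<bullet> F x)) - K * e x)) (at x)"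
          by (rule DERIV_cong, (rule derivative_eq_intros de[OF xT] refl)+) (simp add: algebra_simps)
        show "exp (- (K * x)) * ((\<nu> * q' x * (F x \<bullet> F x) + 2 * (F1 x \<bullet> F x)) - K * e x) \<le> 0"
          using de_le[OF xT] by (intro mult_nonneg_nonpos) auto
      qed
    qed
    have e_grow': "exp (- (K * (T - a))) * e T \<le> e t" if t: "t \<in> {a..b}" for t
    proof -
      have tT: "t \<in> {a..T}" using t ab by simp
      have "exp (K * t) * (exp (- (K * T)) * e T) \<le> exp (K * t) * (exp (- (K * t)) * e t)"
        by (rule mult_left_mono[OF e_grow[OF t]]) simp
      moreover have "exp (K * t) * exp (- (K * T)) = exp (- (K * (T - t)))" "exp (K * t) * exp (- (K * t)) = 1"
        unfolding exp_add[symmetric] by (simp_all add: algebra_simps)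
      ultimately have "exp (- (K * (T - t))) * e T \<le> e t"
        by (simp only: mult.assoc[symmetric] mult_1_left)
      moreover have "exp (- (K * (T - a))) * e T \<le> exp (- (K * (T - t))) * e T"
        using t K0(1) e_nonneg[OF T(2)] by (intro mult_right_mono) (auto simp: K_def)
      ultimately show ?thesis by linarith
    qed
    define \<xi> where "\<xi> t = (t - a) * (b - t)" for t :: real
    define \<xi>' where "\<xi>' t = (b - t) - (t - a)" for t :: real
    define H where "H t = (\<xi> t)\<^sup>2 * (F1 t \<bullet> F t)" for t
    define H' where "H' t = 2 * \<xi> t * \<xi>' t * (F1 t \<bullet> F t) + (\<xi> t)\<^sup>2 * (F1 t \<bullet> F1 t - \<nu> * q t * (F t \<bullet> F t))" for t
    have d\<xi>: "(\<xi> has_real_derivative \<xi>' t) (at t)" for t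
      unfolding \<xi>_def \<xi>'_def by (auto intro!: derivative_eq_intros)
    have dH: "(H has_real_derivative H' t) (at t)" if t: "t \<in> {a..T}" for t
    proof -
      have "((\<lambda>t. (\<xi> t)\<^sup>2) has_real_derivative 2 * \<xi> t * \<xi>' t) (at t)"
        by (rule derivative_eq_intros d\<xi> refl)+ simp
      from DERIV_mult[OF this dinner[OF dF1[OF t] dF[OF t]]]
      show ?thesis unfolding H_def H'_def by (simp add: algebra_simps inner_commute)
    qed
    have iH: "(H' has_integral 0) {a..b}"
    proof -
      have "(H' has_integral H b - H a) {a..b}"
        by (rule fundamental_theorem_of_calculus)
          (use ab dH in \<open>auto simp: has_real_derivative_iff_has_vector_derivative[symmetric] intro: has_field_derivative_at_within\<close>)
      then show ?thesis by (simp add: H_def \<xi>_def)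
    qed
    have cacc: "(\<xi> t)\<^sup>2 * e t \<le> 2 * H' t + (1 + \<nu>) * D * (F t \<bullet> F t)" if t: "t \<in> {a..b}" for t
    proof -
      have tT: "t \<in> {a..T}" using t ab by simp
      have r: "0 \<le> t - a" "t - a \<le> b - a" "0 \<le> b - t" "b - t \<le> b - a" using t by auto
      have "\<xi> t \<le> (b - a) * (b - a)" unfolding \<xi>_def by (intro mult_mono r) (use r ab in auto)
      moreover have "0 \<le> \<xi> t" unfolding \<xi>_def using r by simp
      ultimately have "(\<xi> t)\<^sup>2 \<le> ((b - a) * (b - a))\<^sup>2" by (rule power_mono)
      then have \<xi>X: "(\<xi> t)\<^sup>2 \<le> X" by (simp add: X_def power2_eq_square power4_eq_xxxx)
      have \<xi>'Y: "(\<xi>' t)\<^sup>2 \<le> Y" unfolding Y_def \<xi>'_def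
        by (rule power2_le_iff_abs_le[THEN iffD2]) (use r ab in auto)
      let ?f = "F t \<bullet> F t" and ?g = "F1 t \<bullet> F1 t"
      have f0: "?f \<ge> 0" by (rule inner_ge_zero)
      \<comment> \<open>Young's inequality absorbs the term with the derivative of the cutoff into the left-hand side\<close>
      define V where "V = \<xi> t *\<^sub>R F1 t + (2 * \<xi>' t) *\<^sub>R F t"
      have "0 \<le> V \<bullet> V" by (rule inner_ge_zero)
      then have V: "- (4 * \<xi> t * \<xi>' t * (F1 t \<bullet> F t)) \<le> (\<xi> t)\<^sup>2 * ?g + 4 * (\<xi>' t)\<^sup>2 * ?f"
        unfolding V_def by (simp add: inner_add_left inner_add_right inner_commute power2_eq_square algebra_simps)
      have "(\<xi> t)\<^sup>2 * ?g \<le> 2 * H' t + 2 * (\<nu> * q t) * (\<xi> t)\<^sup>2 * ?f + 4 * (\<xi>' t)\<^sup>2 * ?f"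
        using V unfolding H'_def by (simp add: algebra_simps)
      then have 1: "(\<xi> t)\<^sup>2 * e t \<le> 2 * H' t + (3 * (\<nu> * q t) * (\<xi> t)\<^sup>2 + 4 * (\<xi>' t)\<^sup>2 + (\<xi> t)\<^sup>2) * ?f"
        unfolding e_def by (simp add: algebra_simps)
      have "\<nu> * q t * (\<xi> t)\<^sup>2 \<le> \<nu> * Q * X"
        using \<nu> qQ[OF tT] qpos[OF tT] \<xi>X by (intro mult_mono) (auto intro: mult_left_mono)
      then have "3 * (\<nu> * q t) * (\<xi> t)\<^sup>2 + 4 * (\<xi>' t)\<^sup>2 + (\<xi> t)\<^sup>2 \<le> 3 * (\<nu> * Q * X) + 4 * Y + X"
        using \<xi>X \<xi>'Y by simp
      also have "\<dots> \<le> (1 + \<nu>) * D"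
      proof -
        have "0 \<le> \<nu> * (4 * Y + X) + 3 * Q * X" using \<nu> XY Q by simp
        then show ?thesis by (simp add: D_def algebra_simps)
      qed
      finally have "(3 * (\<nu> * q t) * (\<xi> t)\<^sup>2 + 4 * (\<xi>' t)\<^sup>2 + (\<xi> t)\<^sup>2) * ?f \<le> (1 + \<nu>) * D * ?f"
        by (rule mult_right_mono[OF _ f0])
      then show ?thesis using 1 by linarith
    qed
    have Fc: "continuous_on {a..b} F"
      by (rule continuous_on_vector_derivative[where f' = F1], rule has_vector_derivative_at_within, rule dF) (use ab in auto)
    have iF: "((\<lambda>t. F t \<bullet> F t) has_integral integral {a..b} (\<lambda>t. F t \<bullet> F t)) {a..b}"
      by (intro integrable_integral integrable_continuous_real continuous_intros Fc)
    define c where "c = exp (- (K * (T - a))) * e T"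
    have i1: "((\<lambda>t. c * (\<xi> t)\<^sup>2) has_integral c * ((b - a) ^ 5 / 30)) {a..b}"
      unfolding \<xi>_def by (rule has_integral_mult_right[OF has_integral_cutoff]) (use ab in simp)
    have i2: "((\<lambda>t. 2 * H' t + (1 + \<nu>) * D * (F t \<bullet> F t)) has_integral
        2 * 0 + (1 + \<nu>) * D * integral {a..b} (\<lambda>t. F t \<bullet> F t)) {a..b}"
      by (intro has_integral_add has_integral_mult_right iH iF)
    have "c * ((b - a) ^ 5 / 30) \<le> 2 * 0 + (1 + \<nu>) * D * integral {a..b} (\<lambda>t. F t \<bullet> F t)"
    proof (rule has_integral_le[OF i1 i2])
      fix t assume t: "t \<in> {a..b}"
      have "c * (\<xi> t)\<^sup>2 \<le> e t * (\<xi> t)\<^sup>2" using e_grow'[OF t] unfolding c_def by (rule mult_right_mono) simp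
      then show "c * (\<xi> t)\<^sup>2 \<le> 2 * H' t + (1 + \<nu>) * D * (F t \<bullet> F t)" using cacc[OF t] by (simp add: mult.commute)
    qed
    then have 1: "c * ((b - a) ^ 5 / 30) \<le> (1 + \<nu>) * (D * integral {a..b} (\<lambda>t. F t \<bullet> F t))" by simp
    have 2: "(1 + \<nu>) * (m * (F T \<bullet> F T)) \<le> e T"
    proof -
      have "(1 + \<nu>) * m \<le> \<nu> * q T + 1"
        using \<nu> mult_left_mono[of m "q T" \<nu>] by (simp add: m_def algebra_simps)
      then have "(1 + \<nu>) * m * (F T \<bullet> F T) \<le> (\<nu> * q T + 1) * (F T \<bullet> F T)" by (rule mult_right_mono) simp
      also have "\<dots> \<le> e T" by (simp add: e_def)
      finally show ?thesis by (simp add: mult.assoc)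
    qed
    have "(1 + \<nu>) * (exp (- (K * (T - a))) * m * ((b - a) ^ 5 / 30) * (F T \<bullet> F T))
       = exp (- (K * (T - a))) * ((b - a) ^ 5 / 30) * ((1 + \<nu>) * (m * (F T \<bullet> F T)))" by (simp add: mult_ac)
    also have "\<dots> \<le> exp (- (K * (T - a))) * ((b - a) ^ 5 / 30) * e T"
      by (rule mult_left_mono[OF 2]) (use ab in simp)
    also have "\<dots> = c * ((b - a) ^ 5 / 30)" by (simp add: c_def mult_ac)
    also have "\<dots> \<le> (1 + \<nu>) * (D * integral {a..b} (\<lambda>t. F t \<bullet> F t))" by (rule 1)
    finally have "exp (- (K * (T - a))) * m * ((b - a) ^ 5 / 30) * (F T \<bullet> F T) \<le> D * integral {a..b} (\<lambda>t. F t \<bullet> F t)"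
      by (rule mult_left_le_imp_le) (use \<nu> in simp)
    then have "F T \<bullet> F T \<le> C * integral {a..b} (\<lambda>t. F t \<bullet> F t)"
      using m ab unfolding C_def exp_minus by (simp add: field_simps)
    then show "(cmod (F T))\<^sup>2 \<le> C * integral {a..b} (\<lambda>t. (cmod (F t))\<^sup>2)"
      by (simp add: dot_square_norm)
  qed
qed

section \<open>Comparison of measures\<close>

lemma prod_Basis_real2:
  fixes x :: "real^2"
  shows "(\<Prod>b\<in>Basis. x \<bullet> b) = (x $ 1) * (x $ 2)"
proof -
  have B: "(Basis :: (real^2) set) = (\<lambda>i. axis i 1) ` UNIV"
    by (auto simp: Basis_vec_def)
  have "inj (\<lambda>i::2. axis i (1::real))" by (auto simp: inj_on_def axis_eq_axis)
  then show ?thesis unfolding B by (simp add: prod.reindex inner_axis UNIV_2)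
qed

definition complex_of_vec :: "real^2 \<Rightarrow> complex" where
  "complex_of_vec x = Complex (x $ 1) (x $ 2)"

definition vec_of_complex :: "complex \<Rightarrow> real^2" where
  "vec_of_complex z = (\<chi> i. if i = 1 then Re z else Im z)"

lemma vec_of_complex_nth [simp]: "vec_of_complex z $ 1 = Re z" "vec_of_complex z $ 2 = Im z"
  by (simp_all add: vec_of_complex_def)

lemma complex_of_vec_inverse [simp]: "vec_of_complex (complex_of_vec x) = x" "complex_of_vec (vec_of_complex z) = z"
  by (simp_all add: complex_of_vec_def vec_eq_iff forall_2)

lemma bounded_linear_complex_of_vec: "bounded_linear complex_of_vec"
  by (rule linear_conv_bounded_linear[THEN iffD1], rule linearI) (simp_all add: complex_of_vec_def complex_eq_iff)

lemma bounded_linear_vec_of_complex: "bounded_linear vec_of_complex"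
  by (rule linear_conv_bounded_linear[THEN iffD1], rule linearI) (simp_all add: vec_eq_iff forall_2)

lemma complex_of_vec_measurable [measurable]: "complex_of_vec \<in> borel_measurable borel"
  by (rule borel_measurable_continuous_onI) (rule linear_continuous_on[OF bounded_linear_complex_of_vec])

text \<open>
  The change of variables formula is applied in \<open>\<real>\<^sup>2\<close> and Fubini's theorem in \<open>\<real> \<times> \<real>\<close>; these two
  identifications with the complex plane preserve Lebesgue measure.
\<close>

lemma lborel_complex_of_vec: "distr lborel borel complex_of_vec = lborel"
proof (rule lborel_eqI[symmetric])
  fix l u :: complex assume le: "\<And>b. b \<in> Basis \<Longrightarrow> l \<bullet> b \<le> u \<bullet> b"
  have lu: "Re l \<le> Re u" "Im l \<le> Im u" using le[of 1] le[of \<i>] by (auto simp: Basis_complex_def)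
  have pre: "complex_of_vec -` box l u = box (vec_of_complex l) (vec_of_complex u)"
    by (auto simp: complex_of_vec_def in_box_complex_iff mem_box_cart forall_2)
  have leB: "vec_of_complex l \<bullet> b \<le> vec_of_complex u \<bullet> b" if "b \<in> Basis" for b
    using that lu by (auto simp: Basis_vec_def inner_axis vec_of_complex_def)
  have "emeasure (distr lborel borel complex_of_vec) (box l u) = emeasure lborel (box (vec_of_complex l) (vec_of_complex u))"
    by (subst emeasure_distr) (auto simp: pre)
  also have "\<dots> = (\<Prod>b\<in>Basis. (vec_of_complex u - vec_of_complex l) \<bullet> b)"
    by (rule emeasure_lborel_box[OF leB])
  also have "(\<Prod>b\<in>Basis. (vec_of_complex u - vec_of_complex l) \<bullet> b) = (Re u - Re l) * (Im u - Im l)"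
    unfolding prod_Basis_real2 by simp
  also have "\<dots> = (\<Prod>b\<in>Basis. (u - l) \<bullet> b)"
    by (simp add: Basis_complex_def)
  finally show "emeasure (distr lborel borel complex_of_vec) (box l u) = (\<Prod>b\<in>Basis. (u - l) \<bullet> b)" .
qed simp

lemma lborel_complex_prod: "distr (lborel \<Otimes>\<^sub>M lborel) borel (\<lambda>(x, y). Complex x y) = lborel"
proof (rule lborel_eqI[symmetric])
  have C: "(\<lambda>(x, y). Complex x y) = (\<lambda>p. of_real (fst p) + \<i> * of_real (snd p))"
    by (auto simp: fun_eq_iff complex_eq_iff)
  have m: "(\<lambda>(x, y). Complex x y) \<in> borel_measurable (lborel \<Otimes>\<^sub>M lborel)"
    unfolding C by measurable
  fix l u :: complex assume le: "\<And>b. b \<in> Basis \<Longrightarrow> l \<bullet> b \<le> u \<bullet> b"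
  have lu: "Re l \<le> Re u" "Im l \<le> Im u" using le[of 1] le[of \<i>] by (auto simp: Basis_complex_def)
  have pre: "(\<lambda>(x, y). Complex x y) -` box l u = {Re l<..<Re u} \<times> {Im l<..<Im u}"
    by (auto simp: in_box_complex_iff)
  have "emeasure (distr (lborel \<Otimes>\<^sub>M lborel) borel (\<lambda>(x, y). Complex x y)) (box l u)
      = emeasure (lborel \<Otimes>\<^sub>M lborel) ({Re l<..<Re u} \<times> {Im l<..<Im u})"
    by (subst emeasure_distr[OF m]) (auto simp: pre space_pair_measure)
  also have "\<dots> = ennreal (Re u - Re l) * ennreal (Im u - Im l)"
    by (subst lborel.emeasure_pair_measure_Times) (use lu in auto)
  also have "\<dots> = (\<Prod>b\<in>Basis. (u - l) \<bullet> b)"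
    using lu by (simp add: Basis_complex_def ennreal_mult)
  finally show "emeasure (distr (lborel \<Otimes>\<^sub>M lborel) borel (\<lambda>(x, y). Complex x y)) (box l u) = (\<Prod>b\<in>Basis. (u - l) \<bullet> b)" .
qed simp

lemma det_complex_multiplication:
  "det (matrix (\<lambda>x. vec_of_complex (d * complex_of_vec x))) = (cmod d)\<^sup>2"
proof -
  have "complex_of_vec (axis 1 1) = 1" "complex_of_vec (axis 2 1) = \<i>"
    by (simp_all add: complex_of_vec_def axis_def complex_eq_iff)
  then show ?thesis unfolding cmod_power2 by (simp add: det_2 matrix_def power2_eq_square)
qed

lemma continuous_vimage_borel:
  fixes f :: "'a::topological_space \<Rightarrow> 'b::topological_space"
  assumes "open U" "continuous_on U f" "Z \<in> sets borel"
  shows "U \<inter> f -` Z \<in> sets borel"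
proof -
  define f' where "f' w = (if w \<in> U then f w else undefined)" for w
  have "f' \<in> borel_measurable borel"
    unfolding f'_def by (rule borel_measurable_continuous_on_if[OF _ assms(2) continuous_on_const]) (use assms(1) in simp)
  then have "f' -` Z \<in> sets borel" using measurable_sets[of f' borel borel Z] assms(3) by simp
  moreover have "U \<inter> f -` Z = U \<inter> f' -` Z" by (auto simp: f'_def)
  ultimately show ?thesis using assms(1) by simp
qed

text \<open>
  The Jacobian of a holomorphic map is \<open>|k'|\<^sup>2 \<ge> m\<^sup>2\<close>, and \<open>k\<close> maps the set on the left injectively into \<open>Z\<close>.
\<close>

lemma area_inverse_image:
  assumes U: "open U" "k holomorphic_on U" and K: "compact K" "K \<subseteq> U" and R: "R \<in> sets borel" "R \<subseteq> K"
    and inj: "inj_on k R" and m: "m > 0" "\<And>w. w \<in> R \<Longrightarrow> m \<le> cmod (deriv k w)" and Z: "Z \<in> sets borel"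
  shows "ennreal (m\<^sup>2) * emeasure lborel (R \<inter> k -` Z) \<le> emeasure lborel Z"
proof -
  have RU: "R \<subseteq> U" using R K by auto
  have kc: "continuous_on U k" by (rule holomorphic_on_imp_continuous_on[OF U(2)])
  define S where "S = R \<inter> k -` Z"
  have Sb: "S \<in> sets borel"
  proof -
    have "U \<inter> k -` Z \<in> sets borel"
      by (rule continuous_vimage_borel[OF U(1) kc Z])
    moreover have "S = R \<inter> (U \<inter> k -` Z)" using RU by (auto simp: S_def)
    ultimately show ?thesis using R(1) by simp
  qed
  have SK: "S \<subseteq> K" "S \<subseteq> U" "S \<subseteq> R" using R(2) RU by (auto simp: S_def)
  let ?T = complex_of_vec and ?J = vec_of_complex
  define S2 where "S2 = ?T -` S"
  define K2 where "K2 = ?J ` K"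
  define f where "f x = ?J (k (?T x))" for x
  define f' where "f' x = (\<lambda>e. ?J (deriv k (?T x) * ?T e))" for x
  have S2b: "S2 \<in> sets borel" unfolding S2_def using measurable_sets[OF complex_of_vec_measurable Sb] by simp
  have K2: "compact K2" unfolding K2_def
    by (rule compact_continuous_image[OF linear_continuous_on[OF bounded_linear_vec_of_complex] K(1)])
  have S2K: "S2 \<subseteq> K2"
  proof
    fix x assume "x \<in> S2"
    then have "?T x \<in> K" using SK by (auto simp: S2_def)
    then show "x \<in> K2" unfolding K2_def using complex_of_vec_inverse(1)[of x] by (metis imageI)
  qed
  have K2m: "K2 \<in> sets borel" using K2 by (simp add: borel_compact)
  have em: "emeasure lborel (?T -` B) = emeasure lborel B" if "B \<in> sets borel" for B
    using emeasure_distr[of complex_of_vec lborel borel B] that by (simp add: lborel_complex_of_vec)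
  have df: "(f has_derivative f' x) (at x within S2)" if "x \<in> S2" for x
  proof -
    have "?T x \<in> U" using that SK by (auto simp: S2_def)
    then have "(k has_derivative (*) (deriv k (?T x))) (at (?T x))"
      using holomorphic_derivI[OF U(2,1)] by (simp add: has_field_derivative_def)
    from bounded_linear.has_derivative[OF bounded_linear_vec_of_complex
        has_derivative_compose[OF bounded_linear.has_derivative[OF bounded_linear_complex_of_vec has_derivative_ident] this]]
    show ?thesis unfolding f_def f'_def by (rule has_derivative_at_withinI)
  qed
  have injf: "inj_on f S2"
  proof (rule inj_onI)
    fix x y assume xy: "x \<in> S2" "y \<in> S2" "f x = f y"
    then have "k (?T x) = k (?T y)" unfolding f_def by (metis complex_of_vec_inverse(2))
    then have "?T x = ?T y" using inj xy SK(3) unfolding S2_def inj_on_def by blast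
    then show "x = y" by (metis complex_of_vec_inverse(1))
  qed
  have det: "\<bar>det (matrix (f' x))\<bar> = (cmod (deriv k (?T x)))\<^sup>2" for x
    unfolding f'_def det_complex_multiplication by simp
  have Tc: "continuous_on K2 ?T" by (rule linear_continuous_on[OF bounded_linear_complex_of_vec])
  have TK: "?T ` K2 \<subseteq> U" using K(2) by (auto simp: K2_def)
  have dc: "continuous_on K2 (\<lambda>x. (cmod (deriv k (?T x)))\<^sup>2)"
    by (intro continuous_intros continuous_on_compose2[OF holomorphic_on_imp_continuous_on[OF holomorphic_deriv[OF U(2,1)]] Tc TK])
  have "set_integrable lborel K2 (\<lambda>x. (cmod (deriv k (?T x)))\<^sup>2)"
    unfolding set_integrable_def by (rule borel_integrable_compact[OF K2 dc])
  then have "set_integrable lborel S2 (\<lambda>x. (cmod (deriv k (?T x)))\<^sup>2)"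
    by (rule set_integrable_subset) (use S2b S2K in auto)
  then have int: "(\<lambda>x. (cmod (deriv k (?T x)))\<^sup>2) integrable_on S2"
    by (rule set_borel_integral_eq_integral(1))
  have int': "(\<lambda>x. \<bar>det (matrix (f' x))\<bar>) integrable_on S2" unfolding det by (rule int)
  have S2l: "S2 \<in> sets lebesgue" using S2b by simp
  note md = measurable_differentiable_image_eq[OF S2l df injf] measure_differentiable_image_eq[OF S2l df injf int']
  have fl: "f ` S2 \<in> lmeasurable" using md(1) int' by blast
  have S2lm: "S2 \<in> lmeasurable"
    using fmeasurableI2[of K2 lebesgue S2] lmeasurable_compact[OF K2] S2K S2l by blast
  have "m\<^sup>2 * measure lebesgue S2 = integral S2 (\<lambda>_. m\<^sup>2)"
    using S2lm by (simp add: lmeasure_integral integral_mult_right flip: integral_mult_right)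
  also have "\<dots> \<le> integral S2 (\<lambda>x. (cmod (deriv k (?T x)))\<^sup>2)"
  proof (rule integral_le)
    show "(\<lambda>_. m\<^sup>2) integrable_on S2" using S2lm by (rule integrable_on_const)
    fix x assume "x \<in> S2"
    then have "?T x \<in> R" using SK(3) by (auto simp: S2_def)
    from m(2)[OF this] m(1) show "m\<^sup>2 \<le> (cmod (deriv k (?T x)))\<^sup>2" by (intro power_mono) auto
  qed (rule int)
  also have "\<dots> = measure lebesgue (f ` S2)" using md(2) unfolding det by simp
  finally have le: "m\<^sup>2 * measure lebesgue S2 \<le> measure lebesgue (f ` S2)" .
  have sub: "f ` S2 \<subseteq> ?T -` Z" by (auto simp: f_def S2_def S_def)
  have "ennreal (m\<^sup>2) * emeasure lborel S = ennreal (m\<^sup>2) * emeasure lebesgue S2"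
    unfolding em[OF Sb, symmetric] S2_def[symmetric] using S2b by simp
  also have "\<dots> = ennreal (m\<^sup>2 * measure lebesgue S2)"
    using S2lm by (simp add: emeasure_eq_measure2 ennreal_mult)
  also have "\<dots> \<le> ennreal (measure lebesgue (f ` S2))" by (rule ennreal_leI[OF le])
  also have "\<dots> = emeasure lebesgue (f ` S2)" using fl by (simp add: emeasure_eq_measure2)
  also have "\<dots> \<le> emeasure lebesgue (?T -` Z)"
    by (rule emeasure_mono[OF sub]) (use measurable_sets[OF complex_of_vec_measurable Z] in simp)
  also have "\<dots> = emeasure lborel Z"
    using measurable_sets[OF complex_of_vec_measurable Z] em[OF Z] by simp
  finally show ?thesis unfolding S_def .
qed

text \<open>
  This is \<open>0 \<le> \<integral>|u - M|\<^sup>2\<close> for the mean \<open>M\<close> of \<open>u\<close>.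
\<close>

lemma norm_integral_square_le:
  fixes u :: "real \<Rightarrow> complex"
  assumes "continuous_on {0..1} u"
  shows "(cmod (integral {0..1} u))\<^sup>2 \<le> integral {0..1} (\<lambda>x. (cmod (u x))\<^sup>2)"
proof -
  define M where "M = integral {0..1} u"
  have i: "u integrable_on {0..1}" "(\<lambda>x. (cmod (u x))\<^sup>2) integrable_on {0..1}" "(\<lambda>x. M \<bullet> u x) integrable_on {0..1}"
    using assms by (auto intro!: integrable_continuous_real continuous_intros)
  have "integral {0..1} (\<lambda>x. M \<bullet> u x) = M \<bullet> M"
    using integral_linear[OF i(1) bounded_linear_inner_right[of M]] by (simp add: o_def M_def)
  moreover have "integral {0..1} (\<lambda>x. 2 * (M \<bullet> u x) - M \<bullet> M) \<le> integral {0..1} (\<lambda>x. (cmod (u x))\<^sup>2)"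
  proof (rule integral_le)
    show "(\<lambda>x. 2 * (M \<bullet> u x) - M \<bullet> M) integrable_on {0..1}"
      using assms by (auto intro!: integrable_continuous_real continuous_intros)
    fix x :: real
    have "0 \<le> (M \<bullet> M - M \<bullet> u x) - (M \<bullet> u x - u x \<bullet> u x)"
      using inner_ge_zero[of "M - u x"] unfolding inner_diff_left inner_diff_right inner_commute[of "u x" M] .
    then show "2 * (M \<bullet> u x) - M \<bullet> M \<le> (cmod (u x))\<^sup>2"
      unfolding power2_norm_eq_inner by linarith
  qed (rule i(2))
  moreover have "integral {0..1} (\<lambda>x. 2 * (M \<bullet> u x) - M \<bullet> M) = 2 * integral {0..1} (\<lambda>x. M \<bullet> u x) - M \<bullet> M"
    using i(3) by (subst Henstock_Kurzweil_Integration.integral_diff) (auto intro: integrable_on_cmult_left)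
  ultimately show ?thesis by (simp add: M_def dot_square_norm)
qed

section \<open>The mean square over small circles\<close>

lemma nn_integral_measure_le:
  assumes sets: "sets N = sets M" and le: "\<And>B. B \<in> sets M \<Longrightarrow> c * emeasure N B \<le> emeasure M B"
    and u: "u \<in> borel_measurable M"
  shows "c * (\<integral>\<^sup>+x. u x \<partial>N) \<le> (\<integral>\<^sup>+x. u x \<partial>M)"
  using u
proof (induction rule: borel_measurable_induct)
  case (cong f g)
  have "(\<integral>\<^sup>+x. f x \<partial>N) = (\<integral>\<^sup>+x. g x \<partial>N)" "(\<integral>\<^sup>+x. f x \<partial>M) = (\<integral>\<^sup>+x. g x \<partial>M)"
    using cong(3) sets_eq_imp_space_eq[OF sets] by (auto intro!: nn_integral_cong)
  then show ?case using cong(4) by simp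
next
  case (set A)
  then show ?case using le[OF set] sets by simp
next
  case (mult u d)
  have m: "u \<in> borel_measurable N" using mult(2) by (subst measurable_cong_sets[OF sets refl])
  have "c * (d * (\<integral>\<^sup>+x. u x \<partial>N)) = d * (c * (\<integral>\<^sup>+x. u x \<partial>N))" by (simp add: mult_ac)
  also have "\<dots> \<le> d * (\<integral>\<^sup>+x. u x \<partial>M)" by (rule mult_left_mono[OF mult(4)]) simp
  finally show ?case using mult(2) m by (simp add: nn_integral_cmult)
next
  case (add u v)
  have m: "w \<in> borel_measurable N" if "w \<in> borel_measurable M" for w :: "_ \<Rightarrow> ennreal"
    using that by (subst measurable_cong_sets[OF sets refl])
  show ?case using add m[OF add(1)] m[OF add(3)] by (simp add: nn_integral_add distrib_left add_mono)
next
  case (seq U)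
  have m: "U i \<in> borel_measurable N" for i using seq(1) by (subst measurable_cong_sets[OF sets refl])
  have N: "(\<integral>\<^sup>+x. (SUP i. U i) x \<partial>N) = (SUP i. \<integral>\<^sup>+x. U i x \<partial>N)"
    unfolding SUP_apply by (rule nn_integral_monotone_convergence_SUP[OF seq(3) m])
  have M: "(\<integral>\<^sup>+x. (SUP i. U i) x \<partial>M) = (SUP i. \<integral>\<^sup>+x. U i x \<partial>M)"
    unfolding SUP_apply by (rule nn_integral_monotone_convergence_SUP[OF seq(3) seq(1)])
  show ?case unfolding N M SUP_mult_left_ennreal by (rule SUP_mono) (use seq.IH in auto)
qed

lemma exp_Complex: "exp (Complex t s) = of_real (exp t) * cis s"
  by (simp add: exp_eq_polar)

context compact_hyperbolic_surface
begin

text \<open>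
  Near the puncture the cylinder \<open>{w. Re w < 0} / 2\<pi>\<i>\<close> embeds into the surface as a punctured disc
  around the centre, so circular means there are controlled by the \<open>L\<^sup>2\<close> norm.
\<close>

lemma circle_measure_bound:
  assumes vol: "volume_measure A \<rho> v" and E: "local_isometry A \<rho> (ball 0 1) E" and \<kappa>: "\<bar>\<kappa>\<bar> = 2 * pi"
  obtains b0 where "b0 < 0" "\<And>a b. b \<le> b0 \<Longrightarrow> \<exists>C>0. \<forall>B\<in>sets borel.
     ennreal C * emeasure lborel ({w. Re w \<in> {a..b} \<and> Im w / \<kappa> \<in> {0..<1}} \<inter> (E \<circ> exp) -` B) \<le> emeasure v B"
proof -
  define c where "c = chart_at A (E 0)"
  have c: "c \<in> A" "E 0 \<in> cdom c" unfolding c_def by (rule chart_at_props)+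
  have z0: "(0::complex) \<in> ball 0 1" by simp
  obtain \<delta> where \<delta>: "\<delta> > 0" "ball 0 \<delta> \<subseteq> ball (0::complex) 1" "E ` ball 0 \<delta> \<subseteq> cdom c"
    by (rule local_isometries_near[OF E z0 c open_UNIV UNIV_I])
  let ?g = "coord c \<circ> E"
  have h: "?g holomorphic_on ball 0 \<delta>"
    by (rule local_isometry_holomorphic[OF E open_ball \<delta>(2) c(1) \<delta>(3)])
  have nz: "deriv ?g z \<noteq> 0" if "z \<in> ball 0 \<delta>" for z
  proof
    assume "deriv ?g z = 0"
    moreover have "(cmod z)\<^sup>2 < 1" using subsetD[OF \<delta>(2) that] by (simp add: abs_square_less_1)
    ultimately show False
      using local_isometry_derivative(2)[OF E subsetD[OF \<delta>(2) that] c(1) subsetD[OF \<delta>(3) imageI[OF that]]] by simp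
  qed
  have z\<delta>: "0 \<in> ball (0::complex) \<delta>" using \<delta>(1) by simp
  obtain r where r: "r > 0" "ball 0 r \<subseteq> ball (0::complex) \<delta>" "inj_on ?g (ball 0 r)"
    using has_complex_derivative_locally_injective[OF h z\<delta> open_ball nz[OF z\<delta>]] by metis
  \<comment> \<open>\<open>r' \<le> 1\<close> makes the logarithm below nonpositive\<close>
  define r' where "r' = min r 1"
  have r': "0 < r'" "r' \<le> 1" "r' \<le> r" using r(1) by (auto simp: r'_def)
  define b0 where "b0 = ln (r' / 2)"
  have b0: "exp b0 < r'" "b0 < 0" using r' by (simp_all add: b0_def)
  show ?thesis
  proof (rule that[OF b0(2)])
    fix a b assume b: "b \<le> b0"
    define k where "k = ?g \<circ> exp"
    define U where "U = {w. Re w < ln r'}"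
    have U: "open U" unfolding U_def by (rule open_halfspace_Re_lt)
    have eU: "exp ` U \<subseteq> ball 0 r"
    proof
      fix x assume "x \<in> exp ` U"
      then obtain w where w: "Re w < ln r'" "x = exp w" by (auto simp: U_def)
      have "exp (Re w) < exp (ln r')" using w(1) by simp
      then show "x \<in> ball 0 r" using w(2) r' by (simp add: norm_exp_eq_Re)
    qed
    have eU': "exp w \<in> ball 0 r" "exp w \<in> ball 0 \<delta>" if "w \<in> U" for w using eU r(2) that by blast+
    have kh: "k holomorphic_on U"
      unfolding k_def by (rule holomorphic_on_compose_gen[OF _ h]) (use eU' in \<open>auto intro!: holomorphic_intros\<close>)
    have kd: "deriv k w \<noteq> 0" if "w \<in> U" for w
    proof -
      have "(k has_field_derivative deriv ?g (exp w) * exp w) (at w)"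
        unfolding k_def by (rule DERIV_chain[OF holomorphic_derivI[OF h open_ball eU'(2)[OF that]] DERIV_exp])
      then have "deriv k w = deriv ?g (exp w) * exp w" by (rule DERIV_imp_deriv)
      then show ?thesis using nz[OF eU'(2)[OF that]] by simp
    qed
    define K where "K = cbox (Complex a (- (2 * pi))) (Complex b (2 * pi))"
    have K: "compact K" unfolding K_def by (rule compact_cbox)
    have bln: "b < ln r'" using b b0(1) r'(1) by (metis exp_less_cancel_iff exp_ln le_less_trans not_le)
    have KU: "K \<subseteq> U" using bln by (auto simp: K_def U_def in_cbox_complex_iff)
    define R where "R = {w. Re w \<in> {a..b} \<and> Im w / \<kappa> \<in> {0..<1}}"
    have \<kappa>0: "\<kappa> \<noteq> 0" using \<kappa> by auto
    have RK: "R \<subseteq> K"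
    proof
      fix w assume w: "w \<in> R"
      have "\<bar>Im w\<bar> = \<bar>\<kappa>\<bar> * \<bar>Im w / \<kappa>\<bar>" using \<kappa>0 by (simp add: abs_divide)
      also have "\<dots> \<le> \<bar>\<kappa>\<bar> * 1" using w by (intro mult_left_mono) (auto simp: R_def)
      finally show "w \<in> K" using w \<kappa> by (auto simp: K_def R_def in_cbox_complex_iff)
    qed
    have Rb: "R \<in> sets borel"
    proof -
      have "R = (Re -` {a..b}) \<inter> ((\<lambda>w. Im w / \<kappa>) -` {0..<1})" by (auto simp: R_def)
      moreover have "Re -` {a..b} \<in> sets borel" "(\<lambda>w. Im w / \<kappa>) -` {0..<1} \<in> sets borel"
        using measurable_sets[of Re borel borel "{a..b}"] measurable_sets[of "\<lambda>w. Im w / \<kappa>" borel borel "{0..<1}"] by simp_all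
      ultimately show ?thesis by simp
    qed
    have injR: "inj_on k R"
    proof (rule inj_onI)
      fix w w' assume w: "w \<in> R" "w' \<in> R" "k w = k w'"
      have wU: "w \<in> U" "w' \<in> U" using w RK KU by blast+
      have "exp w = exp w'"
        using inj_onD[OF r(3), of "exp w" "exp w'"] w(3) eU'(1)[OF wU(1)] eU'(1)[OF wU(2)] by (simp add: k_def)
      then obtain n :: int where n: "w = w' + (of_int (2 * n) * pi) * \<i>" unfolding exp_eq by blast
      have "\<bar>Im w / \<kappa> - Im w' / \<kappa>\<bar> < 1" using w(1,2) by (auto simp: R_def)
      moreover have "Im w / \<kappa> - Im w' / \<kappa> = of_int n * (2 * pi / \<kappa>)" using \<kappa>0 by (simp add: n field_simps)
      moreover have "\<bar>2 * pi / \<kappa>\<bar> = 1" using \<kappa> by (simp add: abs_divide)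
      ultimately have "\<bar>real_of_int n\<bar> < 1" by (simp add: abs_mult)
      then have "n = 0" by linarith
      then show "w = w'" using n by simp
    qed
    show "\<exists>C>0. \<forall>B\<in>sets borel. ennreal C * emeasure lborel ({w. Re w \<in> {a..b} \<and> Im w / \<kappa> \<in> {0..<1}} \<inter> (E \<circ> exp) -` B) \<le> emeasure v B"
    proof (cases "K = {}")
      case True
      then have "R = {}" using RK by auto
      then show ?thesis unfolding R_def[symmetric] by (intro exI[of _ 1]) simp
    next
      case False
      have "continuous_on K (\<lambda>w. cmod (deriv k w))"
        using KU by (intro continuous_intros continuous_on_subset[OF holomorphic_on_imp_continuous_on[OF holomorphic_deriv[OF kh U]]])
      then obtain w1 where w1: "w1 \<in> K" "\<And>w. w \<in> K \<Longrightarrow> cmod (deriv k w1) \<le> cmod (deriv k w)"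
        using continuous_attains_inf[OF K False] by blast
      define m where "m = cmod (deriv k w1)"
      have m: "m > 0" using kd[of w1] w1(1) KU by (auto simp: m_def)
      have kS: "k ` U \<subseteq> coord c ` cdom c"
      proof
        fix x assume "x \<in> k ` U"
        then obtain w where w: "w \<in> U" "x = k w" by blast
        have "E (exp w) \<in> cdom c" by (rule subsetD[OF \<delta>(3) imageI[OF eU'(2)[OF w(1)]]])
        then show "x \<in> coord c ` cdom c" by (simp add: w(2) k_def)
      qed
      have kc: "continuous_on K k" by (rule continuous_on_subset[OF holomorphic_on_imp_continuous_on[OF kh] KU])
      have kK: "compact (k ` K)" by (rule compact_continuous_image[OF kc K])
      have "continuous_on (coord c ` cdom c) (\<rho> c)"
        using density_smooth[OF c(1)] C_on.simps(1) unfolding smooth_on_def by metis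
      then have "continuous_on (k ` K) (\<rho> c)"
        by (rule continuous_on_subset) (use kS KU in blast)
      then obtain \<zeta>1 where \<zeta>1: "\<zeta>1 \<in> k ` K" "\<And>\<zeta>. \<zeta> \<in> k ` K \<Longrightarrow> \<rho> c \<zeta>1 \<le> \<rho> c \<zeta>"
        using continuous_attains_inf[OF kK] False by blast
      define m2 where "m2 = \<rho> c \<zeta>1"
      have m2: "m2 > 0" unfolding m2_def by (rule density_pos[OF c(1)]) (use \<zeta>1(1) kS KU in blast)
      show ?thesis
      proof (intro exI[of _ "m2\<^sup>2 * m\<^sup>2"] conjI ballI)
        show "m2\<^sup>2 * m\<^sup>2 > 0" using m m2 by simp
        fix B :: "'a set" assume B: "B \<in> sets borel"
        define B' where "B' = B \<inter> cdom c"
        have B': "B' \<in> sets borel" using B open_cdom[OF c(1)] by (simp add: B'_def)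
        have img: "coord c ` B' = coord c ` cdom c \<inter> cinv c -` B"
        proof (intro equalityI subsetI)
          fix x assume "x \<in> coord c ` B'"
          then show "x \<in> coord c ` cdom c \<inter> cinv c -` B" using cinv_coord[OF c(1)] by (auto simp: B'_def)
        next
          fix x assume x: "x \<in> coord c ` cdom c \<inter> cinv c -` B"
          then obtain q where "q \<in> cdom c" "x = coord c q" by blast
          then show "x \<in> coord c ` B'" using x cinv_coord[OF c(1)] by (auto simp: B'_def)
        qed
        have imb: "coord c ` B' \<in> sets borel"
          unfolding img by (rule continuous_vimage_borel[OF open_coord_image[OF c(1)] continuous_cinv[OF c(1)] B])
        define Z where "Z = coord c ` B' \<inter> k ` K"
        have Z: "Z \<in> sets borel" unfolding Z_def by (rule sets.Int[OF imb borel_compact[OF kK]])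
        have sub: "R \<inter> (E \<circ> exp) -` B \<subseteq> R \<inter> k -` Z"
        proof
          fix w assume w: "w \<in> R \<inter> (E \<circ> exp) -` B"
          then have wK: "w \<in> K" "w \<in> U" using RK KU by blast+
          have "E (exp w) \<in> cdom c" using \<delta>(3) eU'(2)[OF wK(2)] by blast
          then have "E (exp w) \<in> B'" using w by (simp add: B'_def)
          then show "w \<in> R \<inter> k -` Z" using w wK(1) by (auto simp: Z_def k_def)
        qed
        have RZ: "R \<inter> k -` Z \<in> sets borel"
        proof -
          have "R \<inter> k -` Z = R \<inter> (U \<inter> k -` Z)" using RK KU by blast
          then show ?thesis using Rb continuous_vimage_borel[OF U holomorphic_on_imp_continuous_on[OF kh] Z] by simp
        qed
        have "ennreal (m2\<^sup>2 * m\<^sup>2) * emeasure lborel (R \<inter> (E \<circ> exp) -` B) \<le> ennreal (m2\<^sup>2 * m\<^sup>2) * emeasure lborel (R \<inter> k -` Z)"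
          by (intro mult_left_mono emeasure_mono sub) (use RZ in simp_all)
        also have "\<dots> = ennreal (m2\<^sup>2) * (ennreal (m\<^sup>2) * emeasure lborel (R \<inter> k -` Z))"
          by (simp add: ennreal_mult mult.assoc)
        also have "\<dots> \<le> ennreal (m2\<^sup>2) * emeasure lborel Z"
          by (intro mult_left_mono area_inverse_image[OF U kh K KU Rb RK injR m _ Z]) (use w1(2) RK in \<open>auto simp: m_def\<close>)
        also have "\<dots> = (\<integral>\<^sup>+\<zeta>\<in>Z. ennreal (m2\<^sup>2) \<partial>lborel)"
          using Z by (simp add: nn_integral_cmult_indicator)
        also have "\<dots> \<le> (\<integral>\<^sup>+\<zeta>\<in>coord c ` B'. ennreal ((\<rho> c \<zeta>)\<^sup>2) \<partial>lborel)"
        proof (rule nn_integral_mono)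
          fix \<zeta> :: complex
          show "ennreal (m2\<^sup>2) * indicator Z \<zeta> \<le> ennreal ((\<rho> c \<zeta>)\<^sup>2) * indicator (coord c ` B') \<zeta>"
          proof (cases "\<zeta> \<in> Z")
            case True
            then have "m2\<^sup>2 \<le> (\<rho> c \<zeta>)\<^sup>2" using \<zeta>1(2)[of \<zeta>] m2 by (intro power_mono) (auto simp: Z_def m2_def)
            then show ?thesis using True by (simp add: Z_def ennreal_leI)
          qed simp
        qed
        also have "\<dots> = emeasure v B'"
        proof -
          have "B' \<subseteq> cdom c" by (simp add: B'_def)
          then show ?thesis using vol c(1) B' unfolding volume_measure_def by simp
        qed
        also have "\<dots> \<le> emeasure v B"
          by (rule emeasure_mono) (use vol B in \<open>auto simp: B'_def volume_measure_def\<close>)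
        finally show "ennreal (m2\<^sup>2 * m\<^sup>2) * emeasure lborel ({w. Re w \<in> {a..b} \<and> Im w / \<kappa> \<in> {0..<1}} \<inter> (E \<circ> exp) -` B) \<le> emeasure v B"
          unfolding R_def .
      qed
    qed
  qed
qed

text \<open>
  The Cauchy-Schwarz inequality on each circle, and Fubini's theorem in the logarithmic coordinate to
  assemble the circles.
\<close>

lemma mean_square_bound:
  assumes vol: "volume_measure A \<rho> v" and E: "local_isometry A \<rho> (ball 0 1) E" and \<kappa>: "\<bar>\<kappa>\<bar> = 2 * pi"
  obtains b0 where "b0 < 0" "\<And>a b. b \<le> b0 \<Longrightarrow> \<exists>C>0. \<forall>\<phi>. continuous_on UNIV \<phi> \<longrightarrow>
     continuous_on {a..b} (\<lambda>t. integral {0..1} (\<lambda>\<theta>. \<phi> (E (exp (Complex t (\<kappa> * \<theta>)))))) \<longrightarrow>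
     (\<integral>\<^sup>+p. ennreal ((cmod (\<phi> p))\<^sup>2) \<partial>v) = 1 \<longrightarrow>
     integral {a..b} (\<lambda>t. (cmod (integral {0..1} (\<lambda>\<theta>. \<phi> (E (exp (Complex t (\<kappa> * \<theta>)))))))\<^sup>2) \<le> C"
proof -
  obtain b0 where b0: "b0 < 0" and meas: "\<And>a b. b \<le> b0 \<Longrightarrow> \<exists>C>0. \<forall>B\<in>sets borel.
     ennreal C * emeasure lborel ({w. Re w \<in> {a..b} \<and> Im w / \<kappa> \<in> {0..<1}} \<inter> (E \<circ> exp) -` B) \<le> emeasure v B"
    by (rule circle_measure_bound[OF vol E \<kappa>]) (rule that)
  have \<kappa>0: "\<kappa> \<noteq> 0" using \<kappa> by auto
  show ?thesis
  proof (rule that[OF b0])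
    fix a b assume b: "b \<le> b0"
    define R where "R = {w. Re w \<in> {a..b} \<and> Im w / \<kappa> \<in> {0..<1}}"
    obtain M where M: "M > 0" and le: "\<And>B. B \<in> sets borel \<Longrightarrow> ennreal M * emeasure lborel (R \<inter> (E \<circ> exp) -` B) \<le> emeasure v B"
      using meas[OF b, of a] unfolding R_def by blast
    have Rb: "R \<in> sets borel"
    proof -
      have "R = (Re -` {a..b}) \<inter> ((\<lambda>w. Im w / \<kappa>) -` {0..<1})" by (auto simp: R_def)
      moreover have "Re -` {a..b} \<in> sets borel" "(\<lambda>w. Im w / \<kappa>) -` {0..<1} \<in> sets borel"
        using measurable_sets[of Re borel borel "{a..b}"] measurable_sets[of "\<lambda>w. Im w / \<kappa>" borel borel "{0..<1}"] by simp_all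
      ultimately show ?thesis by simp
    qed
    have Rneg: "Re w < 0" if "w \<in> R" for w using that b b0 by (auto simp: R_def)
    have eR: "exp ` R \<subseteq> ball 0 1" using Rneg by auto
    define \<Psi> where "\<Psi> w = (if w \<in> R then (E \<circ> exp) w else E 0)" for w
    have \<Psi>: "\<Psi> \<in> borel_measurable borel"
      unfolding \<Psi>_def
      by (rule borel_measurable_continuous_on_if[OF Rb continuous_on_compose[OF _ continuous_on_subset[OF local_isometryD(3)[OF E] eR]] continuous_on_const])
        (intro continuous_intros)
    have sv: "sets v = sets borel" using vol by (simp add: volume_measure_def)
    define N where "N = distr (density lborel (indicator R)) borel \<Psi>"
    have sN: "sets N = sets v" unfolding N_def using sv by simp
    have \<Psi>': "\<Psi> \<in> measurable (density lborel (indicator R)) borel" using \<Psi> by simp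
    have N: "ennreal M * emeasure N B \<le> emeasure v B" if B: "B \<in> sets v" for B
    proof -
      have Bb: "B \<in> sets borel" using B sv by simp
      have vb: "\<Psi> -` B \<in> sets borel" using measurable_sets[OF \<Psi> Bb] by simp
      have "emeasure N B = emeasure (density lborel (indicator R)) (\<Psi> -` B)"
        unfolding N_def using emeasure_distr[OF \<Psi>' Bb] by simp
      also have "\<dots> = (\<integral>\<^sup>+w. indicator R w * indicator (\<Psi> -` B) w \<partial>lborel)"
        by (rule emeasure_density) (use Rb vb in auto)
      also have "\<dots> = (\<integral>\<^sup>+w. indicator (R \<inter> \<Psi> -` B) w \<partial>lborel)"
        by (simp add: indicator_inter_arith)
      also have "\<dots> = emeasure lborel (R \<inter> \<Psi> -` B)"
        by (rule nn_integral_indicator) (use Rb vb in auto)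
      also have "R \<inter> \<Psi> -` B = R \<inter> (E \<circ> exp) -` B" by (auto simp: \<Psi>_def)
      finally show ?thesis using le[OF Bb] by simp
    qed
    define C where "C = 1 / (2 * pi * M)"
    show "\<exists>C>0. \<forall>\<phi>. continuous_on UNIV \<phi> \<longrightarrow>
     continuous_on {a..b} (\<lambda>t. integral {0..1} (\<lambda>\<theta>. \<phi> (E (exp (Complex t (\<kappa> * \<theta>)))))) \<longrightarrow>
     (\<integral>\<^sup>+p. ennreal ((cmod (\<phi> p))\<^sup>2) \<partial>v) = 1 \<longrightarrow>
     integral {a..b} (\<lambda>t. (cmod (integral {0..1} (\<lambda>\<theta>. \<phi> (E (exp (Complex t (\<kappa> * \<theta>)))))))\<^sup>2) \<le> C"
    proof (intro exI[of _ C] conjI allI impI)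
      show "C > 0" using M by (simp add: C_def)
      fix \<phi> :: "'a \<Rightarrow> complex"
      assume \<phi>c: "continuous_on UNIV \<phi>"
        and Fc: "continuous_on {a..b} (\<lambda>t. integral {0..1} (\<lambda>\<theta>. \<phi> (E (exp (Complex t (\<kappa> * \<theta>))))))"
        and n1: "(\<integral>\<^sup>+p. ennreal ((cmod (\<phi> p))\<^sup>2) \<partial>v) = 1"
      define F where "F t = integral {0..1} (\<lambda>\<theta>. \<phi> (E (exp (Complex t (\<kappa> * \<theta>)))))" for t
      have Fc': "continuous_on {a..b} F" using Fc unfolding F_def .
      define u where "u p = ennreal ((cmod (\<phi> p))\<^sup>2)" for p
      have \<phi>m: "\<phi> \<in> borel_measurable borel" by (rule borel_measurable_continuous_onI[OF \<phi>c])
      have um: "u \<in> borel_measurable borel" unfolding u_def using \<phi>m by measurable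
      have umv: "u \<in> borel_measurable v" using um by (subst measurable_cong_sets[OF sv refl])
      define f where "f w = indicator R w * u (\<Psi> w)" for w
      have fm: "f \<in> borel_measurable borel"
        unfolding f_def using Rb measurable_compose[OF \<Psi> um] by measurable
      have "(\<integral>\<^sup>+w. f w \<partial>lborel) = (\<integral>\<^sup>+p. u p \<partial>N)"
      proof -
        have "(\<integral>\<^sup>+p. u p \<partial>N) = (\<integral>\<^sup>+w. u (\<Psi> w) \<partial>density lborel (indicator R))"
          unfolding N_def by (rule nn_integral_distr[OF \<Psi>']) (simp add: um)
        also have "\<dots> = (\<integral>\<^sup>+w. indicator R w * u (\<Psi> w) \<partial>lborel)"
          by (rule nn_integral_density) (use Rb measurable_compose[OF \<Psi> um] in auto)
        finally show ?thesis unfolding f_def ..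
      qed
      then have Mf: "ennreal M * (\<integral>\<^sup>+w. f w \<partial>lborel) \<le> 1"
        using nn_integral_measure_le[OF sN N umv] n1 unfolding u_def by simp
      have Cm: "(\<lambda>(x, y). Complex x y) \<in> measurable (lborel \<Otimes>\<^sub>M lborel) borel"
      proof -
        have "(\<lambda>(x, y). Complex x y) = (\<lambda>p. of_real (fst p) + \<i> * of_real (snd p))"
          by (auto simp: fun_eq_iff complex_eq_iff)
        then show ?thesis by simp
      qed
      have Fub: "(\<integral>\<^sup>+w. f w \<partial>lborel) = (\<integral>\<^sup>+t. \<integral>\<^sup>+s. f (Complex t s) \<partial>lborel \<partial>lborel)"
      proof -
        have "(\<integral>\<^sup>+w. f w \<partial>lborel) = (\<integral>\<^sup>+w. f w \<partial>distr (lborel \<Otimes>\<^sub>M lborel) borel (\<lambda>(x, y). Complex x y))"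
          by (simp only: lborel_complex_prod)
        also have "\<dots> = (\<integral>\<^sup>+p. f ((\<lambda>(x, y). Complex x y) p) \<partial>(lborel \<Otimes>\<^sub>M lborel))"
          by (rule nn_integral_distr[OF Cm]) (simp add: fm)
        also have "\<dots> = (\<integral>\<^sup>+t. \<integral>\<^sup>+s. f ((\<lambda>(x, y). Complex x y) (t, s)) \<partial>lborel \<partial>lborel)"
          by (rule lborel.nn_integral_fst[symmetric]) (rule measurable_compose[OF Cm fm])
        finally show ?thesis by simp
      qed
      have slice: "ennreal (2 * pi * (cmod (F t))\<^sup>2) \<le> (\<integral>\<^sup>+s. f (Complex t s) \<partial>lborel)" if t: "t \<in> {a..b}" for t
      proof -
        define h where "h \<theta> = \<phi> (E (exp (Complex t (\<kappa> * \<theta>))))" for \<theta>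
        have t0: "t < 0" using t b b0 by simp
        have hc: "continuous_on {0..1} h"
        proof -
          have e: "exp (Complex t (\<kappa> * \<theta>)) = of_real (exp t) * cis (\<kappa> * \<theta>)" for \<theta> by (rule exp_Complex)
          have "continuous_on {0..1} (\<lambda>\<theta>. of_real (exp t) * cis (\<kappa> * \<theta>))" by (intro continuous_intros)
          moreover have "(\<lambda>\<theta>. of_real (exp t) * cis (\<kappa> * \<theta>)) ` {0..1} \<subseteq> ball 0 1" using t0 by (auto simp: norm_mult)
          ultimately have "continuous_on {0..1} (\<lambda>\<theta>. E (of_real (exp t) * cis (\<kappa> * \<theta>)))"
            by (rule continuous_on_compose2[OF local_isometryD(3)[OF E]])
          then show ?thesis unfolding h_def e by (rule continuous_on_compose2[OF \<phi>c]) simp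
        qed
        have Cm1: "(\<lambda>s. f (Complex t s)) \<in> borel_measurable borel"
        proof -
          have e: "Complex t = (\<lambda>s. of_real t + \<i> * of_real s)" by (auto simp: fun_eq_iff complex_eq_iff)
          have "Complex t \<in> borel_measurable borel" unfolding e by measurable
          then show ?thesis by (rule measurable_compose[OF _ fm])
        qed
        have fv: "f (Complex t (\<kappa> * \<theta>)) = ennreal ((cmod (h \<theta>))\<^sup>2) * indicator {0..<1} \<theta>" for \<theta>
          using t \<kappa>0 by (auto simp: f_def R_def \<Psi>_def u_def h_def indicator_def)
        have sq: "((\<lambda>\<theta>. (cmod (h \<theta>))\<^sup>2) has_integral integral {0..1} (\<lambda>\<theta>. (cmod (h \<theta>))\<^sup>2)) {0..1}"
          by (intro integrable_integral integrable_continuous_real continuous_intros hc)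
        have "ennreal ((cmod (F t))\<^sup>2) \<le> ennreal (integral {0..1} (\<lambda>\<theta>. (cmod (h \<theta>))\<^sup>2))"
          using norm_integral_square_le[OF hc] unfolding F_def h_def by (rule ennreal_leI)
        also have "\<dots> = (\<integral>\<^sup>+\<theta>. ennreal ((cmod (h \<theta>))\<^sup>2) * indicator {0..1} \<theta> \<partial>lborel)"
          by (rule nn_integral_has_integral_lebesgue'[OF _ sq, symmetric]) simp
        also have "\<dots> = (\<integral>\<^sup>+\<theta>. f (Complex t (\<kappa> * \<theta>)) \<partial>lborel)"
        proof (rule nn_integral_cong_AE)
          show "AE \<theta> in lborel. ennreal ((cmod (h \<theta>))\<^sup>2) * indicator {0..1} \<theta> = f (Complex t (\<kappa> * \<theta>))"
            using AE_lborel_singleton[of "1::real"] unfolding fv by eventually_elim (auto simp: indicator_def)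
        qed
        finally have 1: "ennreal ((cmod (F t))\<^sup>2) \<le> (\<integral>\<^sup>+\<theta>. f (Complex t (\<kappa> * \<theta>)) \<partial>lborel)" .
        have "ennreal (2 * pi * (cmod (F t))\<^sup>2) = ennreal \<bar>\<kappa>\<bar> * ennreal ((cmod (F t))\<^sup>2)"
          unfolding \<kappa> by (rule ennreal_mult) simp_all
        also have "\<dots> \<le> ennreal \<bar>\<kappa>\<bar> * (\<integral>\<^sup>+\<theta>. f (Complex t (\<kappa> * \<theta>)) \<partial>lborel)"
          by (rule mult_left_mono[OF 1]) simp
        also have "\<dots> = (\<integral>\<^sup>+s. f (Complex t s) \<partial>lborel)"
          using nn_integral_real_affine[OF Cm1 \<kappa>0, of 0] by simp
        finally show ?thesis .
      qed
      have iF: "((\<lambda>t. 2 * pi * (cmod (F t))\<^sup>2) has_integral integral {a..b} (\<lambda>t. 2 * pi * (cmod (F t))\<^sup>2)) {a..b}"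
        by (intro integrable_integral integrable_continuous_real continuous_intros Fc')
      define I where "I = integral {a..b} (\<lambda>t. (cmod (F t))\<^sup>2)"
      have I2: "integral {a..b} (\<lambda>t. 2 * pi * (cmod (F t))\<^sup>2) = 2 * pi * I"
        unfolding I_def by (rule Henstock_Kurzweil_Integration.integral_mult_right)
      have I0: "I \<ge> 0" unfolding I_def by (rule Henstock_Kurzweil_Integration.integral_nonneg)
          (auto intro!: integrable_continuous_real continuous_intros Fc')
      have "ennreal (2 * pi * I) = (\<integral>\<^sup>+t. ennreal (2 * pi * (cmod (F t))\<^sup>2) * indicator {a..b} t \<partial>lborel)"
        unfolding I2[symmetric] by (rule nn_integral_has_integral_lebesgue'[OF _ iF, symmetric]) simp
      also have "\<dots> \<le> (\<integral>\<^sup>+t. \<integral>\<^sup>+s. f (Complex t s) \<partial>lborel \<partial>lborel)"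
        by (rule nn_integral_mono) (use slice in \<open>auto simp: indicator_def\<close>)
      finally have "ennreal M * ennreal (2 * pi * I) \<le> ennreal M * (\<integral>\<^sup>+w. f w \<partial>lborel)"
        unfolding Fub by (rule mult_left_mono) simp
      also note Mf
      finally have "ennreal (M * (2 * pi * I)) \<le> ennreal 1" using M I0 by (simp add: ennreal_mult)
      then have "M * (2 * pi * I) \<le> 1" by (subst (asm) ennreal_le_iff) simp_all
      then have "I \<le> C" using M by (simp add: C_def field_simps)
      then show "integral {a..b} (\<lambda>t. (cmod (integral {0..1} (\<lambda>\<theta>. \<phi> (E (exp (Complex t (\<kappa> * \<theta>)))))))\<^sup>2) \<le> C"
        unfolding I_def F_def .
    qed
  qed
qed

end

section \<open>The bound for circle integrals\<close>

theorem corollaryA: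
  fixes A :: "('a::t2_space) chart set"
    and \<rho> :: "'a chart \<Rightarrow> complex \<Rightarrow> real"
    and v :: "'a measure"
    and y :: 'a and r :: real
    and u1 u2 :: "'a chart \<Rightarrow> complex"
  assumes "compact_hyperbolic_surface A \<rho>"
    and "volume_measure A \<rho> v"
    and "orthonormal_frame A \<rho> y u1 u2"
    and "r > 0"
  shows "\<exists>C>0. \<forall>\<phi>. eigenfunction A \<rho> \<phi> \<and> L2_norm v \<phi> = 1 \<longrightarrow>
           cmod (line_integral A \<rho> (geodesic_circle A \<rho> y u1 u2 r) \<phi>) \<le> C"
proof -
  interpret compact_hyperbolic_surface A \<rho> by (rule assms(1))
  obtain E \<epsilon> where E: "local_isometry A \<rho> (ball 0 1) E" and \<epsilon>: "\<epsilon> = 1 \<or> \<epsilon> = (-1 :: real)"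
    and circ: "\<And>r \<theta>. geodesic_circle A \<rho> y u1 u2 r \<theta> = E (of_real (tanh (r / 2)) * cis (\<epsilon> * (2 * pi * \<theta>)))"
    by (rule geodesic_circle_developed[OF assms(3)]) (rule that)
  define R where "R = tanh (r / 2)"
  have R: "0 < R" "R < 1" using assms(4) tanh_real_lt_1[of "r / 2"] by (auto simp: R_def)
  define T where "T = ln R"
  have T: "T < 0" "exp T = R" using R by (auto simp: T_def)
  define \<kappa> where "\<kappa> = \<epsilon> * (2 * pi)"
  have \<kappa>: "\<bar>\<kappa>\<bar> = 2 * pi" "\<kappa> \<noteq> 0" using \<epsilon> by (auto simp: \<kappa>_def)
  obtain b0 where b0: "b0 < 0" and msq: "\<And>a b. b \<le> b0 \<Longrightarrow> \<exists>C>0. \<forall>\<phi>. continuous_on UNIV \<phi> \<longrightarrow>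
     continuous_on {a..b} (\<lambda>t. integral {0..1} (\<lambda>\<theta>. \<phi> (E (exp (Complex t (\<kappa> * \<theta>)))))) \<longrightarrow>
     (\<integral>\<^sup>+p. ennreal ((cmod (\<phi> p))\<^sup>2) \<partial>v) = 1 \<longrightarrow>
     integral {a..b} (\<lambda>t. (cmod (integral {0..1} (\<lambda>\<theta>. \<phi> (E (exp (Complex t (\<kappa> * \<theta>)))))))\<^sup>2) \<le> C"
    by (rule mean_square_bound[OF assms(2) E \<kappa>(1)]) (rule that)
  \<comment> \<open>an interval of radii that are both small and smaller than the given one\<close>
  define b where "b = min b0 T"
  define a where "a = b - 1"
  have ab: "a < b" "b \<le> T" "b \<le> b0" by (auto simp: a_def b_def)
  obtain C2 where C2: "C2 > 0" and msq2: "\<And>\<phi>. continuous_on UNIV \<phi> \<Longrightarrow>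
     continuous_on {a..b} (\<lambda>t. integral {0..1} (\<lambda>\<theta>. \<phi> (E (exp (Complex t (\<kappa> * \<theta>)))))) \<Longrightarrow>
     (\<integral>\<^sup>+p. ennreal ((cmod (\<phi> p))\<^sup>2) \<partial>v) = 1 \<Longrightarrow>
     integral {a..b} (\<lambda>t. (cmod (integral {0..1} (\<lambda>\<theta>. \<phi> (E (exp (Complex t (\<kappa> * \<theta>)))))))\<^sup>2) \<le> C2"
    using msq[OF ab(3), of a] by blast
  have neg: "t < 0" if "t \<in> {a..T}" for t using that T by simp
  define q where "q t = 1 / (sinh t)\<^sup>2" for t :: real
  define q' where "q' t = - (2 * cosh t / (sinh t) ^ 3)" for t :: real
  have dq: "(q has_real_derivative q' t) (at t)" if "t \<in> {a..T}" for t
  proof -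
    have s: "sinh t \<noteq> 0" using neg[OF that] by simp
    have "((\<lambda>t. (sinh t)\<^sup>2) has_real_derivative 2 * sinh t * cosh t) (at t)"
      by (auto intro!: derivative_eq_intros)
    from DERIV_divide[OF DERIV_const[of 1] this] s
    have "((\<lambda>t. 1 / (sinh t)\<^sup>2) has_real_derivative
        (0 * (sinh t)\<^sup>2 - 1 * (2 * sinh t * cosh t)) / ((sinh t)\<^sup>2 * (sinh t)\<^sup>2)) (at t)" by simp
    also have "(0 * (sinh t)\<^sup>2 - 1 * (2 * sinh t * cosh t)) / ((sinh t)\<^sup>2 * (sinh t)\<^sup>2) = q' t"
      using s by (simp add: q'_def field_simps eval_nat_numeral)
    finally show ?thesis unfolding q_def .
  qed
  have q'c: "continuous_on {a..T} q'"
    unfolding q'_def using neg by (intro continuous_intros) force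
  have qpos: "q t > 0" if "t \<in> {a..T}" for t using neg[OF that] by (simp add: q_def)
  obtain C1 where C1: "C1 > 0" and energy: "\<And>F F1 \<nu>. \<nu> \<ge> 0 \<Longrightarrow>
     \<forall>t\<in>{a..T}. ((F :: real \<Rightarrow> complex) has_vector_derivative F1 t) (at t) \<Longrightarrow>
     \<forall>t\<in>{a..T}. (F1 has_vector_derivative - (\<nu> * q t) *\<^sub>R F t) (at t) \<Longrightarrow>
     (cmod (F T))\<^sup>2 \<le> C1 * integral {a..b} (\<lambda>t. (cmod (F t))\<^sup>2)"
    by (rule energy_estimate[OF ab(1,2) _ q'c]) (rule dq, assumption, rule qpos, assumption, rule that)
  define L where "L = 4 * pi * R / (1 - R\<^sup>2)"
  have L: "L > 0" using R by (simp add: L_def abs_square_less_1)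
  have bound: "cmod (line_integral A \<rho> (geodesic_circle A \<rho> y u1 u2 r) \<phi>) \<le> L * sqrt (C1 * C2)"
    if eig: "eigenfunction A \<rho> \<phi>" and norm1: "L2_norm v \<phi> = 1" for \<phi>
  proof -
    obtain \<mu> where \<mu>: "eigenvalue A \<rho> \<phi> \<mu>" using eig unfolding eigenfunction_def eigenvalue_def by blast
    obtain p0 where "\<phi> p0 \<noteq> 0" using eig unfolding eigenfunction_def by blast
    then have \<mu>0: "\<mu> \<le> 0" by (rule eigenvalue_nonpos[OF \<mu>])
    have \<phi>c: "continuous_on UNIV \<phi>" by (rule eigenfunction_continuous[OF \<mu>])
    have i1: "(\<integral>p. (cmod (\<phi> p))\<^sup>2 \<partial>v) = 1" using norm1 by (simp add: L2_norm_def)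
    then have "integrable v (\<lambda>p. (cmod (\<phi> p))\<^sup>2)" using not_integrable_integral_eq by fastforce
    then have n1: "(\<integral>\<^sup>+p. ennreal ((cmod (\<phi> p))\<^sup>2) \<partial>v) = 1"
      using nn_integral_eq_integral[of v "\<lambda>p. (cmod (\<phi> p))\<^sup>2"] i1 by simp
    define h where "h = \<phi> \<circ> E \<circ> exp"
    note hp = eigenfunction_log_pullback[OF E \<mu>, folded h_def]
    have per: "h (w + \<i> * of_real \<kappa>) = h w" for w
    proof -
      have "cis \<kappa> = 1" using \<epsilon> by (auto simp: \<kappa>_def complex_eq_iff)
      then have "exp (\<i> * of_real \<kappa>) = 1" by (simp only: cis_conv_exp)
      then show ?thesis by (simp add: h_def exp_add)
    qed
    define F where "F t = integral {0..1} (\<lambda>\<theta>. h (Complex t (\<kappa> * \<theta>)))" for t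
    define F1 where "F1 t = integral {0..1} (\<lambda>\<theta>. pdx h (Complex t (\<kappa> * \<theta>)))" for t
    note ode = vertical_mean_ode[where q = "\<lambda>t. \<mu> / (sinh t)\<^sup>2", OF hp(1) per \<kappa>(2) hp(2) neg]
    have d1: "(F has_vector_derivative F1 t) (at t)" if "t \<in> {a..T}" for t
      unfolding F_def F1_def by (rule ode(1)[OF _ that])
    have d2: "(F1 has_vector_derivative - (- \<mu> * q t) *\<^sub>R F t) (at t)" if "t \<in> {a..T}" for t
      using ode(2)[OF _ that] unfolding F_def F1_def by (simp add: q_def)
    have Fh: "F t = integral {0..1} (\<lambda>\<theta>. \<phi> (E (exp (Complex t (\<kappa> * \<theta>)))))" for t
      by (simp add: F_def h_def)
    have Fc: "continuous_on {a..b} F"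
      by (rule continuous_on_vector_derivative[where f' = F1], rule has_vector_derivative_at_within, rule d1) (use ab in auto)
    have "(cmod (F T))\<^sup>2 \<le> C1 * integral {a..b} (\<lambda>t. (cmod (F t))\<^sup>2)"
      by (rule energy[of "- \<mu>" F F1]) (use \<mu>0 d1 d2 in simp_all)
    also have "\<dots> \<le> C1 * C2"
      using msq2[OF \<phi>c _ n1, folded Fh] Fc C1 by (intro mult_left_mono) (auto simp: Fh)
    finally have FT: "cmod (F T) \<le> sqrt (C1 * C2)" by (rule real_le_rsqrt)
    have g: "geodesic_circle A \<rho> y u1 u2 r = (\<lambda>\<theta>. E (of_real R * cis (\<epsilon> * (2 * pi * \<theta>))))"
      by (simp add: fun_eq_iff circ R_def)
    have "line_integral A \<rho> (geodesic_circle A \<rho> y u1 u2 r) \<phi> = L *\<^sub>R F T"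
      unfolding g line_integral_circle[OF E less_imp_le[OF R(1)] R(2) \<epsilon>] L_def Fh exp_Complex T(2)
      by (simp add: \<kappa>_def mult.assoc)
    then have "cmod (line_integral A \<rho> (geodesic_circle A \<rho> y u1 u2 r) \<phi>) = L * cmod (F T)" using L by simp
    also have "\<dots> \<le> L * sqrt (C1 * C2)" using FT L by (intro mult_left_mono) auto
    finally show ?thesis .
  qed
  have "L * sqrt (C1 * C2) > 0" using L C1 C2 by simp
  then show ?thesis using bound by blast
qed

end
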